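(* The following decision problem is $\mathsf{NP}$-complete: given a finite graph $G$ and vectors $\vec r,\vec c\in\mathbb{N}^2$, decide whether the edges of $G$ can be colored with $2$ colors so that the resulting $2$-edge-colored graph is $(\vec r,\vec c)$-triangle-regular.
   Context: For $t\in\mathbb{N}$ and $\vec r,\vec c\in\mathbb{N}^t$, a graph whose edges are each colored with one of the colors $1,\dots,t$ is $(\vec r,\vec c)$-triangle-regular if, for every vertex $v$ and every color $i\in\{1,\dots,t\}$, $v$ is incident to exactly $\vec r[i]$ edges of color $i$, and the open neighborhood $N(v)$ induces exactly $\vec c[i]$ edges of color $i$. *)

theory Defs
  imports "HOL-Computational_Algebra.Polynomial"
begin

section \<open>Polynomial time on deterministic multi-tape Turing machines\<close>

text \<open>
  States and tape symbols are initial segments of the natural numbers, since HOL cannot quantify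
  existentially over finite types.  Symbol 0 is the blank, 1 and 2 represent the bits 0 and 1.
  State 0 is the start state; 1 (accept) and 2 (reject) are the halting states.
  Tapes are infinite in both directions, and a tape is given with the position of its head.
\<close>

type_synonym tape = "(int \<Rightarrow> nat) \<times> int"
type_synonym config = "nat \<times> tape list"

record tm =
  tm_tapes :: nat
  tm_states :: nat
  tm_symbols :: nat
  tm_trans :: "nat \<Rightarrow> nat list \<Rightarrow> nat \<times> (nat \<times> int) list"

text \<open>
  A transition maps a state and the list of scanned symbols to the next state and, for each tape,
  the symbol to write and the direction in which to move.  Two tapes are required because tape 1
  holds the second input (of a verifier) or the output (of a function).
\<close>

definition wf_tm :: "tm \<Rightarrow> bool" where
  "wf_tm M \<longleftrightarrow> tm_tapes M \<ge> 2 \<and> tm_states M \<ge> 3 \<and> tm_symbols M \<ge> 3 \<and>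
     (\<forall>q as q' acts. q < tm_states M \<longrightarrow> length as = tm_tapes M \<longrightarrow> set as \<subseteq> {..<tm_symbols M} \<longrightarrow>
        tm_trans M q as = (q', acts) \<longrightarrow>
        q' < tm_states M \<and> length acts = tm_tapes M \<and> set acts \<subseteq> {..<tm_symbols M} \<times> {-1, 0, 1})"

definition halted :: "config \<Rightarrow> bool" where
  "halted C \<longleftrightarrow> fst C \<in> {1, 2}"

definition tm_step :: "tm \<Rightarrow> config \<Rightarrow> config" where
  "tm_step M C =
     (if halted C then C
      else let (q', acts) = tm_trans M (fst C) (map (\<lambda>(f, h). f h) (snd C))
           in (q', map2 (\<lambda>(f, h) (a, d). (f(h := a), h + d)) (snd C) acts))"

definition tape_content :: "bool list \<Rightarrow> int \<Rightarrow> nat" where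
  "tape_content w z =
     (if 0 \<le> z \<and> z < int (length w) then (if w ! nat z then 2 else 1) else 0)"

definition tm_init :: "tm \<Rightarrow> bool list list \<Rightarrow> config" where
  "tm_init M ws =
     (0, map (\<lambda>i. (tape_content (if i < length ws then ws ! i else []), 0)) [0..<tm_tapes M])"

definition tm_run :: "tm \<Rightarrow> bool list list \<Rightarrow> nat \<Rightarrow> config" where
  "tm_run M ws T = (tm_step M ^^ T) (tm_init M ws)"

definition polytime_decidable :: "(bool list \<Rightarrow> bool list \<Rightarrow> bool) \<Rightarrow> bool" where
  "polytime_decidable R \<longleftrightarrow>
     (\<exists>M (p :: nat poly). wf_tm M \<and>
        (\<forall>x y. \<exists>T \<le> poly p (length x + length y).
           fst (tm_run M [x, y] T) = (if R x y then 1 else 2)))"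

definition polytime_computable :: "(bool list \<Rightarrow> bool list) \<Rightarrow> bool" where
  "polytime_computable f \<longleftrightarrow>
     (\<exists>M (p :: nat poly). wf_tm M \<and>
        (\<forall>x. \<exists>T \<le> poly p (length x).
           halted (tm_run M [x] T) \<and> fst (snd (tm_run M [x] T) ! 1) = tape_content (f x)))"


section \<open>NP-completeness\<close>

definition NP :: "bool list set set" where
  "NP = {L. \<exists>R (p :: nat poly). polytime_decidable R \<and>
            (\<forall>x. x \<in> L \<longleftrightarrow> (\<exists>y. length y \<le> poly p (length x) \<and> R x y))}"

definition polytime_reducible :: "bool list set \<Rightarrow> bool list set \<Rightarrow> bool" where
  "polytime_reducible L L' \<longleftrightarrow> (\<exists>f. polytime_computable f \<and> (\<forall>x. x \<in> L \<longleftrightarrow> f x \<in> L'))"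

definition NP_hard :: "bool list set \<Rightarrow> bool" where
  "NP_hard L \<longleftrightarrow> (\<forall>L' \<in> NP. polytime_reducible L' L)"

definition NP_complete :: "bool list set \<Rightarrow> bool" where
  "NP_complete L \<longleftrightarrow> L \<in> NP \<and> NP_hard L"


section \<open>Triangle-regular edge-coloured graphs\<close>

definition finite_graph :: "'a set \<Rightarrow> 'a set set \<Rightarrow> bool" where
  "finite_graph V E \<longleftrightarrow> finite V \<and> (\<forall>e \<in> E. e \<subseteq> V \<and> card e = 2)"

definition neighborhood :: "'a set set \<Rightarrow> 'a \<Rightarrow> 'a set" where
  "neighborhood E v = {u. {u, v} \<in> E \<and> u \<noteq> v}"

definition edge_coloring :: "nat \<Rightarrow> 'a set set \<Rightarrow> ('a set \<Rightarrow> nat) \<Rightarrow> bool" where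
  "edge_coloring t E col \<longleftrightarrow> (\<forall>e \<in> E. col e \<in> {1..t})"

text \<open>
  A vector in the \<open>t\<close>-th power of the naturals is a list of length \<open>t\<close>; colors are counted from 1
  while list positions are counted from 0.
\<close>

definition triangle_regular ::
  "nat \<Rightarrow> nat list \<Rightarrow> nat list \<Rightarrow> 'a set \<Rightarrow> 'a set set \<Rightarrow> ('a set \<Rightarrow> nat) \<Rightarrow> bool" where
  "triangle_regular t r c V E col \<longleftrightarrow>
     (\<forall>v \<in> V. \<forall>i \<in> {1..t}.
        card {e \<in> E. v \<in> e \<and> col e = i} = r ! (i - 1) \<and>
        card {e \<in> E. e \<subseteq> neighborhood E v \<and> col e = i} = c ! (i - 1))"


section \<open>The decision problem as a language\<close>

fun binary :: "nat \<Rightarrow> bool list" where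
  "binary n = (if n = 0 then [] else odd n # binary (n div 2))"

declare binary.simps [simp del]

text \<open>Each binary digit is preceded by a 1, and a 0 marks the end of the number.\<close>

definition encode_nat :: "nat \<Rightarrow> bool list" where
  "encode_nat n = concat (map (\<lambda>b. [True, b]) (binary n)) @ [False]"

definition adjacency_matrix :: "nat \<Rightarrow> nat set set \<Rightarrow> bool list" where
  "adjacency_matrix n E = concat (map (\<lambda>u. map (\<lambda>v. {u, v} \<in> E) [0..<n]) [0..<n])"

definition encode_instance :: "nat \<Rightarrow> nat set set \<Rightarrow> nat list \<Rightarrow> nat list \<Rightarrow> bool list" where
  "encode_instance n E r c =
     encode_nat n @ adjacency_matrix n E @ concat (map encode_nat r) @ concat (map encode_nat c)"

definition triangle_regular_coloring_problem :: "nat \<Rightarrow> bool list set" where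
  "triangle_regular_coloring_problem t =
     {encode_instance n E r c | n E r c.
        finite_graph {..<n} E \<and> length r = t \<and> length c = t \<and>
        (\<exists>col. edge_coloring t E col \<and> triangle_regular t r c {..<n} E col)}"

text \<open>Distinct instances have distinct encodings, so membership is a property of the instance.\<close>

lemma binary_inject: "binary m = binary n \<Longrightarrow> m = n"
proof (induction m arbitrary: n rule: less_induct)
  case (less m)
  show ?case
  proof (cases "m = 0 \<or> n = 0")
    case True
    then show ?thesis
      using less.prems by (auto simp: binary.simps[of m] binary.simps[of n] split: if_splits)
  next
    case False
    then have "odd m = odd n" and "binary (m div 2) = binary (n div 2)"
      using less.prems by (auto simp: binary.simps[of m] binary.simps[of n])
    moreover from this(2) have "m div 2 = n div 2"
      using less.IH[of "m div 2"] False by simp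
    ultimately show ?thesis
      by (metis bit_eq_rec)
  qed
qed

lemma encode_nat_prefix:
  assumes "encode_nat m @ u = encode_nat n @ v"
  shows "m = n \<and> u = v"
proof -
  have *: "bs = cs \<and> u = v"
    if "concat (map (\<lambda>b. [True, b]) bs) @ False # u = concat (map (\<lambda>b. [True, b]) cs) @ False # v"
    for bs cs
    using that
  proof (induction bs arbitrary: cs)
    case Nil
    then show ?case by (cases cs) auto
  next
    case (Cons b bs)
    then show ?case by (cases cs) auto
  qed
  show ?thesis
    using *[of "binary m" "binary n"] assms binary_inject by (auto simp: encode_nat_def)
qed

lemma encode_nats_prefix:
  "length xs = length ys \<Longrightarrow> concat (map encode_nat xs) @ u = concat (map encode_nat ys) @ v
    \<Longrightarrow> xs = ys \<and> u = v"
  by (induction xs ys rule: list_induct2) (auto dest!: encode_nat_prefix)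

lemma adjacency_matrix_inject:
  assumes "finite_graph {..<n} E" "finite_graph {..<n} F" "adjacency_matrix n E = adjacency_matrix n F"
  shows "E = F"
proof -
  have rows: "map (\<lambda>u. map (\<lambda>v. {u, v} \<in> E) [0..<n]) [0..<n]
            = map (\<lambda>u. map (\<lambda>v. {u, v} \<in> F) [0..<n]) [0..<n]"
    using assms(3) unfolding adjacency_matrix_def
    by (rule concat_injective) (auto simp: set_zip)
  have eq: "{u, v} \<in> E \<longleftrightarrow> {u, v} \<in> F" if "u < n" "v < n" for u v
    using rows that by (auto simp: map_eq_conv)
  have "e \<in> E \<longleftrightarrow> e \<in> F" for e
  proof (cases "e \<subseteq> {..<n} \<and> card e = 2")
    case True
    then obtain u v where "e = {u, v}" by (auto simp: card_2_iff)
    with True eq show ?thesis by simp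
  next
    case False
    with assms(1,2) show ?thesis by (auto simp: finite_graph_def)
  qed
  then show ?thesis by blast
qed

lemma encode_instance_inject:
  assumes "encode_instance n E r c = encode_instance m F r' c'"
    and "finite_graph {..<n} E" "finite_graph {..<m} F"
    and "length r = t" "length c = t" "length r' = t" "length c' = t"
  shows "n = m \<and> E = F \<and> r = r' \<and> c = c'"
proof -
  have n: "n = m"
    and rest: "adjacency_matrix n E @ concat (map encode_nat r) @ concat (map encode_nat c)
             = adjacency_matrix m F @ concat (map encode_nat r') @ concat (map encode_nat c')"
    using assms(1) by (auto simp: encode_instance_def dest: encode_nat_prefix)
  have "length (adjacency_matrix n E) = length (adjacency_matrix m F)"
    by (simp add: adjacency_matrix_def length_concat n comp_def)
  with rest have "adjacency_matrix n E = adjacency_matrix m F"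
    and rc: "concat (map encode_nat r) @ concat (map encode_nat c)
           = concat (map encode_nat r') @ concat (map encode_nat c')"
    by auto
  then have "E = F"
    using adjacency_matrix_inject assms(2,3) n by blast
  moreover have "r = r'" "concat (map encode_nat c) = concat (map encode_nat c')"
    using encode_nats_prefix[OF _ rc] assms by auto
  moreover from this(2) have "c = c'"
    using encode_nats_prefix[of c c' "[]" "[]"] assms by auto
  ultimately show ?thesis using n by blast
qed

end

(*
  Membership: the certificate is the coloring.

  Hardness: the run of a verifier is encoded by cells whose values satisfy constraints of the form
  "the value of p lies in F iff the value of q lies in G".  Such constraints are equivalent to a system
  of rows, each of which demands that exactly one of its variables is selected, where every row has k
  variables, every variable lies in k rows and the rows can be indexed by the variables such that
  variable i lies in row i.

  In the graph a variable i is an edge between two vertices, and a vertex for each row is joined to both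
  ends of the edges of its variables.  The neighborhood of the vertex of a row then induces exactly the
  edges of its variables, so that c = (1, k - 1) expresses the demand of the row.  The two ends of
  variable i spend one edge of color 1 on row i, which makes exactly one edge in the neighborhood of the
  other end and two edges at the row have color 1.  What is left to adjust is the degree at the ends,
  which depends on whether i is selected; this is done by edges between 2 (k - 1) copies of the graph.
*)

theory Submission
  imports Defs
begin

section \<open>A structured counter language on Turing machines\<close>

text \<open>A row vertex has degree 2 k, an end without the copies only k + 1. The k - 1 missing
  edges must not lie in triangles, since the neighborhoods already have their induced edges:
  therefore they form a complete bipartite graph on k - 1 plus k - 1 copies and join only equal ends
  of the same variable. A perfect matching in it gets color 1 when the variable is not selected.

  The condition on two cells becomes a row made of F at p and the complement of G at q. Each cell
  selects one element, so exactly one selected element in the row means that both memberships agree.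
  Swapping the roles of p and q gives the complementary row; the two rows together contain every
  element of both cells once, which is what makes all columns equally large.

  The reduction has to be computed by a concrete machine. All numbers involved are polynomially
  bounded, so unary counters suffice, and every bit of the output is given by an arithmetic formula
  with bounded sums and quantifiers that is evaluated anew for each position.\<close>

type_synonym store = "(nat \<Rightarrow> nat) \<times> bool list"

text \<open>
  Register \<open>r\<close> is the head position on tape \<open>r\<close>.  Tape 0 holds the input, tape 1 holds the second
  component of the store, and every other tape carries the symbol 1 at position 0 and blanks
  elsewhere, so that scanning the symbol 1 is a zero test.
\<close>

definition tape_of :: "bool list \<Rightarrow> bool list \<Rightarrow> nat \<Rightarrow> int \<Rightarrow> nat" where
  "tape_of x z r = (if r = 0 then tape_content x else if r = 1 then tape_content z
     else (\<lambda>j. if j = 0 then 1 else 0))"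

definition scan :: "bool list \<Rightarrow> store \<Rightarrow> nat \<Rightarrow> nat" where
  "scan x s r = tape_of x (snd s) r (int (fst s r))"

datatype cmd = Skip | Inc nat | Dec nat | Out bool | Seq cmd cmd
  | Cond nat nat cmd cmd | Loop nat nat cmd

text \<open>The step counts include the jumps of the compiled code: \<open>CondT\<close> pays for
  the test and for skipping the other branch, \<open>CondF\<close> only for the test,
  \<open>LoopS\<close> for the test and the jump back. There is no rule for \<open>Dec\<close> at 0,
  which would move a head to a negative position, nor for \<open>Out\<close> when head 1 is not on
  the first blank after the output.\<close>

inductive exec :: "bool list \<Rightarrow> cmd \<Rightarrow> store \<Rightarrow> nat \<Rightarrow> store \<Rightarrow> bool" for x where
  Skip: "exec x Skip s 0 s"
| Inc: "exec x (Inc r) (\<rho>, z) 1 (\<rho>(r := Suc (\<rho> r)), z)"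
| Dec: "\<rho> r > 0 \<Longrightarrow> exec x (Dec r) (\<rho>, z) 1 (\<rho>(r := \<rho> r - 1), z)"
| Out: "\<rho> 1 = length z \<Longrightarrow> exec x (Out b) (\<rho>, z) 1 (\<rho>, z @ [b])"
| Seq: "exec x c s n s' \<Longrightarrow> exec x c' s' n' s'' \<Longrightarrow> exec x (Seq c c') s (n + n') s''"
| CondT: "scan x s r = v \<Longrightarrow> exec x c s n s' \<Longrightarrow> exec x (Cond r v c c') s (n + 2) s'"
| CondF: "scan x s r \<noteq> v \<Longrightarrow> exec x c' s n s' \<Longrightarrow> exec x (Cond r v c c') s (n + 1) s'"
| LoopE: "scan x s r = v \<Longrightarrow> exec x (Loop r v c) s 1 s"
| LoopS: "scan x s r \<noteq> v \<Longrightarrow> exec x c s n s' \<Longrightarrow> exec x (Loop r v c) s' m s'' \<Longrightarrow>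
    exec x (Loop r v c) s (n + m + 2) s''"

fun width :: "cmd \<Rightarrow> nat" where
  "width Skip = 0"
| "width (Inc r) = Suc r"
| "width (Dec r) = Suc r"
| "width (Out b) = 2"
| "width (Seq c d) = max (width c) (width d)"
| "width (Cond r v c d) = max (Suc r) (max (width c) (width d))"
| "width (Loop r v c) = max (Suc r) (width c)"

section \<open>Compilation of programs to Turing machines\<close>

datatype instr = Move nat bool | Write bool | Branch nat nat nat nat

fun clen :: "cmd \<Rightarrow> nat" where
  "clen Skip = 0"
| "clen (Inc r) = 1"
| "clen (Dec r) = 1"
| "clen (Out b) = 1"
| "clen (Seq c d) = clen c + clen d"
| "clen (Cond r v c d) = clen c + clen d + 2"
| "clen (Loop r v c) = clen c + 2"

text \<open>The argument \<open>i\<close> is the absolute address of the first instruction; a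
  \<open>Branch\<close> with two equal targets serves as a jump.\<close>

fun compile :: "cmd \<Rightarrow> nat \<Rightarrow> instr list" where
  "compile Skip i = []"
| "compile (Inc r) i = [Move r True]"
| "compile (Dec r) i = [Move r False]"
| "compile (Out b) i = [Write b]"
| "compile (Seq c d) i = compile c i @ compile d (i + clen c)"
| "compile (Cond r v c d) i = Branch r v (i + 1) (i + clen c + 2) # compile c (i + 1) @
     Branch 0 0 (i + clen c + clen d + 2) (i + clen c + clen d + 2) # compile d (i + clen c + 2)"
| "compile (Loop r v c) i = Branch r v (i + clen c + 2) (i + 1) # compile c (i + 1) @ [Branch 0 0 i i]"

lemma length_compile [simp]: "length (compile c i) = clen c"
  by (induction c arbitrary: i) auto

definition keep :: "nat \<Rightarrow> nat list \<Rightarrow> (nat \<times> int) list" where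
  "keep K as = map (\<lambda>i. (as ! i, 0)) [0..<K]"

text \<open>Address \<open>j\<close> becomes state \<open>j + 3\<close>, since 0 is the start state
  and 1 and 2 halt. State 0 writes the zero marker on all tapes from 2 on. Redirecting targets
  outside the code to 0 keeps the machine well-formed for arbitrary code.\<close>

definition code_trans :: "nat \<Rightarrow> instr list \<Rightarrow> nat \<Rightarrow> nat list \<Rightarrow> nat \<times> (nat \<times> int) list" where
  "code_trans K is q as =
    (if q = 0 then (3, map (\<lambda>i. (if i < 2 then as ! i else 1, 0)) [0..<K])
     else if q - 3 < length is then
       (case is ! (q - 3) of
          Move r right \<Rightarrow> (q - 3 + 4, map (\<lambda>i. (as ! i, if i = r then (if right then 1 else -1) else 0)) [0..<K])
        | Write b \<Rightarrow> (q - 3 + 4, map (\<lambda>i. (if i = 1 then (if b then 2 else 1) else as ! i, 0)) [0..<K])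
        | Branch r v j j' \<Rightarrow> (let l = (if as ! r = v then j else j') in
            (if l \<le> length is then l + 3 else 0, keep K as)))
     else (if as ! 3 = 1 then 2 else 1, keep K as))"

text \<open>When the code has been executed, register 3 decides between acceptance and rejection.\<close>

definition code_tm :: "nat \<Rightarrow> instr list \<Rightarrow> tm" where
  "code_tm K is = \<lparr>tm_tapes = K, tm_states = length is + 4, tm_symbols = 3, tm_trans = code_trans K is\<rparr>"

lemma wf_code_tm: "K \<ge> 4 \<Longrightarrow> wf_tm (code_tm K is)"
proof -
  assume K: "K \<ge> 4"
  have "fst r < length is + 4 \<and> length (snd r) = K \<and> set (snd r) \<subseteq> {..<3} \<times> {-1, 0, 1}"
    if "length as = K" "set as \<subseteq> {..<3}" "r = code_trans K is q as" for q as r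
  proof -
    have nth: "as ! i < 3" if "i < K" for i
      using that \<open>length as = K\<close> \<open>set as \<subseteq> {..<3}\<close> by (meson lessThan_iff nth_mem subsetD)
    show ?thesis
      unfolding that(3) code_trans_def keep_def Let_def
      by (cases "is ! (q - 3)") (auto simp: nth split: if_splits)
  qed
  with K show ?thesis
    unfolding wf_tm_def code_tm_def by (simp; metis fst_conv snd_conv)
qed

definition tapes :: "nat \<Rightarrow> bool list \<Rightarrow> store \<Rightarrow> tape list" where
  "tapes K x s = map (\<lambda>r. (tape_of x (snd s) r, int (fst s r))) [0..<K]"

lemma tapes_init:
  assumes "K \<ge> 4" "length ws \<le> 2" "x = ws ! 0" "z = (if length ws = 2 then ws ! 1 else [])" "ws \<noteq> []"
  shows "tm_step (code_tm K is) (tm_init (code_tm K is) ws) = (3, tapes K x (\<lambda>_. 0, z))"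
proof -
  have blank: "(tape_content [])(0 := 1) = (\<lambda>j. if j = 0 then 1 else 0)"
    by (auto simp: tape_content_def)
  have ws: "length ws = 1 \<or> length ws = 2"
    using assms(2,5) by (cases ws) (auto simp: le_Suc_eq)
  define f where "f i = tape_content (if i < length ws then ws ! i else [])" for i
  have init: "tm_init (code_tm K is) ws = (0, map (\<lambda>i. (f i, 0)) [0..<K])"
    by (simp add: tm_init_def code_tm_def f_def)
  have "map (\<lambda>(f, h). f h) (map (\<lambda>i. (f i, 0::int)) [0..<K]) = map (\<lambda>i. f i 0) [0..<K]"
    by simp
  then have "tm_step (code_tm K is) (tm_init (code_tm K is) ws) =
      (3, map (\<lambda>i. ((f i)(0 := if i < 2 then f i 0 else 1), 0)) [0..<K])"
    unfolding init tm_step_def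
    by (auto simp: halted_def code_tm_def code_trans_def intro!: nth_equalityI)
  moreover have "(f i)(0 := if i < 2 then f i 0 else 1) = tape_of x z i" for i
    using ws assms blank by (auto simp: f_def tape_of_def less_2_cases_iff)
  ultimately show ?thesis by (simp add: tapes_def)
qed

lemma tm_step_code:
  assumes "i < length is"
  shows "tm_step (code_tm K is) (i + 3, tapes K x s) =
    (let as = map (scan x s) [0..<K]; (q', acts) = code_trans K is (i + 3) as
     in (q', map (\<lambda>r. ((tape_of x (snd s) r)(int (fst s r) := fst (acts ! r)), int (fst s r) + snd (acts ! r))) [0..<K]))"
proof -
  have len: "length (snd (code_trans K is (i + 3) as)) = K" for as
    by (auto simp: code_trans_def keep_def Let_def split: instr.splits)
  have "map (\<lambda>(f, h). f h) (tapes K x s) = map (scan x s) [0..<K]"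
    by (auto simp: tapes_def scan_def)
  then have "tm_step (code_tm K is) (i + 3, tapes K x s) =
    (let (q', acts) = code_trans K is (i + 3) (map (scan x s) [0..<K])
     in (q', map2 (\<lambda>(f, h) (a, d). (f(h := a), h + d)) (tapes K x s) acts))"
    by (simp add: tm_step_def halted_def code_tm_def)
  then show ?thesis
    using len[of "map (scan x s) [0..<K]"]
    by (auto simp: Let_def split_beta tapes_def intro!: nth_equalityI)
qed

lemma tape_content_snoc:
  "(tape_content z)(int (length z) := if b then 2 else 1) = tape_content (z @ [b])"
  by (auto simp: tape_content_def fun_eq_iff nth_append nat_less_iff)

lemma step_Move_inc:
  assumes "i < length is" "is ! i = Move r True" "r < K"
  shows "tm_step (code_tm K is) (i + 3, tapes K x (\<rho>, z)) = (i + 4, tapes K x (\<rho>(r := Suc (\<rho> r)), z))"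
  using assms unfolding tm_step_code[OF assms(1)]
  by (auto simp: code_trans_def Let_def tapes_def scan_def)

lemma step_Move_dec:
  assumes "i < length is" "is ! i = Move r False" "r < K" "\<rho> r > 0"
  shows "tm_step (code_tm K is) (i + 3, tapes K x (\<rho>, z)) = (i + 4, tapes K x (\<rho>(r := \<rho> r - 1), z))"
  using assms unfolding tm_step_code[OF assms(1)]
  by (auto simp: code_trans_def Let_def tapes_def scan_def)

lemma step_Write:
  assumes "i < length is" "is ! i = Write b" "1 < K" "\<rho> 1 = length z"
  shows "tm_step (code_tm K is) (i + 3, tapes K x (\<rho>, z)) = (i + 4, tapes K x (\<rho>, z @ [b]))"
  using assms tape_content_snoc[of z b] unfolding tm_step_code[OF assms(1)]
  by (auto simp: code_trans_def Let_def tapes_def scan_def tape_of_def)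

lemma step_Branch:
  assumes "i < length is" "is ! i = Branch r v j j'" "r < K" "j \<le> length is" "j' \<le> length is"
  shows "tm_step (code_tm K is) (i + 3, tapes K x s) = ((if scan x s r = v then j else j') + 3, tapes K x s)"
  using assms unfolding tm_step_code[OF assms(1)]
  by (auto simp: code_trans_def Let_def tapes_def scan_def keep_def)

text \<open>The surrounding code \<open>pre\<close> and \<open>post\<close> is arbitrary because the
  induction hypotheses are applied to subprograms in the middle of the code;
  \<open>length pre\<close> is the address at which the subprogram was compiled.\<close>

lemma exec_tm:
  assumes "exec x c s n s'" "is = pre @ compile c (length pre) @ post" "width c \<le> K" "K > 0"
  shows "(tm_step (code_tm K is) ^^ n) (length pre + 3, tapes K x s) =
    (length pre + clen c + 3, tapes K x s')"
  using assms
proof (induction arbitrary: pre post rule: exec.induct)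
  case (Skip s)
  then show ?case by simp
next
  case (Inc r \<rho> z)
  then show ?case using step_Move_inc[of "length pre" "is" r K x \<rho> z] by (simp add: nth_append)
next
  case (Dec \<rho> r z)
  then show ?case using step_Move_dec[of "length pre" "is" r K \<rho> x z] by (simp add: nth_append)
next
  case (Out \<rho> z b)
  then show ?case using step_Write[of "length pre" "is" b K \<rho> z x] by (simp add: nth_append)
next
  case (Seq c s n s' c' n' s'')
  have 1: "(tm_step (code_tm K is) ^^ n) (length pre + 3, tapes K x s) = (length pre + clen c + 3, tapes K x s')"
    using Seq.prems by (intro Seq.IH(1)[of _ "compile c' (length pre + clen c) @ post"]) auto
  have 2: "(tm_step (code_tm K is) ^^ n') (length (pre @ compile c (length pre)) + 3, tapes K x s') =
      (length (pre @ compile c (length pre)) + clen c' + 3, tapes K x s'')"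
    using Seq.prems by (intro Seq.IH(2)[of _ post]) auto
  show ?case using 1 2 by (simp add: add.commute[of n n'] funpow_add add.assoc)
next
  case (CondT s r v c n s' c')
  let ?M = "code_tm K is"
  let ?j = "length pre + clen c + clen c' + 2"
  let ?b = "Branch r v (length pre + 1) (length pre + clen c + 2)"
  let ?b' = "Branch 0 0 ?j ?j"
  have "is": "is = pre @ ?b # compile c (length pre + 1) @ ?b' # compile c' (length pre + clen c + 2) @ post"
    using CondT.prems by simp
  have len: "length is = length pre + clen c + clen c' + 2 + length post"
    by (simp add: "is")
  have 1: "tm_step ?M (length pre + 3, tapes K x s) = (length pre + 1 + 3, tapes K x s)"
    using CondT.hyps CondT.prems step_Branch[of "length pre" "is" r v _ _ K x s]
    by (simp add: "is" nth_append)
  have 2: "(tm_step ?M ^^ n) (length (pre @ [?b]) + 3, tapes K x s) = (length (pre @ [?b]) + clen c + 3, tapes K x s')"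
    using CondT.prems by (intro CondT.IH[of _ "?b' # compile c' (length pre + clen c + 2) @ post"]) auto
  have 3: "tm_step ?M ((length pre + 1 + clen c) + 3, tapes K x s') = (?j + 3, tapes K x s')"
    using CondT.prems step_Branch[of "length pre + 1 + clen c" "is" 0 0 ?j ?j K x s']
    by (simp add: "is" nth_append)
  have "(tm_step ?M ^^ (n + 2)) (length pre + 3, tapes K x s) =
      tm_step ?M ((tm_step ?M ^^ n) (tm_step ?M (length pre + 3, tapes K x s)))"
    by (simp add: funpow_swap1)
  then show ?case using 1 2 3 by (simp add: add.assoc)
next
  case (CondF s r v c' n s' c)
  let ?M = "code_tm K is"
  let ?j = "length pre + clen c + clen c' + 2"
  let ?b = "Branch r v (length pre + 1) (length pre + clen c + 2)"
  let ?b' = "Branch 0 0 ?j ?j"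
  let ?pre = "pre @ ?b # compile c (length pre + 1) @ [?b']"
  have "is": "is = pre @ ?b # compile c (length pre + 1) @ ?b' # compile c' (length pre + clen c + 2) @ post"
    using CondF.prems by simp
  have 1: "tm_step ?M (length pre + 3, tapes K x s) = (length pre + clen c + 2 + 3, tapes K x s)"
    using CondF.hyps CondF.prems step_Branch[of "length pre" "is" r v _ _ K x s]
    by (simp add: "is" nth_append)
  have 2: "(tm_step ?M ^^ n) (length ?pre + 3, tapes K x s) = (length ?pre + clen c' + 3, tapes K x s')"
    using CondF.prems by (intro CondF.IH[of _ post]) auto
  have "(tm_step ?M ^^ (n + 1)) (length pre + 3, tapes K x s) =
      (tm_step ?M ^^ n) (tm_step ?M (length pre + 3, tapes K x s))"
    by (simp add: funpow_swap1)
  then show ?case using 1 2 by (simp add: add.assoc)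
next
  case (LoopE s r v c)
  then show ?case
    using step_Branch[of "length pre" "is" r v "length pre + clen c + 2" "length pre + 1" K x s]
    by (simp add: nth_append)
next
  case (LoopS s r v c n s' m s'')
  let ?M = "code_tm K is"
  let ?b = "Branch r v (length pre + clen c + 2) (length pre + 1)"
  let ?b' = "Branch 0 0 (length pre) (length pre)"
  have "is": "is = pre @ ?b # compile c (length pre + 1) @ ?b' # post"
    using LoopS.prems by simp
  have 1: "tm_step ?M (length pre + 3, tapes K x s) = (length pre + 1 + 3, tapes K x s)"
    using LoopS.hyps LoopS.prems step_Branch[of "length pre" "is" r v _ _ K x s]
    by (simp add: "is" nth_append)
  have 2: "(tm_step ?M ^^ n) (length (pre @ [?b]) + 3, tapes K x s) = (length (pre @ [?b]) + clen c + 3, tapes K x s')"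
    using LoopS.prems by (intro LoopS.IH(1)[of _ "?b' # post"]) auto
  have 3: "tm_step ?M ((length pre + 1 + clen c) + 3, tapes K x s') = (length pre + 3, tapes K x s')"
    using LoopS.prems step_Branch[of "length pre + 1 + clen c" "is" 0 0 "length pre" "length pre" K x s']
    by (simp add: "is" nth_append)
  have 4: "(tm_step ?M ^^ m) (length pre + 3, tapes K x s') = (length pre + clen (Loop r v c) + 3, tapes K x s'')"
    using LoopS.prems by (intro LoopS.IH(2)[of _ post]) auto
  have "(tm_step ?M ^^ (n + m + 2)) (length pre + 3, tapes K x s) =
      (tm_step ?M ^^ m) (tm_step ?M ((tm_step ?M ^^ n) (tm_step ?M (length pre + 3, tapes K x s))))"
    by (simp add: funpow_swap1 add.commute[of n m] funpow_add)
  then show ?case using 1 2 3 4 by (simp add: add.assoc)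
qed

text \<open>One step raises a register by at most 1. This later turns a time bound for a program
  into a bound on the value that it computes.\<close>

lemma exec_growth: "exec x c s n s' \<Longrightarrow> fst s' r \<le> fst s r + n"
  by (induction rule: exec.induct) auto

definition machine :: "cmd \<Rightarrow> tm" where
  "machine c = code_tm (max 4 (width c)) (compile c 0)"

lemma wf_machine: "wf_tm (machine c)"
  by (simp add: machine_def wf_code_tm)

text \<open>The two extra steps are the initial writing of the zero markers and the final test of
  register 3.\<close>

lemma tm_run_machine:
  assumes "exec x c (\<lambda>_. 0, z) n (\<rho>, z')" "ws = [x] \<and> z = [] \<or> ws = [x, z]"
  shows "\<exists>t. tm_run (machine c) ws (n + 2) =
    (if \<rho> 3 = 0 then 2 else 1, tapes (max 4 (width c)) x (\<rho>, z'))"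
proof -
  let ?K = "max 4 (width c)"
  let ?M = "machine c"
  have 1: "tm_step ?M (tm_init ?M ws) = (3, tapes ?K x (\<lambda>_. 0, z))"
    using assms(2) unfolding machine_def by (intro tapes_init) auto
  have 2: "(tm_step ?M ^^ n) (3, tapes ?K x (\<lambda>_. 0, z)) = (clen c + 3, tapes ?K x (\<rho>, z'))"
    using exec_tm[OF assms(1), of "compile c 0" "[]" "[]" ?K] unfolding machine_def by simp
  have 3: "tm_step ?M (clen c + 3, tapes ?K x (\<rho>, z')) = (if \<rho> 3 = 0 then 2 else 1, tapes ?K x (\<rho>, z'))"
    by (auto simp: tm_step_def halted_def machine_def code_tm_def code_trans_def keep_def tapes_def
        tape_of_def intro!: nth_equalityI)
  have "tm_run ?M ws (n + 2) = tm_step ?M ((tm_step ?M ^^ n) (tm_step ?M (tm_init ?M ws)))"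
    by (simp add: tm_run_def funpow_swap1)
  with 1 2 3 show ?thesis by simp
qed

section \<open>Polynomial-time functionals\<close>

text \<open>The summand 2 keeps the base at least 2, so that constants and factors are absorbed by a
  larger exponent.\<close>

definition bound :: "nat \<Rightarrow> bool list \<Rightarrow> bool list \<Rightarrow> nat list \<Rightarrow> nat" where
  "bound k x z s = (length x + length z + sum_list s + 2) ^ k"

text \<open>The exponent may depend on the length of the environment: a program is built for a fixed
  list of registers, and bounds are only needed for that many entries.\<close>

definition pbounded :: "(bool list \<Rightarrow> bool list \<Rightarrow> nat list \<Rightarrow> nat) \<Rightarrow> bool" where
  "pbounded f \<longleftrightarrow> (\<forall>m. \<exists>k. \<forall>x z s. length s = m \<longrightarrow> f x z s \<le> bound k x z s)"

lemma pboundedE: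
  assumes "pbounded f"
  obtains k where "\<And>x z s. length s = m \<Longrightarrow> f x z s \<le> bound k x z s"
  using assms unfolding pbounded_def by meson

lemma pboundedI: "(\<And>x z s. f x z s \<le> bound k x z s) \<Longrightarrow> pbounded f"
  unfolding pbounded_def by blast

lemma pbounded_mono: "pbounded g \<Longrightarrow> (\<And>x z s. f x z s \<le> g x z s) \<Longrightarrow> pbounded f"
  unfolding pbounded_def by (meson le_trans)

lemma bound_mono: "sum_list s \<le> sum_list s' \<Longrightarrow> bound k x z s \<le> bound k x z s'"
  unfolding bound_def by (rule power_mono) auto

lemma pbounded_bound: "pbounded (bound k)"
  by (rule pboundedI[of "bound k" k]) simp

lemma pbounded_const: "pbounded (\<lambda>x z s. c)"
proof (rule pboundedI[where k = c])
  fix x z s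
  have "c \<le> 2 ^ c" by (simp add: less_imp_le)
  also have "\<dots> \<le> bound c x z s" unfolding bound_def by (rule power_mono) auto
  finally show "c \<le> bound c x z s" .
qed

lemma pbounded_mult:
  assumes "pbounded f" "pbounded g"
  shows "pbounded (\<lambda>x z s. f x z s * g x z s)"
  unfolding pbounded_def
proof
  fix m
  obtain k where "\<And>x z s. length s = m \<Longrightarrow> f x z s \<le> bound k x z s"
    using pboundedE[OF assms(1)] by blast
  moreover obtain l where "\<And>x z s. length s = m \<Longrightarrow> g x z s \<le> bound l x z s"
    using pboundedE[OF assms(2)] by blast
  ultimately show "\<exists>k. \<forall>x z s. length s = m \<longrightarrow> f x z s * g x z s \<le> bound k x z s"
    by (intro exI[of _ "k + l"]) (auto simp: bound_def power_add intro!: mult_mono)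
qed

text \<open>Reduced to products by f + g \<le> (1 + f) (1 + g); adding 1 costs one unit of the
  exponent.\<close>

lemma pbounded_add:
  assumes "pbounded f" "pbounded g"
  shows "pbounded (\<lambda>x z s. f x z s + g x z s)"
proof -
  have *: "pbounded (\<lambda>x z s. 1 + h x z s)" if "pbounded h" for h
    unfolding pbounded_def
  proof
    fix m
    obtain k where k: "\<And>x z s. length s = m \<Longrightarrow> h x z s \<le> bound k x z s"
      using pboundedE[OF \<open>pbounded h\<close>] by blast
    have "1 + h x z s \<le> bound (Suc k) x z s" if "length s = m" for x z s
    proof -
      have "1 \<le> bound k x z s" by (simp add: bound_def)
      then have "1 + h x z s \<le> 2 * bound k x z s" using k[OF that, of x z] by simp
      also have "\<dots> \<le> bound (Suc k) x z s" by (simp add: bound_def)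
      finally show ?thesis .
    qed
    then show "\<exists>k. \<forall>x z s. length s = m \<longrightarrow> 1 + h x z s \<le> bound k x z s" by blast
  qed
  have "pbounded (\<lambda>x z s. (1 + f x z s) * (1 + g x z s))"
    by (intro pbounded_mult * assms)
  then show ?thesis by (rule pbounded_mono) (simp add: algebra_simps)
qed

lemma pbounded_size: "pbounded (\<lambda>x z s. length x + length z + sum_list s + 2)"
  by (rule pboundedI[where k = 1]) (simp add: bound_def)

lemma pbounded_tl:
  assumes "pbounded f"
  shows "pbounded (\<lambda>x z s. f x z (tl s))"
  unfolding pbounded_def
proof
  fix m
  obtain k where k: "\<And>x z s. length s = m - 1 \<Longrightarrow> f x z s \<le> bound k x z s"
    using pboundedE[OF assms] by blast
  have "f x z (tl s) \<le> bound k x z s" if "length s = m" for x z s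
    using that by (intro order.trans[OF k bound_mono]) (cases s; simp)+
  then show "\<exists>k. \<forall>x z s. length s = m \<longrightarrow> f x z (tl s) \<le> bound k x z s" by blast
qed

text \<open>Composition of polynomials: if the pushed value has degree \<open>l\<close>, a bound of
  degree \<open>k\<close> becomes one of degree \<open>l * k\<close>.\<close>

lemma pbounded_Cons:
  assumes "pbounded f" "pbounded a"
  shows "pbounded (\<lambda>x z s. f x z (a x z s # s))"
  unfolding pbounded_def
proof
  fix m
  obtain k where k: "\<And>x z s. length s = Suc m \<Longrightarrow> f x z s \<le> bound k x z s"
    using pboundedE[OF assms(1)] by blast
  have "pbounded (\<lambda>x z s. (length x + length z + sum_list s + 2) + a x z s)"
    by (intro pbounded_add[OF pbounded_size] assms)
  then obtain l where
    l: "\<And>x z s. length s = m \<Longrightarrow> length x + length z + sum_list s + 2 + a x z s \<le> bound l x z s"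
    using pboundedE by blast
  have "f x z (a x z s # s) \<le> bound (l * k) x z s" if "length s = m" for x z s
  proof -
    have "f x z (a x z s # s) \<le> (length x + length z + sum_list s + 2 + a x z s) ^ k"
      using k[of "a x z s # s" x z] that by (simp add: bound_def add_ac)
    also have "\<dots> \<le> bound l x z s ^ k" by (rule power_mono[OF l[OF that]]) simp
    finally show ?thesis by (simp add: bound_def power_mult)
  qed
  then show "\<exists>k. \<forall>x z s. length s = m \<longrightarrow> f x z (a x z s # s) \<le> bound k x z s" by blast
qed

section \<open>Executions within a time bound\<close>

definition runs :: "bool list \<Rightarrow> cmd \<Rightarrow> store \<Rightarrow> nat \<Rightarrow> store \<Rightarrow> bool" where
  "runs x c s t s' \<longleftrightarrow> (\<exists>n \<le> t. exec x c s n s')"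

lemma runs_mono: "runs x c s t s' \<Longrightarrow> t \<le> t' \<Longrightarrow> runs x c s t' s'"
  unfolding runs_def by (meson le_trans)

lemma runs_Skip: "runs x Skip s 0 s"
  by (auto simp: runs_def intro: exec.intros)

lemma runs_Inc: "runs x (Inc r) (\<rho>, z) 1 (\<rho>(r := Suc (\<rho> r)), z)"
  unfolding runs_def by (intro exI[of _ 1] conjI exec.intros) auto

lemma runs_Dec: "\<rho> r > 0 \<Longrightarrow> runs x (Dec r) (\<rho>, z) 1 (\<rho>(r := \<rho> r - 1), z)"
  unfolding runs_def by (intro exI[of _ 1] conjI exec.intros) auto

lemma runs_Inc': "s' = (\<rho>(r := Suc (\<rho> r)), z) \<Longrightarrow> runs x (Inc r) (\<rho>, z) 1 s'"
  by (simp only: runs_Inc)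

lemma runs_Dec': "\<rho> r > 0 \<Longrightarrow> s' = (\<rho>(r := \<rho> r - 1), z) \<Longrightarrow> runs x (Dec r) (\<rho>, z) 1 s'"
  by (simp only: runs_Dec)

lemma runs_Out: "\<rho> 1 = length z \<Longrightarrow> runs x (Out b) (\<rho>, z) 1 (\<rho>, z @ [b])"
  unfolding runs_def by (intro exI[of _ 1] conjI exec.intros) auto

lemma runs_Seq: "runs x c s t s' \<Longrightarrow> runs x c' s' t' s'' \<Longrightarrow> runs x (Seq c c') s (t + t') s''"
  unfolding runs_def by (meson add_mono exec.Seq)

lemma runs_CondT: "scan x s r = v \<Longrightarrow> runs x c s t s' \<Longrightarrow> runs x (Cond r v c c') s (t + 2) s'"
  unfolding runs_def by (meson add_mono le_refl exec.CondT)

lemma runs_CondF: "scan x s r \<noteq> v \<Longrightarrow> runs x c' s t s' \<Longrightarrow> runs x (Cond r v c c') s (t + 2) s'"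
  unfolding runs_def by (meson add_mono one_le_numeral exec.CondF)

lemma runs_Loop:
  assumes "\<And>i. i < N \<Longrightarrow> scan x (S i) r \<noteq> v" "scan x (S N) r = v"
    and "\<And>i. i < N \<Longrightarrow> runs x c (S i) t (S (Suc i))"
  shows "runs x (Loop r v c) (S 0) (N * (t + 2) + 1) (S N)"
proof -
  \<comment> \<open>The induction is on the number \<open>j\<close> of iterations still to come,
    because \<open>LoopS\<close> adds an iteration at the front.\<close>
  have "runs x (Loop r v c) (S (N - j)) (j * (t + 2) + 1) (S N)" if "j \<le> N" for j
    using that
  proof (induction j)
    case 0
    then show ?case using assms(2) by (auto simp: runs_def intro!: exI[of _ 1] exec.LoopE)
  next
    case (Suc j)
    from Suc obtain m where m: "m \<le> j * (t + 2) + 1" "exec x (Loop r v c) (S (N - j)) m (S N)"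
      by (auto simp: runs_def)
    have "Suc (N - Suc j) = N - j" using Suc.prems by simp
    with assms(3)[of "N - Suc j"] Suc.prems obtain n where n: "n \<le> t" "exec x c (S (N - Suc j)) n (S (N - j))"
      by (auto simp: runs_def)
    have "exec x (Loop r v c) (S (N - Suc j)) (n + m + 2) (S N)"
      using assms(1)[of "N - Suc j"] Suc.prems n(2) m(2) by (intro exec.LoopS) auto
    with n m show ?case unfolding runs_def by (intro exI[of _ "n + m + 2"]) auto
  qed
  from this[of N] show ?thesis by simp
qed

lemma scan_counter: "r \<ge> 2 \<Longrightarrow> scan x (\<rho>, z) r = (if \<rho> r = 0 then 1 else 0)"
  by (simp add: scan_def tape_of_def)

definition clear :: "nat \<Rightarrow> cmd" where
  "clear a = Loop a 1 (Dec a)"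

definition transfer :: "nat \<Rightarrow> nat \<Rightarrow> cmd" where
  "transfer a b = Loop a 1 (Seq (Dec a) (Inc b))"

definition transfer2 :: "nat \<Rightarrow> nat \<Rightarrow> nat \<Rightarrow> cmd" where
  "transfer2 a b c = Loop a 1 (Seq (Dec a) (Seq (Inc b) (Inc c)))"

definition lower :: "nat \<Rightarrow> nat \<Rightarrow> cmd" where
  "lower a b = Loop a 1 (Seq (Dec a) (Dec b))"

definition lower2 :: "nat \<Rightarrow> nat \<Rightarrow> nat \<Rightarrow> cmd" where
  "lower2 a b c = Loop a 1 (Seq (Dec a) (Seq (Inc b) (Dec c)))"

lemma runs_clear:
  assumes "a \<ge> 2"
  shows "runs x (clear a) (\<rho>, z) (3 * \<rho> a + 1) (\<rho>(a := 0), z)"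
proof -
  define S where "S i = (\<rho>(a := \<rho> a - i), z)" for i
  have "runs x (Loop a 1 (Dec a)) (S 0) (\<rho> a * (1 + 2) + 1) (S (\<rho> a))"
  proof (rule runs_Loop)
    fix i assume "i < \<rho> a"
    then show "runs x (Dec a) (S i) (1) (S (Suc i))"
      using assms unfolding S_def
      by (intro runs_Dec') (auto simp: fun_eq_iff)
  qed (use assms in \<open>auto simp: S_def scan_counter\<close>)
  from runs_mono[OF this, of "3 * \<rho> a + 1"] show ?thesis by (simp add: S_def clear_def)
qed

lemma runs_transfer:
  assumes "a \<ge> 2" "a \<noteq> b"
  shows "runs x (transfer a b) (\<rho>, z) (4 * \<rho> a + 1) (\<rho>(a := 0, b := \<rho> b + \<rho> a), z)"
proof -
  define S where "S i = (\<rho>(a := \<rho> a - i, b := \<rho> b + i), z)" for i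
  have "runs x (Loop a 1 (Seq (Dec a) (Inc b))) (S 0) (\<rho> a * ((1 + 1) + 2) + 1) (S (\<rho> a))"
  proof (rule runs_Loop)
    fix i assume "i < \<rho> a"
    then show "runs x (Seq (Dec a) (Inc b)) (S i) ((1 + 1)) (S (Suc i))"
      using assms unfolding S_def
      by (intro runs_Seq[OF runs_Dec runs_Inc']) (auto simp: fun_eq_iff)
  qed (use assms in \<open>auto simp: S_def scan_counter\<close>)
  from runs_mono[OF this, of "4 * \<rho> a + 1"] show ?thesis by (simp add: S_def transfer_def)
qed

lemma runs_transfer2:
  assumes "a \<ge> 2" "a \<noteq> b" "a \<noteq> c" "b \<noteq> c"
  shows "runs x (transfer2 a b c) (\<rho>, z) (5 * \<rho> a + 1) (\<rho>(a := 0, b := \<rho> b + \<rho> a, c := \<rho> c + \<rho> a), z)"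
proof -
  define S where "S i = (\<rho>(a := \<rho> a - i, b := \<rho> b + i, c := \<rho> c + i), z)" for i
  have "runs x (Loop a 1 (Seq (Dec a) (Seq (Inc b) (Inc c)))) (S 0) (\<rho> a * ((1 + (1 + 1)) + 2) + 1) (S (\<rho> a))"
  proof (rule runs_Loop)
    fix i assume "i < \<rho> a"
    then show "runs x (Seq (Dec a) (Seq (Inc b) (Inc c))) (S i) ((1 + (1 + 1))) (S (Suc i))"
      using assms unfolding S_def
      by (intro runs_Seq[OF runs_Dec runs_Seq[OF runs_Inc runs_Inc']]) (auto simp: fun_eq_iff)
  qed (use assms in \<open>auto simp: S_def scan_counter\<close>)
  from runs_mono[OF this, of "5 * \<rho> a + 1"] show ?thesis by (simp add: S_def transfer2_def)
qed

lemma runs_lower: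
  assumes "a \<ge> 2" "a \<noteq> b" "\<rho> a \<le> \<rho> b"
  shows "runs x (lower a b) (\<rho>, z) (4 * \<rho> a + 1) (\<rho>(a := 0, b := \<rho> b - \<rho> a), z)"
proof -
  define S where "S i = (\<rho>(a := \<rho> a - i, b := \<rho> b - i), z)" for i
  have "runs x (Loop a 1 (Seq (Dec a) (Dec b))) (S 0) (\<rho> a * ((1 + 1) + 2) + 1) (S (\<rho> a))"
  proof (rule runs_Loop)
    fix i assume "i < \<rho> a"
    then show "runs x (Seq (Dec a) (Dec b)) (S i) ((1 + 1)) (S (Suc i))"
      using assms unfolding S_def
      by (intro runs_Seq[OF runs_Dec runs_Dec']) (auto simp: fun_eq_iff)
  qed (use assms in \<open>auto simp: S_def scan_counter\<close>)
  from runs_mono[OF this, of "4 * \<rho> a + 1"] show ?thesis by (simp add: S_def lower_def)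
qed

lemma runs_lower2:
  assumes "a \<ge> 2" "a \<noteq> b" "a \<noteq> c" "b \<noteq> c" "\<rho> a \<le> \<rho> c"
  shows "runs x (lower2 a b c) (\<rho>, z) (5 * \<rho> a + 1) (\<rho>(a := 0, b := \<rho> b + \<rho> a, c := \<rho> c - \<rho> a), z)"
proof -
  define S where "S i = (\<rho>(a := \<rho> a - i, b := \<rho> b + i, c := \<rho> c - i), z)" for i
  have "runs x (Loop a 1 (Seq (Dec a) (Seq (Inc b) (Dec c)))) (S 0) (\<rho> a * ((1 + (1 + 1)) + 2) + 1) (S (\<rho> a))"
  proof (rule runs_Loop)
    fix i assume "i < \<rho> a"
    then show "runs x (Seq (Dec a) (Seq (Inc b) (Dec c))) (S i) ((1 + (1 + 1))) (S (Suc i))"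
      using assms unfolding S_def
      by (intro runs_Seq[OF runs_Dec runs_Seq[OF runs_Inc runs_Dec']]) (auto simp: fun_eq_iff)
  qed (use assms in \<open>auto simp: S_def scan_counter\<close>)
  from runs_mono[OF this, of "5 * \<rho> a + 1"] show ?thesis by (simp add: S_def lower2_def)
qed

section \<open>Functionals computed by programs in polynomial time\<close>

text \<open>
  The list \<open>s\<close> of a functional \<open>f x z s\<close> is an environment.  A program for \<open>f\<close> has to exist for all
  registers \<open>rs\<close> in which the environment may be stored and for every target register above them.
\<close>

definition pc_at :: "(bool list \<Rightarrow> bool list \<Rightarrow> nat list \<Rightarrow> nat) \<Rightarrow> nat list \<Rightarrow> nat \<Rightarrow> cmd \<Rightarrow>
    (bool list \<Rightarrow> bool list \<Rightarrow> nat list \<Rightarrow> nat) \<Rightarrow> bool" where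
  "pc_at f rs T c t \<longleftrightarrow> (\<forall>x z \<rho>. (\<forall>r<3. \<rho> r = 0) \<longrightarrow> (\<forall>r\<ge>T. \<rho> r = 0) \<longrightarrow>
     runs x c (\<rho>, z) (t x z (map \<rho> rs)) (\<rho>(T := f x z (map \<rho> rs)), z))"

text \<open>Registers below 3 are reserved: 0 and 1 are the heads on the two data tapes and 2 is
  scratch, and all of them are back at 0 between programs. Registers above \<open>T\<close> are
  scratch as well.\<close>

definition pc :: "(bool list \<Rightarrow> bool list \<Rightarrow> nat list \<Rightarrow> nat) \<Rightarrow> bool" where
  "pc f \<longleftrightarrow> (\<forall>rs T. 3 \<le> T \<longrightarrow> set rs \<subseteq> {3..<T} \<longrightarrow> (\<exists>c t. pbounded t \<and> pc_at f rs T c t))"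

lemma pcE:
  assumes "pc f" "3 \<le> T" "set rs \<subseteq> {3..<T}"
  obtains c k where "pc_at f rs T c (bound k)"
proof -
  obtain c t where ct: "pbounded t" "pc_at f rs T c t"
    using assms unfolding pc_def by blast
  then obtain k where "\<And>x z s. length s = length rs \<Longrightarrow> t x z s \<le> bound k x z s"
    using pboundedE by blast
  with ct(2) have "pc_at f rs T c (bound k)"
    unfolding pc_at_def by (meson runs_mono length_map)
  then show ?thesis by (rule that)
qed

lemma pc_atD:
  assumes "pc_at f rs T c t" "\<forall>r<3. \<rho> r = 0" "\<forall>r\<ge>T. \<rho> r = 0" "s = map \<rho> rs"
  shows "runs x c (\<rho>, z) (t x z s) (\<rho>(T := f x z s), z)"
  using assms unfolding pc_at_def by blast

text \<open>Register \<open>T\<close> goes from 0 to the value of \<open>f\<close> and gains at most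
  1 per step, so the time bounds the value. Distinctness of \<open>rs\<close> allows an arbitrary
  \<open>s\<close> to be stored in the registers.\<close>

lemma pc_at_value_le:
  assumes "pc_at f rs T c t" "3 \<le> T" "distinct rs" "set rs \<subseteq> {3..<T}" "length s = length rs"
  shows "f x z s \<le> t x z s"
proof -
  define \<rho> where "\<rho> r = (case map_of (zip rs s) r of None \<Rightarrow> 0 | Some v \<Rightarrow> v)" for r
  have s: "s = map \<rho> rs"
    using assms(3,5) by (auto simp: \<rho>_def map_of_zip_nth intro!: nth_equalityI)
  have "\<rho> r = 0" if "r \<notin> set rs" for r
    using that by (auto simp: \<rho>_def split: option.split dest!: map_of_SomeD dest: set_zip_leftD)
  then have "\<forall>r<3. \<rho> r = 0" "\<forall>r\<ge>T. \<rho> r = 0"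
    using assms(4) by force+
  then have "runs x c (\<rho>, z) (t x z s) (\<rho>(T := f x z s), z)" and "\<rho> T = 0"
    using pc_atD[OF assms(1)] s by auto
  then obtain n where "n \<le> t x z s" "exec x c (\<rho>, z) n (\<rho>(T := f x z s), z)"
    by (auto simp: runs_def)
  from exec_growth[OF this(2), of T] this(1) \<open>\<rho> T = 0\<close> show ?thesis by simp
qed

lemma pc_pbounded:
  assumes "pc f"
  shows "pbounded f"
  unfolding pbounded_def
proof
  fix m
  obtain c k where c: "pc_at f [3..<3 + m] (3 + m) c (bound k)"
    by (rule pcE[OF assms, of "3 + m" "[3..<3 + m]"]) auto
  have "f x z s \<le> bound k x z s" if "length s = m" for x z s
    by (rule pc_at_value_le[OF c]) (use that in auto)
  then show "\<exists>k. \<forall>x z s. length s = m \<longrightarrow> f x z s \<le> bound k x z s" by blast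
qed

definition arg :: "nat \<Rightarrow> nat list \<Rightarrow> nat" where
  "arg k s = (if k < length s then s ! k else 0)"

lemma arg_Cons [simp]: "arg 0 (v # s) = v" "arg (Suc k) (v # s) = arg k s"
  by (simp_all add: arg_def)

lemma arg_tl [simp]: "arg k (tl s) = arg (Suc k) s"
  by (auto simp: arg_def nth_tl)

lemma pcI:
  assumes "\<And>rs T. 3 \<le> T \<Longrightarrow> set rs \<subseteq> {3..<T} \<Longrightarrow> \<exists>c t. pbounded t \<and> pc_at f rs T c t"
  shows "pc f"
  using assms by (auto simp: pc_def)

lemma pc_zero: "pc (\<lambda>x z s. 0)"
proof (rule pcI)
  fix rs T
  have "pc_at (\<lambda>x z s. 0) rs T Skip (\<lambda>_ _ _. 0)"
    unfolding pc_at_def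
  proof (intro allI impI)
    fix x z \<rho> assume "\<forall>r\<ge>T. \<rho> r = (0::nat)"
    then have "\<rho>(T := 0) = \<rho>" by auto
    then show "runs x Skip (\<rho>, z) 0 (\<rho>(T := 0), z)" using runs_Skip by simp
  qed
  then show "\<exists>c t. pbounded t \<and> pc_at (\<lambda>x z s. 0) rs T c t"
    using pbounded_const by blast
qed

lemma pc_Suc:
  assumes "pc f"
  shows "pc (\<lambda>x z s. Suc (f x z s))"
proof (rule pcI)
  fix rs :: "nat list" and T assume T: "3 \<le> T" "set rs \<subseteq> {3..<T}"
  obtain c k where c: "pc_at f rs T c (bound k)" using pcE[OF assms T] .
  have "pc_at (\<lambda>x z s. Suc (f x z s)) rs T (Seq c (Inc T)) (\<lambda>x z s. bound k x z s + 1)"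
    unfolding pc_at_def
  proof (intro allI impI)
    fix x z \<rho> assume "\<forall>r<3. \<rho> r = 0" "\<forall>r\<ge>T. \<rho> r = (0::nat)"
    then show "runs x (Seq c (Inc T)) (\<rho>, z) (bound k x z (map \<rho> rs) + 1)
      (\<rho>(T := Suc (f x z (map \<rho> rs))), z)"
      by (intro runs_Seq[OF pc_atD[OF c _ _ refl] runs_Inc']) auto
  qed
  then show "\<exists>c t. pbounded t \<and> pc_at (\<lambda>x z s. Suc (f x z s)) rs T c t"
    using pbounded_add[OF pbounded_bound pbounded_const] by blast
qed

lemma pc_arg: "pc (\<lambda>x z s. arg j s)"
proof (rule pcI)
  fix rs :: "nat list" and T assume T: "3 \<le> T" "set rs \<subseteq> {3..<T}"
  show "\<exists>c t. pbounded t \<and> pc_at (\<lambda>x z s. arg j s) rs T c t"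
  proof (cases "j < length rs")
    case True
    define r where "r = rs ! j"
    have r: "3 \<le> r" "r < T" using T(2) nth_mem[OF True] unfolding r_def by (meson atLeastLessThan_iff subsetD)+
    \<comment> \<open>A unary register can only be read by counting it down; register 2 keeps a
      second copy from which \<open>r\<close> is restored.\<close>
    have "pc_at (\<lambda>x z s. arg j s) rs T (Seq (transfer2 r T 2) (transfer 2 r))
        (\<lambda>x z s. 9 * sum_list s + 2)"
      unfolding pc_at_def
    proof (intro allI impI)
      fix x z \<rho> assume \<rho>: "\<forall>r<3. \<rho> r = 0" "\<forall>r\<ge>T. \<rho> r = (0::nat)"
      let ?\<rho> = "\<rho>(r := 0, T := \<rho> T + \<rho> r, 2 := \<rho> 2 + \<rho> r)"
      have 1: "runs x (transfer2 r T 2) (\<rho>, z) (5 * \<rho> r + 1) (?\<rho>, z)"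
        using r T by (intro runs_transfer2) auto
      have 2: "runs x (transfer 2 r) (?\<rho>, z) (4 * ?\<rho> 2 + 1) (?\<rho>(2 := 0, r := ?\<rho> r + ?\<rho> 2), z)"
        using r by (intro runs_transfer) auto
      have 3: "?\<rho>(2 := 0, r := ?\<rho> r + ?\<rho> 2) = \<rho>(T := arg j (map \<rho> rs))"
        using \<rho> r T True by (auto simp: fun_eq_iff arg_def r_def)
      have *: "runs x (Seq (transfer2 r T 2) (transfer 2 r)) (\<rho>, z)
          ((5 * \<rho> r + 1) + (4 * ?\<rho> 2 + 1)) (\<rho>(T := arg j (map \<rho> rs)), z)"
        using runs_Seq[OF 1 2] unfolding 3 .
      have "\<rho> r \<le> sum_list (map \<rho> rs)"
        using True by (intro member_le_sum_list) (auto simp: r_def)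
      moreover have "?\<rho> 2 = \<rho> r" using \<rho> r T by auto
      ultimately show "runs x (Seq (transfer2 r T 2) (transfer 2 r)) (\<rho>, z) (9 * sum_list (map \<rho> rs) + 2)
          (\<rho>(T := arg j (map \<rho> rs)), z)"
        by (intro runs_mono[OF *]) simp
    qed
    moreover have "pbounded (\<lambda>x z s. 9 * sum_list s + 2)"
      by (rule pbounded_mono[OF pbounded_mult[OF pbounded_const[of 9] pbounded_size]]) simp
    ultimately show ?thesis by blast
  next
    case False
    have "pc_at (\<lambda>x z s. arg j s) rs T Skip (\<lambda>_ _ _. 0)"
      unfolding pc_at_def
    proof (intro allI impI)
      fix x z \<rho> assume "\<forall>r\<ge>T. \<rho> r = (0::nat)"
      then have "\<rho>(T := arg j (map \<rho> rs)) = \<rho>" using False by (auto simp: arg_def)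
      then show "runs x Skip (\<rho>, z) 0 (\<rho>(T := arg j (map \<rho> rs)), z)" using runs_Skip by simp
    qed
    then show ?thesis using pbounded_const by blast
  qed
qed

lemma pc_tl:
  assumes "pc f"
  shows "pc (\<lambda>x z s. f x z (tl s))"
proof (rule pcI)
  fix rs :: "nat list" and T assume T: "3 \<le> T" "set rs \<subseteq> {3..<T}"
  then have T': "set (tl rs) \<subseteq> {3..<T}" by (cases rs) auto
  obtain c k where c: "pc_at f (tl rs) T c (bound k)" using pcE[OF assms T(1) T'] .
  have "pc_at (\<lambda>x z s. f x z (tl s)) rs T c (\<lambda>x z s. bound k x z (tl s))"
    using c by (simp add: pc_at_def map_tl)
  then show "\<exists>c t. pbounded t \<and> pc_at (\<lambda>x z s. f x z (tl s)) rs T c t"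
    using pbounded_tl[OF pbounded_bound] by blast
qed

text \<open>Local binding: the value of \<open>a\<close> occupies register \<open>T\<close> as the
  head of the environment while \<open>g\<close> is evaluated into \<open>Suc T\<close>; afterwards
  the result replaces it.\<close>

lemma pc_push:
  assumes "pc a" "pc g"
  shows "pc (\<lambda>x z s. g x z (a x z s # s))"
proof (rule pcI)
  fix rs :: "nat list" and T assume T: "3 \<le> T" "set rs \<subseteq> {3..<T}"
  obtain ca ka where ca: "pc_at a rs T ca (bound ka)" using pcE[OF assms(1) T] .
  have T': "3 \<le> Suc T" "set (T # rs) \<subseteq> {3..<Suc T}" using T by auto
  obtain cf kf where cf: "pc_at g (T # rs) (Suc T) cf (bound kf)"
    using pcE[OF assms(2) T'] .
  define c where "c = Seq ca (Seq cf (Seq (clear T) (transfer (Suc T) T)))"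
  define t where "t = (\<lambda>x z s. bound ka x z s + (bound kf x z (a x z s # s) +
      ((3 * a x z s + 1) + (4 * g x z (a x z s # s) + 1))))"
  have "pc_at (\<lambda>x z s. g x z (a x z s # s)) rs T c t"
    unfolding pc_at_def
  proof (intro allI impI)
    fix x z \<rho> assume \<rho>: "\<forall>r<3. \<rho> r = 0" "\<forall>r\<ge>T. \<rho> r = (0::nat)"
    define s where "s = map \<rho> rs"
    define \<rho>1 where "\<rho>1 = \<rho>(T := a x z s)"
    have m: "map \<rho>1 (T # rs) = a x z s # s"
      using T by (auto simp: \<rho>1_def s_def)
    have 1: "runs x ca (\<rho>, z) (bound ka x z s) (\<rho>1, z)"
      unfolding \<rho>1_def by (rule pc_atD[OF ca]) (use \<rho> in \<open>auto simp: s_def\<close>)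
    define \<rho>2 where "\<rho>2 = \<rho>1(Suc T := g x z (a x z s # s))"
    have 2: "runs x cf (\<rho>1, z) (bound kf x z (a x z s # s)) (\<rho>2, z)"
    proof -
      have "\<forall>r<3. \<rho>1 r = 0" "\<forall>r\<ge>Suc T. \<rho>1 r = 0" using \<rho> T by (auto simp: \<rho>1_def)
      from pc_atD[OF cf this m[symmetric]] show ?thesis by (simp add: \<rho>2_def)
    qed
    have 3: "runs x (clear T) (\<rho>2, z) (3 * a x z s + 1) (\<rho>2(T := 0), z)"
      using runs_clear[of T x \<rho>2 z] T by (simp add: \<rho>2_def \<rho>1_def)
    have 4: "runs x (transfer (Suc T) T) (\<rho>2(T := 0), z) (4 * g x z (a x z s # s) + 1) (\<rho>(T := g x z (a x z s # s)), z)"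
    proof -
      have "runs x (transfer (Suc T) T) (\<rho>2(T := 0), z) (4 * (\<rho>2(T := 0)) (Suc T) + 1)
          (\<rho>2(T := 0, Suc T := 0, T := (\<rho>2(T := 0)) T + (\<rho>2(T := 0)) (Suc T)), z)"
        using T by (intro runs_transfer) auto
      moreover have "\<rho>2(T := 0, Suc T := 0, T := (\<rho>2(T := 0)) T + (\<rho>2(T := 0)) (Suc T)) = \<rho>(T := g x z (a x z s # s))"
        using \<rho> by (auto simp: \<rho>2_def \<rho>1_def fun_eq_iff)
      moreover have "(\<rho>2(T := 0)) (Suc T) = g x z (a x z s # s)" by (simp add: \<rho>2_def)
      ultimately show ?thesis by simp
    qed
    show "runs x c (\<rho>, z) (t x z (map \<rho> rs)) (\<rho>(T := g x z (a x z (map \<rho> rs) # map \<rho> rs)), z)"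
      unfolding c_def t_def s_def[symmetric] by (intro runs_Seq[OF 1] runs_Seq[OF 2] runs_Seq[OF 3] 4)
  qed
  moreover have "pbounded t"
    unfolding t_def
    using pbounded_Cons[OF pc_pbounded[OF assms(2)] pc_pbounded[OF assms(1)]]
    by (intro pbounded_add pbounded_mult pbounded_const pbounded_bound pc_pbounded[OF assms(1)]
        pbounded_Cons[OF pbounded_bound pc_pbounded[OF assms(1)]]) simp
  ultimately show "\<exists>c t. pbounded t \<and> pc_at (\<lambda>x z s. g x z (a x z s # s)) rs T c t" by blast
qed

text \<open>Bounded recursion in the style of Cobham: the bound \<open>h\<close> on all intermediate
  values is essential, as iterated squaring would leave the polynomial range. Register
  \<open>T\<close> counts the remaining rounds, \<open>T + 1\<close> holds the index,
  \<open>T + 2\<close> the current and \<open>T + 3\<close> the next value.\<close>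

lemma pc_rec:
  assumes n: "pc n" and a: "pc a" and g: "pc (\<lambda>x z s. g (arg 1 s) (arg 0 s) x z (tl (tl s)))"
    and h: "pbounded h"
    and le: "\<And>x z s i. i \<le> n x z s \<Longrightarrow> rec_nat (a x z s) (\<lambda>i v. g i v x z s) i \<le> h x z s"
  shows "pc (\<lambda>x z s. rec_nat (a x z s) (\<lambda>i v. g i v x z s) (n x z s))"
proof (rule pcI)
  fix rs :: "nat list" and T assume T: "3 \<le> T" "set rs \<subseteq> {3..<T}"
  obtain cn kn where cn: "pc_at n rs T cn (bound kn)" using pcE[OF n T] .
  have "3 \<le> T + 2" "set rs \<subseteq> {3..<T + 2}" using T by auto
  from pcE[OF a this] obtain ca ka where ca: "pc_at a rs (T + 2) ca (bound ka)" .
  have "3 \<le> T + 3" "set ((T + 2) # (T + 1) # rs) \<subseteq> {3..<T + 3}" using T by auto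
  from pcE[OF g this] obtain cg kg where
    cg: "pc_at (\<lambda>x z s. g (arg 1 s) (arg 0 s) x z (tl (tl s))) ((T + 2) # (T + 1) # rs) (T + 3) cg (bound kg)" .
  define body where "body = Seq (Dec T) (Seq cg (Seq (clear (T + 2)) (Seq (transfer (T + 3) (T + 2)) (Inc (T + 1)))))"
  define c where "c = Seq cn (Seq ca (Seq (Loop T 1 body) (Seq (clear (T + 1)) (transfer (T + 2) T))))"
  define f where "f = (\<lambda>x z s. rec_nat (a x z s) (\<lambda>i v. g i v x z s))"
  define tb where "tb = (\<lambda>x z s. 1 + (bound kg x z (h x z s # n x z s # s) + ((3 * h x z s + 1) + ((4 * h x z s + 1) + 1))))"
  define t where "t = (\<lambda>x z s. bound kn x z s + (bound ka x z s + ((n x z s * (tb x z s + 2) + 1) +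
     ((3 * n x z s + 1) + (4 * h x z s + 1)))))"
  have "pc_at (\<lambda>x z s. f x z s (n x z s)) rs T c t"
    unfolding pc_at_def
  proof (intro allI impI)
    fix x z \<rho> assume \<rho>: "\<forall>r<3. \<rho> r = 0" "\<forall>r\<ge>T. \<rho> r = (0::nat)"
    define s where "s = map \<rho> rs"
    have \<rho>s: "map (\<rho>(T := i, T + 1 := j, T + 2 := l)) rs = s" for i j l
      using T by (auto simp: s_def)
    define N where "N = n x z s"
    define v where "v = f x z s"
    have v: "v i \<le> h x z s" if "i \<le> N" for i
      using le[of i x z s] that by (simp add: v_def f_def N_def)
    have vSuc: "v (Suc i) = g i (v i) x z s" for i by (simp add: v_def f_def)
    define S where "S i = \<rho>(T := N - i, T + 1 := i, T + 2 := v i)" for i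
    have 1: "runs x cn (\<rho>, z) (bound kn x z s) (\<rho>(T := N), z)"
      unfolding N_def by (rule pc_atD[OF cn]) (use \<rho> in \<open>auto simp: s_def\<close>)
    have v0: "v 0 = a x z s" by (simp add: v_def f_def)
    have "map (\<rho>(T := N)) rs = s" using T by (auto simp: s_def)
    moreover have "(\<rho>(T := N))(T + 2 := a x z s) = S 0"
      using \<rho> v0 by (auto simp: S_def fun_eq_iff)
    ultimately have 2: "runs x ca (\<rho>(T := N), z) (bound ka x z s) (S 0, z)"
      using pc_atD[OF ca, of "\<rho>(T := N)" s x z] \<rho> T by fastforce
    have 3: "runs x (Loop T 1 body) ((\<lambda>i. (S i, z)) 0) (N * (tb x z s + 2) + 1) ((\<lambda>i. (S i, z)) N)"
    proof (rule runs_Loop)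
      fix i assume i: "i < N"
      show "scan x (S i, z) T \<noteq> 1" using i T by (simp add: scan_counter S_def)
      define R where "R = (S i)(T := N - Suc i)"
      have R: "map R ((T + 2) # (T + 1) # rs) = v i # i # s"
        using T by (auto simp: R_def S_def s_def)
      have b1: "runs x (Dec T) (S i, z) 1 (R, z)"
        using i by (intro runs_Dec') (auto simp: S_def R_def)
      have "runs x cg (R, z) (bound kg x z (v i # i # s)) (R(T + 3 := v (Suc i)), z)"
      proof -
        have "\<forall>r<3. R r = 0" "\<forall>r\<ge>T + 3. R r = 0" using \<rho> T by (auto simp: R_def S_def)
        from pc_atD[OF cg this R[symmetric]] show ?thesis by (simp add: vSuc)
      qed
      moreover have "bound kg x z (v i # i # s) \<le> bound kg x z (h x z s # N # s)"
        using v[of i] i by (intro bound_mono) auto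
      ultimately have b2: "runs x cg (R, z) (bound kg x z (h x z s # N # s)) (R(T + 3 := v (Suc i)), z)"
        by (rule runs_mono)
      let ?R = "R(T + 3 := v (Suc i))"
      have "runs x (clear (T + 2)) (?R, z) (3 * v i + 1) (?R(T + 2 := 0), z)"
        using runs_clear[of "T + 2" x ?R z] T by (simp add: R_def S_def)
      then have b3: "runs x (clear (T + 2)) (?R, z) (3 * h x z s + 1) (?R(T + 2 := 0), z)"
        using v[of i] i by (elim runs_mono) simp
      let ?R' = "?R(T + 2 := 0)"
      have "runs x (transfer (T + 3) (T + 2)) (?R', z) (4 * v (Suc i) + 1) (?R'(T + 3 := 0, T + 2 := v (Suc i)), z)"
        using runs_transfer[of "T + 3" "T + 2" x ?R' z] T by simp
      then have b4: "runs x (transfer (T + 3) (T + 2)) (?R', z) (4 * h x z s + 1) (?R'(T + 3 := 0, T + 2 := v (Suc i)), z)"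
        using v[of "Suc i"] i by (elim runs_mono) simp
      have b5: "runs x (Inc (T + 1)) (?R'(T + 3 := 0, T + 2 := v (Suc i)), z) 1 (S (Suc i), z)"
        using \<rho> by (intro runs_Inc') (auto simp: S_def R_def fun_eq_iff)
      show "runs x body (S i, z) (tb x z s) (S (Suc i), z)"
        unfolding body_def tb_def N_def[symmetric]
        by (intro runs_Seq[OF b1] runs_Seq[OF b2] runs_Seq[OF b3] runs_Seq[OF b4] b5)
    qed (use T in \<open>simp add: scan_counter S_def\<close>)
    then have 3: "runs x (Loop T 1 body) (S 0, z) (N * (tb x z s + 2) + 1) (S N, z)" by simp
    have 4: "runs x (clear (T + 1)) (S N, z) (3 * N + 1) ((S N)(T + 1 := 0), z)"
      using runs_clear[of "T + 1" x "S N" z] T by (simp add: S_def)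
    have "runs x (transfer (T + 2) T) ((S N)(T + 1 := 0), z) (4 * v N + 1)
        ((S N)(T + 1 := 0, T + 2 := 0, T := v N), z)"
      using runs_transfer[of "T + 2" T x "(S N)(T + 1 := 0)" z] T by (simp add: S_def)
    then have 5: "runs x (transfer (T + 2) T) ((S N)(T + 1 := 0), z) (4 * h x z s + 1)
        ((S N)(T + 1 := 0, T + 2 := 0, T := v N), z)"
      using v[of N] by (elim runs_mono) simp
    have 6: "(S N)(T + 1 := 0, T + 2 := 0, T := v N) = \<rho>(T := f x z s (n x z s))"
      using \<rho> by (auto simp: S_def fun_eq_iff v_def N_def)
    show "runs x c (\<rho>, z) (t x z (map \<rho> rs)) (\<rho>(T := f x z (map \<rho> rs) (n x z (map \<rho> rs))), z)"
      unfolding c_def t_def s_def[symmetric] 6[symmetric] unfolding N_def[symmetric]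
      by (intro runs_Seq[OF 1] runs_Seq[OF 2] runs_Seq[OF 3] runs_Seq[OF 4] 5)
  qed
  moreover have "pbounded t"
  proof -
    have *: "pbounded (\<lambda>x z s. bound kg x z (h x z s # n x z s # s))"
    proof -
      have "pbounded (\<lambda>x z s. bound kg x z (h x z (tl s) # s))"
        by (rule pbounded_Cons[OF pbounded_bound pbounded_tl[OF h]])
      from pbounded_Cons[OF this pc_pbounded[OF n]] show ?thesis by simp
    qed
    show ?thesis
      unfolding t_def tb_def
      by (intro * h pc_pbounded[OF n] pbounded_bound pbounded_const pbounded_add pbounded_mult)
  qed
  ultimately show "\<exists>c t. pbounded t \<and> pc_at (\<lambda>x z s. rec_nat (a x z s) (\<lambda>i v. g i v x z s) (n x z s)) rs T c t"
    unfolding f_def by blast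
qed

definition input :: "nat \<Rightarrow> bool list \<Rightarrow> bool list \<Rightarrow> bool list" where
  "input \<tau> x z = (if \<tau> = 0 then x else z)"

lemma scan_input: "\<tau> < 2 \<Longrightarrow> scan x (\<rho>, z) \<tau> = tape_content (input \<tau> x z) (int (\<rho> \<tau>))"
  by (auto simp: scan_def tape_of_def input_def less_2_cases_iff)

lemma length_input: "length (input \<tau> x z) \<le> length x + length z"
  by (simp add: input_def)

text \<open>Random access to a data tape: the head walks to the position while \<open>T + 1\<close>
  records the distance, the branches of the program store the scanned symbol in \<open>T\<close>,
  and the head walks back.\<close>

lemma pc_symbol:
  assumes "pc e" "\<tau> < 2"
  shows "pc (\<lambda>x z s. tape_content (input \<tau> x z) (int (e x z s)))"
proof (rule pcI)
  fix rs :: "nat list" and T assume T: "3 \<le> T" "set rs \<subseteq> {3..<T}"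
  obtain ce k where ce: "pc_at e rs T ce (bound k)" using pcE[OF assms(1) T] .
  define cs where "cs = Cond \<tau> 1 (Inc T) (Cond \<tau> 2 (Seq (Inc T) (Inc T)) Skip)"
  define c where "c = Seq ce (Seq (transfer2 T (T + 1) \<tau>) (Seq cs (lower (T + 1) \<tau>)))"
  define t where "t = (\<lambda>x z s. bound k x z s + ((5 * e x z s + 1) + (6 + (4 * e x z s + 1))))"
  have "pc_at (\<lambda>x z s. tape_content (input \<tau> x z) (int (e x z s))) rs T c t"
    unfolding pc_at_def
  proof (intro allI impI)
    fix x z \<rho> assume \<rho>: "\<forall>r<3. \<rho> r = 0" "\<forall>r\<ge>T. \<rho> r = (0::nat)"
    define s where "s = map \<rho> rs"
    define N where "N = e x z s"
    define w where "w = tape_content (input \<tau> x z) (int N)"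
    have w: "w = 0 \<or> w = 1 \<or> w = 2" by (auto simp: w_def tape_content_def)
    have 1: "runs x ce (\<rho>, z) (bound k x z s) (\<rho>(T := N), z)"
      unfolding N_def by (rule pc_atD[OF ce]) (use \<rho> in \<open>auto simp: s_def\<close>)
    define R where "R = \<rho>(T + 1 := N, \<tau> := N)"
    have "runs x (transfer2 T (T + 1) \<tau>) (\<rho>(T := N), z) (5 * (\<rho>(T := N)) T + 1)
      (\<rho>(T := N, T := 0, T + 1 := (\<rho>(T := N)) (T + 1) + (\<rho>(T := N)) T, \<tau> := (\<rho>(T := N)) \<tau> + (\<rho>(T := N)) T), z)"
      using T assms(2) by (intro runs_transfer2) auto
    moreover have "\<rho>(T := N, T := 0, T + 1 := (\<rho>(T := N)) (T + 1) + (\<rho>(T := N)) T, \<tau> := (\<rho>(T := N)) \<tau> + (\<rho>(T := N)) T) = R"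
      using \<rho> T assms(2) by (auto simp: R_def fun_eq_iff)
    ultimately have 2: "runs x (transfer2 T (T + 1) \<tau>) (\<rho>(T := N), z) (5 * N + 1) (R, z)" by simp
    have scan: "scan x (R, z) \<tau> = w"
      using assms(2) by (simp add: scan_input R_def w_def)
    have RT: "R T = 0" using \<rho> T assms(2) by (simp add: R_def)
    from w have 3: "runs x cs (R, z) 6 (R(T := w), z)"
    proof (elim disjE)
      assume "w = 0"
      moreover have "R(T := 0) = R" using RT by auto
      ultimately have "runs x cs (R, z) (0 + 2 + 2) (R(T := w), z)"
        unfolding cs_def using scan runs_Skip[of x "(R, z)"] by (intro runs_CondF) auto
      then show ?thesis by (rule runs_mono) simp
    next
      assume "w = 1"
      then have "runs x cs (R, z) (1 + 2) (R(T := w), z)"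
        unfolding cs_def using scan RT by (intro runs_CondT runs_Inc') auto
      then show ?thesis by (rule runs_mono) simp
    next
      assume w: "w = 2"
      have "runs x (Seq (Inc T) (Inc T)) (R, z) (1 + 1) (R(T := w), z)"
        using RT w by (intro runs_Seq[OF runs_Inc] runs_Inc') auto
      then have "runs x cs (R, z) ((1 + 1) + 2 + 2) (R(T := w), z)"
        unfolding cs_def using scan w by (intro runs_CondF runs_CondT) auto
      then show ?thesis by (rule runs_mono) simp
    qed
    have "runs x (lower (T + 1) \<tau>) (R(T := w), z) (4 * (R(T := w)) (T + 1) + 1)
        (R(T := w, T + 1 := 0, \<tau> := (R(T := w)) \<tau> - (R(T := w)) (T + 1)), z)"
      using T assms(2) by (intro runs_lower) (auto simp: R_def)
    moreover have "R(T := w, T + 1 := 0, \<tau> := (R(T := w)) \<tau> - (R(T := w)) (T + 1)) = \<rho>(T := w)"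
      using \<rho> T assms(2) by (auto simp: R_def fun_eq_iff)
    moreover have "(R(T := w)) (T + 1) = N" using assms(2) T by (simp add: R_def)
    ultimately have 4: "runs x (lower (T + 1) \<tau>) (R(T := w), z) (4 * N + 1) (\<rho>(T := w), z)" by simp
    show "runs x c (\<rho>, z) (t x z (map \<rho> rs)) (\<rho>(T := tape_content (input \<tau> x z) (int (e x z (map \<rho> rs)))), z)"
      unfolding c_def t_def s_def[symmetric] N_def[symmetric] w_def[symmetric]
      by (intro runs_Seq[OF 1] runs_Seq[OF 2] runs_Seq[OF 3] 4)
  qed
  moreover have "pbounded t"
    unfolding t_def
    by (intro pc_pbounded[OF assms(1)] pbounded_bound pbounded_const pbounded_add pbounded_mult)
  ultimately show "\<exists>c t. pbounded t \<and> pc_at (\<lambda>x z s. tape_content (input \<tau> x z) (int (e x z s))) rs T c t" by blast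
qed

text \<open>Bits are written as 1 and 2, so the first symbol 0 marks the end of the word.\<close>

lemma pc_length:
  assumes "\<tau> < 2"
  shows "pc (\<lambda>x z s. length (input \<tau> x z))"
proof (rule pcI)
  fix rs :: "nat list" and T assume T: "3 \<le> T" "set rs \<subseteq> {3..<T}"
  define body where "body = Seq (Inc \<tau>) (Seq (Inc T) (Inc (T + 1)))"
  define c where "c = Seq (Loop \<tau> 0 body) (lower (T + 1) \<tau>)"
  define l where "l = (\<lambda>(x::bool list) (z::bool list) (s::nat list). length (input \<tau> x z))"
  define t where "t = (\<lambda>x z s. (l x z s * ((1 + (1 + 1)) + 2) + 1) + (4 * l x z s + 1))"
  have **: "pc_at (\<lambda>x z s. length (input \<tau> x z)) rs T c t"
    unfolding pc_at_def
  proof (intro allI impI)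
    fix x z \<rho> assume \<rho>: "\<forall>r<3. \<rho> r = 0" "\<forall>r\<ge>T. \<rho> r = (0::nat)"
    define N where "N = length (input \<tau> x z)"
    define S where "S i = \<rho>(\<tau> := i, T := i, T + 1 := i)" for i
    have "runs x (Loop \<tau> 0 body) ((\<lambda>i. (S i, z)) 0) (N * ((1 + (1 + 1)) + 2) + 1) ((\<lambda>i. (S i, z)) N)"
    proof (rule runs_Loop)
      fix i assume "i < N"
      then show "scan x (S i, z) \<tau> \<noteq> 0"
        using assms T by (simp add: scan_input S_def N_def tape_content_def)
      show "runs x body (S i, z) (1 + (1 + 1)) (S (Suc i), z)"
        unfolding body_def
        by (intro runs_Seq[OF runs_Inc runs_Seq[OF runs_Inc runs_Inc']])
          (use T assms in \<open>auto simp: S_def fun_eq_iff\<close>)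
    qed (use assms T in \<open>simp add: scan_input S_def N_def tape_content_def\<close>)
    moreover have "S 0 = \<rho>" using \<rho> T assms by (auto simp: S_def fun_eq_iff)
    ultimately have 1: "runs x (Loop \<tau> 0 body) (\<rho>, z) (N * ((1 + (1 + 1)) + 2) + 1) (S N, z)" by simp
    have "runs x (lower (T + 1) \<tau>) (S N, z) (4 * S N (T + 1) + 1)
        ((S N)(T + 1 := 0, \<tau> := S N \<tau> - S N (T + 1)), z)"
      using T assms by (intro runs_lower) (auto simp: S_def)
    moreover have "(S N)(T + 1 := 0, \<tau> := S N \<tau> - S N (T + 1)) = \<rho>(T := N)"
      using \<rho> T assms by (auto simp: S_def fun_eq_iff)
    moreover have "S N (T + 1) = N" using T assms by (simp add: S_def)
    ultimately have 2: "runs x (lower (T + 1) \<tau>) (S N, z) (4 * N + 1) (\<rho>(T := N), z)" by simp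
    show "runs x c (\<rho>, z) (t x z (map \<rho> rs)) (\<rho>(T := length (input \<tau> x z)), z)"
      unfolding c_def t_def l_def N_def[symmetric] by (intro runs_Seq[OF 1] 2)
  qed
  have "pbounded l"
    using length_input[of \<tau>] by (intro pbounded_mono[OF pbounded_size]) (simp add: l_def trans_le_add1 le_SucI)
  note * = this
  have "pbounded t"
    unfolding t_def by (intro * pbounded_const pbounded_add pbounded_mult)
  with ** show "\<exists>c t. pbounded t \<and> pc_at (\<lambda>x z s. length (input \<tau> x z)) rs T c t" by blast
qed

section \<open>From functionals to polynomial-time machines\<close>

lemma bound_Nil: "bound k x z [] = poly ([:2, 1:] ^ k) (length x + length z)"
  by (simp add: bound_def add.commute)

theorem polytime_decidable_pc:
  assumes "pc f"
  shows "polytime_decidable (\<lambda>x y. f x y [] \<noteq> 0)"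
proof -
  \<comment> \<open>The target register is 3, the one that the machine tests before it
    halts.\<close>
  have "3 \<le> (3::nat)" "set [] \<subseteq> {3..<(3::nat)}" by auto
  from pcE[OF assms this] obtain c k where c: "pc_at f [] 3 c (bound k)" .
  have "\<exists>T\<le>poly ([:2, 1:] ^ k + [:2:]) (length x + length y).
      fst (tm_run (machine c) [x, y] T) = (if f x y [] \<noteq> 0 then 1 else 2)" for x y
  proof -
    have "runs x c (\<lambda>_. 0, y) (bound k x y []) ((\<lambda>_. 0)(3 := f x y []), y)"
      by (rule pc_atD[OF c]) auto
    then obtain n where n: "n \<le> bound k x y []" "exec x c (\<lambda>_. 0, y) n ((\<lambda>_. 0)(3 := f x y []), y)"
      by (auto simp: runs_def)
    have "fst (tm_run (machine c) [x, y] (n + 2)) = (if f x y [] \<noteq> 0 then 1 else 2)"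
      using tm_run_machine[OF n(2), of "[x, y]"] by auto
    moreover have "n + 2 \<le> poly ([:2, 1:] ^ k + [:2:]) (length x + length y)"
      using n(1) by (simp add: bound_Nil)
    ultimately show ?thesis by blast
  qed
  then show ?thesis unfolding polytime_decidable_def using wf_machine by blast
qed

text \<open>
  The output tape is also the second input tape of a functional, so the functionals that describe
  the output must not depend on it.
\<close>

theorem polytime_computable_pc:
  assumes "pc l" "pc b" and l: "\<And>x z. l x z [] = len x" and b: "\<And>x z i. (b x z [i] \<noteq> 0) = digit x i"
  shows "polytime_computable (\<lambda>x. map (digit x) [0..<len x])"
proof -
  have "3 \<le> (3::nat)" "set [] \<subseteq> {3..<(3::nat)}" by auto
  from pcE[OF assms(1) this] obtain cl kl where cl: "pc_at l [] 3 cl (bound kl)" .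
  have "3 \<le> (5::nat)" "set [4] \<subseteq> {3..<(5::nat)}" by auto
  from pcE[OF assms(2) this] obtain cb kb where cb: "pc_at b [4] 5 cb (bound kb)" .
  \<comment> \<open>Register 3 counts the missing bits, 4 is the index, 5 the current bit and 6
    saves the index. \<open>Out\<close> needs head 1 at the end of the output, whereas
    \<open>cb\<close> needs it at 0; the index equals the length of the output, so it drives the
    head out and back.\<close>
  define body where "body = Seq (Dec 3) (Seq cb (Seq (transfer2 4 6 1) (Seq
     (Cond 5 1 (Out False) (Out True)) (Seq (lower2 6 4 1) (Seq (clear 5) (Inc 4))))))"
  define c where "c = Seq cl (Loop 3 1 body)"
  obtain kv where kv: "\<And>x z s. length s = 1 \<Longrightarrow> b x z s \<le> bound kv x z s"
    using pboundedE[OF pc_pbounded[OF assms(2)]] by blast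
  define L where "L = (\<lambda>x :: bool list. (length x + 2) ^ kl)"
  have len: "len x \<le> L x" for x
    using pc_at_value_le[OF cl, of "[]" x "[]"] by (simp add: l bound_def L_def)
  \<comment> \<open>The two summands \<open>L x\<close> in the base account for the output so far,
    which stands on tape 1, and for the index in the environment.\<close>
  define tb where "tb x = 1 + ((length x + L x + L x + 2) ^ kb + ((5 * L x + 1) + (3 + ((5 * L x + 1) +
     ((3 * (length x + L x + L x + 2) ^ kv + 1) + 1)))))" for x
  define t where "t x = L x + (L x * (tb x + 2) + 1)" for x
  have run: "\<exists>\<rho>. runs x c (\<lambda>_. 0, []) (t x) (\<rho>, map (digit x) [0..<len x])" for x
  proof -
    define N where "N = len x"
    define out where "out i = map (digit x) [0..<i]" for i
    define S :: "nat \<Rightarrow> nat \<Rightarrow> nat" where "S i = (\<lambda>_. 0)(3 := N - i, 4 := i)" for i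
    have "runs x cl (\<lambda>_. 0, []) (bound kl x [] []) ((\<lambda>_. 0)(3 := l x [] []), [])"
      by (rule pc_atD[OF cl]) auto
    moreover have "(\<lambda>_. 0)(3 := l x [] []) = S 0" by (auto simp: S_def l N_def fun_eq_iff)
    ultimately have 1: "runs x cl (\<lambda>_. 0, []) (L x) (S 0, out 0)"
      by (simp add: bound_def out_def L_def)
    have "runs x (Loop 3 1 body) ((\<lambda>i. (S i, out i)) 0) (N * (tb x + 2) + 1) ((\<lambda>i. (S i, out i)) N)"
    proof (rule runs_Loop)
      fix i assume i: "i < N"
      have iL: "i \<le> L x" using i len[of x] by (simp add: N_def)
      show "scan x (S i, out i) 3 \<noteq> 1" using i by (simp add: scan_counter S_def)
      define v where "v = b x (out i) [i]"
      have v_le: "v \<le> (length x + L x + L x + 2) ^ kv"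
      proof -
        have "v \<le> (length x + i + i + 2) ^ kv"
          using kv[of "[i]" x "out i"] by (simp add: v_def bound_def out_def)
        also have "\<dots> \<le> (length x + L x + L x + 2) ^ kv" using iL by (intro power_mono) auto
        finally show ?thesis .
      qed
      define R :: "nat \<Rightarrow> nat" where "R = (\<lambda>_. 0)(3 := N - Suc i, 4 := i)"
      have b1: "runs x (Dec 3) (S i, out i) 1 (R, out i)"
        using i by (intro runs_Dec') (auto simp: S_def R_def)
      have "runs x cb (R, out i) (bound kb x (out i) [i]) (R(5 := v), out i)"
        unfolding v_def by (rule pc_atD[OF cb]) (auto simp: R_def)
      moreover have "bound kb x (out i) [i] \<le> (length x + L x + L x + 2) ^ kb"
        using iL by (auto simp: bound_def out_def intro!: power_mono)
      ultimately have b2: "runs x cb (R, out i) ((length x + L x + L x + 2) ^ kb) (R(5 := v), out i)"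
        by (rule runs_mono)
      define R2 where "R2 = R(4 := 0, 5 := v, 6 := i, 1 := i)"
      have "runs x (transfer2 4 6 1) (R(5 := v), out i) (5 * (R(5 := v)) 4 + 1)
        (R(5 := v, 4 := 0, 6 := (R(5 := v)) 6 + (R(5 := v)) 4, 1 := (R(5 := v)) 1 + (R(5 := v)) 4), out i)"
        by (intro runs_transfer2) auto
      moreover have "R(5 := v, 4 := 0, 6 := (R(5 := v)) 6 + (R(5 := v)) 4, 1 := (R(5 := v)) 1 + (R(5 := v)) 4) = R2"
        by (auto simp: R2_def R_def fun_eq_iff)
      ultimately have "runs x (transfer2 4 6 1) (R(5 := v), out i) (5 * i + 1) (R2, out i)"
        by (simp add: R_def)
      then have b3: "runs x (transfer2 4 6 1) (R(5 := v), out i) (5 * L x + 1) (R2, out i)"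
        using iL by (elim runs_mono) simp
      have R21: "R2 1 = length (out i)" by (simp add: R2_def out_def)
      have "runs x (Cond 5 1 (Out False) (Out True)) (R2, out i) (1 + 2) (R2, out i @ [v \<noteq> 0])"
      proof (cases "v = 0")
        case True
        then show ?thesis
          using runs_Out[of R2 "out i", OF R21] by (intro runs_CondT) (auto simp: scan_counter R2_def)
      next
        case False
        then show ?thesis
          using runs_Out[of R2 "out i", OF R21] by (intro runs_CondF) (auto simp: scan_counter R2_def)
      qed
      moreover have "out i @ [v \<noteq> 0] = out (Suc i)"
        using b[of x "out i" i] by (simp add: out_def v_def)
      ultimately have b4: "runs x (Cond 5 1 (Out False) (Out True)) (R2, out i) 3 (R2, out (Suc i))"
        by (auto elim!: runs_mono)
      have "runs x (lower2 6 4 1) (R2, out (Suc i)) (5 * R2 6 + 1)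
        (R2(6 := 0, 4 := R2 4 + R2 6, 1 := R2 1 - R2 6), out (Suc i))"
        by (intro runs_lower2) (auto simp: R2_def)
      moreover have "R2(6 := 0, 4 := R2 4 + R2 6, 1 := R2 1 - R2 6) = R(5 := v)"
        by (auto simp: R2_def R_def fun_eq_iff)
      ultimately have "runs x (lower2 6 4 1) (R2, out (Suc i)) (5 * i + 1) (R(5 := v), out (Suc i))"
        by (simp add: R2_def)
      then have b5: "runs x (lower2 6 4 1) (R2, out (Suc i)) (5 * L x + 1) (R(5 := v), out (Suc i))"
        using iL by (elim runs_mono) simp
      have "runs x (clear 5) (R(5 := v), out (Suc i)) (3 * (R(5 := v)) 5 + 1) (R(5 := v, 5 := 0), out (Suc i))"
        by (intro runs_clear) auto
      moreover have "R(5 := v, 5 := 0) = R" by (auto simp: R_def)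
      ultimately have b6: "runs x (clear 5) (R(5 := v), out (Suc i)) (3 * (length x + L x + L x + 2) ^ kv + 1) (R, out (Suc i))"
        using v_le by (auto elim!: runs_mono)
      have b7: "runs x (Inc 4) (R, out (Suc i)) 1 (S (Suc i), out (Suc i))"
        by (intro runs_Inc') (auto simp: S_def R_def fun_eq_iff)
      show "runs x body (S i, out i) (tb x) (S (Suc i), out (Suc i))"
        unfolding body_def tb_def
        by (intro runs_Seq[OF b1] runs_Seq[OF b2] runs_Seq[OF b3] runs_Seq[OF b4] runs_Seq[OF b5] runs_Seq[OF b6] b7)
    qed (simp add: scan_counter S_def)
    then have "runs x (Loop 3 1 body) (S 0, out 0) (N * (tb x + 2) + 1) (S N, out N)" by simp
    then have 2: "runs x (Loop 3 1 body) (S 0, out 0) (L x * (tb x + 2) + 1) (S N, out N)"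
      by (rule runs_mono) (use len[of x] in \<open>simp add: N_def add_mono mult_right_mono del: mult_Suc_right add_2_eq_Suc'\<close>)
    show ?thesis
      using runs_Seq[OF 1 2] unfolding c_def t_def out_def N_def by blast
  qed
  define q :: "nat poly" where "q = (let L = [:2, 1:] ^ kl; m = [:2, 1:] + L + L in
     L + (L * ((1 + (m ^ kb + ((5 * L + 1) + (3 + ((5 * L + 1) + ((3 * m ^ kv + 1) + 1)))))) + 2) + 1) + 2)"
  have q: "poly q (length x) = t x + 2" for x
    by (simp add: q_def t_def tb_def L_def Let_def algebra_simps)
  have "\<exists>T\<le>poly q (length x). halted (tm_run (machine c) [x] T) \<and>
      fst (snd (tm_run (machine c) [x] T) ! 1) = tape_content (map (digit x) [0..<len x])" for x
  proof -
    obtain \<rho> n where n: "n \<le> t x" "exec x c (\<lambda>_. 0, []) n (\<rho>, map (digit x) [0..<len x])"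
      using run[of x] by (auto simp: runs_def)
    have *: "tm_run (machine c) [x] (n + 2) =
      (if \<rho> 3 = 0 then 2 else 1, tapes (max 4 (width c)) x (\<rho>, map (digit x) [0..<len x]))"
      using tm_run_machine[OF n(2), of "[x]"] by auto
    show ?thesis
      unfolding q by (rule exI[of _ "n + 2"], unfold *) (use n(1) in \<open>auto simp: halted_def tapes_def tape_of_def\<close>)
  qed
  then show ?thesis unfolding polytime_computable_def using wf_machine by blast
qed

section \<open>Closure properties of the functionals\<close>

text \<open>Bound variables are de Bruijn indices: each enclosing binder wraps the environment of an
  outer variable in another \<open>tl\<close>, and these rules recognize up to six of them.\<close>

lemmas pc_vars = pc_arg pc_tl[OF pc_arg] pc_tl[OF pc_tl[OF pc_arg]] pc_tl[OF pc_tl[OF pc_tl[OF pc_arg]]]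
  pc_tl[OF pc_tl[OF pc_tl[OF pc_tl[OF pc_arg]]]] pc_tl[OF pc_tl[OF pc_tl[OF pc_tl[OF pc_tl[OF pc_arg]]]]]
  pc_tl[OF pc_tl[OF pc_tl[OF pc_tl[OF pc_tl[OF pc_tl[OF pc_arg]]]]]]

lemma pc_const: "pc (\<lambda>x z s. c)"
  by (induction c) (auto intro: pc_zero pc_Suc)

lemma pc_add:
  assumes "pc a" "pc b"
  shows "pc (\<lambda>x z s. a x z s + b x z s)"
proof -
  have *: "rec_nat v (\<lambda>i v. Suc v) n = v + n" for v n by (induction n) auto
  have "pc (\<lambda>x z s. rec_nat (a x z s) (\<lambda>i v. Suc v) (b x z s))"
    by (rule pc_rec[where h = "\<lambda>x z s. a x z s + b x z s"])
      (auto simp: * intro: assms pc_Suc pc_arg pbounded_add pc_pbounded)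
  then show ?thesis by (simp add: *)
qed

lemma pc_pred:
  assumes "pc a"
  shows "pc (\<lambda>x z s. a x z s - 1)"
proof -
  have *: "rec_nat 0 (\<lambda>i v. i) n = n - 1" for n :: nat by (cases n) auto
  have "pc (\<lambda>x z s. rec_nat 0 (\<lambda>i v. i) (a x z s))"
    by (rule pc_rec[where h = a]) (auto simp: * intro: assms pc_zero pc_arg pc_pbounded)
  then show ?thesis by (simp add: *)
qed

lemma pc_diff:
  assumes "pc a" "pc b"
  shows "pc (\<lambda>x z s. a x z s - b x z s)"
proof -
  have *: "rec_nat v (\<lambda>i v. v - 1) n = v - n" for v n :: nat by (induction n) auto
  have "pc (\<lambda>x z s. rec_nat (a x z s) (\<lambda>i v. v - 1) (b x z s))"
    by (rule pc_rec[where h = a]) (use * in \<open>auto intro: assms pc_pred[unfolded One_nat_def] pc_arg pc_pbounded\<close>)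
  then show ?thesis unfolding * .
qed

text \<open>A sum is estimated by the number of its terms times the bound at the upper limit, which
  requires a bound that is monotone in the index. The canonical \<open>bound\<close> has this
  property.\<close>

lemma pbounded_envelope:
  assumes "pbounded f"
  obtains F where "pbounded F" "\<And>x z s. f x z s \<le> F x z s"
    "\<And>x z i j s. i \<le> j \<Longrightarrow> F x z (i # s) \<le> F x z (j # s)"
proof -
  obtain K where K: "\<And>m x z s. length s = m \<Longrightarrow> f x z s \<le> bound (K m) x z s"
    using assms unfolding pbounded_def by metis
  show ?thesis
  proof (rule that[of "\<lambda>x z s. bound (K (length s)) x z s"])
    show "pbounded (\<lambda>x z s. bound (K (length s)) x z s)"
      unfolding pbounded_def
    proof
      fix m
      show "\<exists>k. \<forall>x z s. length s = m \<longrightarrow> bound (K (length s)) x z s \<le> bound k x z s"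
        by (rule exI[of _ "K m"]) simp
    qed
  qed (auto intro: K bound_mono)
qed

lemma pc_sum:
  assumes "pc n" "pc (\<lambda>x z s. f (arg 0 s) x z (tl s))"
  shows "pc (\<lambda>x z s. \<Sum>i<n x z s. f i x z s)"
proof -
  obtain F where F: "pbounded F" "\<And>x z s. f (arg 0 s) x z (tl s) \<le> F x z s"
    "\<And>x z i j s. i \<le> j \<Longrightarrow> F x z (i # s) \<le> F x z (j # s)"
    using pbounded_envelope[OF pc_pbounded[OF assms(2)]] by blast
  have *: "rec_nat 0 (\<lambda>i v. v + g i) m = (\<Sum>i<m. g i)" for g :: "nat \<Rightarrow> nat" and m
    by (induction m) auto
  have "pc (\<lambda>x z s. rec_nat 0 (\<lambda>i v. v + f i x z s) (n x z s))"
  proof (rule pc_rec[where h = "\<lambda>x z s. n x z s * F x z (n x z s # s)"])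
    show "pc (\<lambda>x z s. arg 0 s + f (arg 1 s) x z (tl (tl s)))"
      using pc_add[OF pc_arg pc_tl[OF assms(2)]] by simp
    show "pbounded (\<lambda>x z s. n x z s * F x z (n x z s # s))"
      by (rule pbounded_mult[OF pc_pbounded[OF assms(1)] pbounded_Cons[OF F(1) pc_pbounded[OF assms(1)]]])
    fix x z s i assume "i \<le> n x z s"
    have "f j x z s \<le> F x z (n x z s # s)" if "j < i" for j
      using F(2)[of "j # s" x z] F(3)[of j "n x z s" x z s] that \<open>i \<le> n x z s\<close> by simp
    then have "(\<Sum>j<i. f j x z s) \<le> i * F x z (n x z s # s)"
      using sum_bounded_above[of "{..<i}" "\<lambda>j. f j x z s" "F x z (n x z s # s)"] by simp
    also have "\<dots> \<le> n x z s * F x z (n x z s # s)"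
      using \<open>i \<le> n x z s\<close> by (intro mult_right_mono) auto
    finally show "rec_nat 0 (\<lambda>i v. v + f i x z s) i \<le> n x z s * F x z (n x z s # s)"
      unfolding * .
  qed (auto intro: assms pc_zero)
  then show ?thesis unfolding * .
qed

lemma pc_mult:
  assumes "pc a" "pc b"
  shows "pc (\<lambda>x z s. a x z s * b x z s)"
  using pc_sum[OF assms(1), of "\<lambda>i. b"] pc_tl[OF assms(2)] by simp

definition pcp :: "(bool list \<Rightarrow> bool list \<Rightarrow> nat list \<Rightarrow> bool) \<Rightarrow> bool" where
  "pcp P \<longleftrightarrow> pc (\<lambda>x z s. of_bool (P x z s))"

lemma pc_of_bool: "pcp P \<Longrightarrow> pc (\<lambda>x z s. of_bool (P x z s))"
  by (simp add: pcp_def)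

lemma pcp_const: "pcp (\<lambda>x z s. c)"
  unfolding pcp_def by (rule pc_const)

lemma pcp_pos:
  assumes "pc a"
  shows "pcp (\<lambda>x z s. a x z s > 0)"
proof -
  have *: "rec_nat 0 (\<lambda>i v. 1) n = (of_bool (n > 0) :: nat)" for n by (cases n) auto
  have "pc (\<lambda>x z s. rec_nat 0 (\<lambda>i v. 1) (a x z s))"
    by (rule pc_rec[where h = "\<lambda>_ _ _. 1"])
      (use * in \<open>auto intro: assms pc_const pbounded_const\<close>)
  then show ?thesis unfolding pcp_def * .
qed

lemma pcp_less:
  assumes "pc a" "pc b"
  shows "pcp (\<lambda>x z s. a x z s < b x z s)"
  using pcp_pos[OF pc_diff[OF assms(2,1)]] by simp

lemma pcp_not:
  assumes "pcp P"
  shows "pcp (\<lambda>x z s. \<not> P x z s)"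
proof -
  have "pc (\<lambda>x z s. 1 - of_bool (P x z s))"
    using assms unfolding pcp_def by (intro pc_diff pc_const)
  moreover have "1 - of_bool Q = (of_bool (\<not> Q) :: nat)" for Q by simp
  ultimately show ?thesis unfolding pcp_def by simp
qed

lemma pcp_conj:
  assumes "pcp P" "pcp Q"
  shows "pcp (\<lambda>x z s. P x z s \<and> Q x z s)"
  using pc_mult[OF assms[unfolded pcp_def]] unfolding pcp_def of_bool_conj .

lemma pcp_disj:
  assumes "pcp P" "pcp Q"
  shows "pcp (\<lambda>x z s. P x z s \<or> Q x z s)"
  using pcp_not[OF pcp_conj[OF pcp_not[OF assms(1)] pcp_not[OF assms(2)]]] by simp

lemma pcp_imp:
  assumes "pcp P" "pcp Q"
  shows "pcp (\<lambda>x z s. P x z s \<longrightarrow> Q x z s)"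
  unfolding imp_conv_disj by (intro pcp_disj pcp_not assms)

lemma pcp_iff:
  assumes "pcp P" "pcp Q"
  shows "pcp (\<lambda>x z s. P x z s \<longleftrightarrow> Q x z s)"
  unfolding iff_conv_conj_imp by (intro pcp_conj pcp_imp assms)

lemma pcp_le:
  assumes "pc a" "pc b"
  shows "pcp (\<lambda>x z s. a x z s \<le> b x z s)"
  unfolding not_less[symmetric] by (intro pcp_not pcp_less assms)

lemma pcp_eq:
  assumes "pc a" "pc b"
  shows "pcp (\<lambda>x z s. a x z s = b x z s)"
  unfolding order_eq_iff[where 'a = nat] by (intro pcp_conj pcp_le assms)

lemma pc_if:
  assumes "pcp P" "pc a" "pc b"
  shows "pc (\<lambda>x z s. if P x z s then a x z s else b x z s)"
proof -
  have "pc (\<lambda>x z s. of_bool (P x z s) * a x z s + of_bool (\<not> P x z s) * b x z s)"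
    by (intro pc_add pc_mult pc_of_bool pcp_not assms)
  moreover have "of_bool Q * u + of_bool (\<not> Q) * v = (if Q then u else v)" for Q and u v :: nat by simp
  ultimately show ?thesis by simp
qed

lemma pcp_if:
  assumes "pcp P" "pcp Q" "pcp R"
  shows "pcp (\<lambda>x z s. if P x z s then Q x z s else R x z s)"
  unfolding if_bool_eq_conj by (intro pcp_conj pcp_imp pcp_not assms)

lemma pcp_bex:
  assumes "pc n" "pcp (\<lambda>x z s. P (arg 0 s) x z (tl s))"
  shows "pcp (\<lambda>x z s. \<exists>i<n x z s. P i x z s)"
proof -
  have "pc (\<lambda>x z s. \<Sum>i<n x z s. of_bool (P i x z s))"
    by (rule pc_sum[OF assms(1)]) (use assms(2) in \<open>simp add: pcp_def\<close>)
  from pcp_pos[OF this]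
  have "pcp (\<lambda>x z s. 0 < (\<Sum>i<n x z s. of_bool (P i x z s) :: nat))" .
  moreover have "0 < (\<Sum>i<m. (of_bool (Q i) :: nat)) \<longleftrightarrow> (\<exists>i<m. Q i)" for m and Q :: "nat \<Rightarrow> bool"
    by (auto simp: neq0_conv[symmetric] simp del: neq0_conv)
  ultimately show ?thesis by simp
qed

lemma pcp_ball:
  assumes "pc n" "pcp (\<lambda>x z s. P (arg 0 s) x z (tl s))"
  shows "pcp (\<lambda>x z s. \<forall>i<n x z s. P i x z s)"
  using pcp_not[OF pcp_bex[OF assms(1) pcp_not[OF assms(2)]]] by simp

text \<open>The quotient is the number of positive multiples of the divisor that do not exceed the
  dividend; the test for a positive divisor yields 0 for division by 0.\<close>

lemma pc_div:
  assumes "pc a" "pc b"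
  shows "pc (\<lambda>x z s. a x z s div b x z s)"
proof -
  have sum: "pc (\<lambda>x z s. \<Sum>i<a x z s. of_bool (0 < b x z s \<and> Suc i * b x z s \<le> a x z s))"
    by (intro pc_sum pc_of_bool pcp_conj pcp_less pcp_le pc_mult pc_Suc pc_const pc_arg assms
        pc_tl[OF assms(1)] pc_tl[OF assms(2)])
  have *: "(\<Sum>i<m. of_bool (0 < n \<and> Suc i * n \<le> m)) = m div n" for m n :: nat
  proof (cases "n = 0")
    case False
    have "(\<Sum>i<m. of_bool (0 < n \<and> Suc i * n \<le> m)) = card {i \<in> {..<m}. 0 < n \<and> Suc i * n \<le> m}"
      by (simp only: of_bool_def sum.If_cases[OF finite_lessThan] Int_def mem_Collect_eq sum_constant
          of_nat_id mult_0_right add_0_right mult_1_right)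
    also have "{i \<in> {..<m}. 0 < n \<and> Suc i * n \<le> m} = {..<m div n}"
    proof -
      have "0 < n \<and> Suc i * n \<le> m \<longleftrightarrow> i < m div n" for i
      proof -
        have "Suc i \<le> m div n \<longleftrightarrow> Suc i * n \<le> m"
          by (rule less_eq_div_iff_mult_less_eq) (use False in simp)
        then show ?thesis using False unfolding Suc_le_eq[of i "m div n"] by blast
      qed
      then show ?thesis
        using less_le_trans[OF _ div_le_dividend, of _ m n] by blast
    qed
    finally show ?thesis unfolding card_lessThan .
  next
    case True
    then show ?thesis by simp
  qed
  show ?thesis using sum unfolding * .
qed

lemma pc_mod:
  assumes "pc a" "pc b"
  shows "pc (\<lambda>x z s. a x z s mod b x z s)"
  unfolding modulo_nat_def by (intro pc_diff pc_mult pc_div assms)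

lemma pcp_odd:
  assumes "pc a"
  shows "pcp (\<lambda>x z s. odd (a x z s))"
  unfolding odd_iff_mod_2_eq_one by (intro pcp_eq pc_mod pc_const assms)

lemma pcp_even:
  assumes "pc a"
  shows "pcp (\<lambda>x z s. even (a x z s))"
  unfolding even_iff_mod_2_eq_zero by (intro pcp_eq pc_mod pc_const assms)

text \<open>Halving is iterated, because the power of 2 itself need not be polynomially
  bounded.\<close>

lemma pc_div_power2:
  assumes "pc a" "pc b"
  shows "pc (\<lambda>x z s. a x z s div 2 ^ b x z s)"
proof -
  have *: "rec_nat m (\<lambda>i v. v div 2) n = m div 2 ^ n" for m n :: nat
    by (induction n) (simp_all add: div_mult2_eq mult.commute[of 2])
  have "pc (\<lambda>x z s. rec_nat (a x z s) (\<lambda>i v. v div 2) (b x z s))"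
    by (rule pc_rec[where h = a])
      (auto simp: * intro!: assms pc_div pc_const pc_arg pc_pbounded)
  then show ?thesis unfolding * .
qed

lemma pc_poly:
  assumes "pc a"
  shows "pc (\<lambda>x z s. poly p (a x z s))"
  by (induction p) (simp_all add: pc_const pc_add pc_mult assms)

text \<open>An arbitrary function on a finite range is computable by a cascade of case distinctions.
  This is how the transition function of an unknown verifier enters the reduction.\<close>

lemma pc_table:
  assumes "pc a"
  shows "pc (\<lambda>x z s. if a x z s < N then f (a x z s) else 0)"
proof (induction N)
  case 0
  show ?case by (simp add: pc_const)
next
  case (Suc N)
  have "pc (\<lambda>x z s. if a x z s = N then f N else if a x z s < N then f (a x z s) else 0)"
    by (intro pc_if pcp_eq assms pc_const Suc.IH)
  moreover have "(if m = N then f N else if m < N then f m else 0) = (if m < Suc N then f m else 0)" for m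
    by auto
  ultimately show ?case by simp
qed

definition has_bit :: "bool list \<Rightarrow> nat \<Rightarrow> bool" where
  "has_bit w i \<longleftrightarrow> i < length w \<and> w ! i"

lemma pcp_input:
  assumes "pc e"
  shows "pcp (\<lambda>x z s. has_bit x (e x z s))" "pcp (\<lambda>x z s. has_bit z (e x z s))"
proof -
  have *: "tape_content w (int i) = 2 \<longleftrightarrow> has_bit w i" for w i
    by (simp add: tape_content_def has_bit_def)
  show "pcp (\<lambda>x z s. has_bit x (e x z s))"
    using pcp_eq[OF pc_symbol[OF assms, of 0] pc_const[of 2]] unfolding * by (simp add: input_def)
  show "pcp (\<lambda>x z s. has_bit z (e x z s))"
    using pcp_eq[OF pc_symbol[OF assms, of 1] pc_const[of 2]] unfolding * by (simp add: input_def)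
qed

lemma pc_input_length: "pc (\<lambda>x z s. length x)" "pc (\<lambda>x z s. length z)"
  using pc_length[of 0] pc_length[of 1] by (simp_all add: input_def)

lemmas pc_intros = pc_vars pc_const pc_Suc pc_add pc_diff pc_mult pc_div_power2 pc_div pc_mod pc_poly
  pc_sum pc_if pc_of_bool pc_input_length
  pcp_const pcp_conj pcp_disj pcp_not pcp_imp pcp_iff pcp_eq pcp_less pcp_le pcp_if pcp_bex pcp_ball
  pcp_odd pcp_even pcp_input

section \<open>Membership in NP\<close>

lemma pc_comp1:
  assumes "pc (\<lambda>x z s. F x z (arg 0 s))" "pc a"
  shows "pc (\<lambda>x z s. F x z (a x z s))"
  using pc_push[OF assms(2,1)] by simp

text \<open>The number of binary digits as a bounded sum; the limit \<open>n\<close> suffices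
  because n < 2 ^ n.\<close>

definition blen :: "nat \<Rightarrow> nat" where
  "blen n = (\<Sum>j<n. of_bool (0 < n div 2 ^ j))"

definition elen :: "nat \<Rightarrow> nat" where
  "elen n = 2 * blen n + 1"

text \<open>The bits of \<open>encode_nat n\<close>: even positions carry the continuation mark, odd
  ones a digit, and the final 0 is the position that fails \<open>i < 2 * blen n\<close>.\<close>

definition ebit :: "nat \<Rightarrow> nat \<Rightarrow> bool" where
  "ebit n i \<longleftrightarrow> i < 2 * blen n \<and> (even i \<or> odd (n div 2 ^ (i div 2)))"

lemma pc_blen: "pc a \<Longrightarrow> pc (\<lambda>x z s. blen (a x z s))"
  by (rule pc_comp1[where F = "\<lambda>_ _. blen"]) (unfold blen_def, intro pc_intros)

lemma pc_elen: "pc a \<Longrightarrow> pc (\<lambda>x z s. elen (a x z s))"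
  unfolding elen_def by (intro pc_blen pc_intros)

lemma pcp_ebit: "pc a \<Longrightarrow> pc b \<Longrightarrow> pcp (\<lambda>x z s. ebit (a x z s) (b x z s))"
  unfolding ebit_def by (intro pc_blen pc_intros)

lemma sum_of_bool_card:
  fixes n :: nat
  shows "(\<Sum>i<n. of_bool (P i) :: nat) = card {i. i < n \<and> P i}"
proof -
  have "(\<Sum>i<n. of_bool (P i) :: nat) = (\<Sum>i\<in>{i \<in> {..<n}. P i}. 1)"
    unfolding of_bool_def by (subst sum.inter_filter) simp_all
  then show ?thesis by simp
qed

lemma binary_less: "j < length (binary n) \<longleftrightarrow> 0 < n div 2 ^ j"
proof (induction n arbitrary: j rule: less_induct)
  case (less n)
  show ?case
  proof (cases "n = 0")
    case False
    then show ?thesis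
      using less[of "n div 2"] by (cases j) (auto simp: binary.simps[of n] div_mult2_eq)
  qed (simp add: binary.simps)
qed

lemma binary_nth: "j < length (binary n) \<Longrightarrow> binary n ! j = odd (n div 2 ^ j)"
proof (induction n arbitrary: j rule: less_induct)
  case (less n)
  show ?case
  proof (cases "n = 0")
    case False
    then show ?thesis
      using less by (cases j) (auto simp: binary.simps[of n] div_mult2_eq)
  qed (use less.prems in \<open>simp add: binary.simps\<close>)
qed

lemma length_binary: "length (binary n) = blen n"
proof -
  have "j < n" if "0 < n div 2 ^ j" for j
  proof -
    have "2 ^ j \<le> n" using that by (metis div_less not_le less_irrefl)
    with less_exp[of j] show ?thesis by linarith
  qed
  then have "{j. j < n \<and> 0 < n div 2 ^ j} = {..<length (binary n)}"
    using binary_less by auto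
  then show ?thesis by (simp add: blen_def sum_of_bool_card)
qed

lemma length_pairs: "length (concat (map (\<lambda>b. [True, b]) bs)) = 2 * length bs"
  by (induction bs) auto

lemma nth_pairs: "i < 2 * length bs \<Longrightarrow> concat (map (\<lambda>b. [True, b]) bs) ! i = (even i \<or> bs ! (i div 2))"
proof (induction bs arbitrary: i)
  case (Cons b bs)
  consider "i = 0" | "i = 1" | k where "i = Suc (Suc k)"
    by (metis One_nat_def not0_implies_Suc)
  then show ?case using Cons by cases auto
qed simp

lemma length_encode_nat: "length (encode_nat n) = elen n"
  by (simp add: encode_nat_def length_pairs elen_def length_binary)

lemma has_bit_append: "has_bit (u @ v) i \<longleftrightarrow> has_bit u i \<or> length u \<le> i \<and> has_bit v (i - length u)"
  by (auto simp: has_bit_def nth_append)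

lemma has_bit_encode_nat: "has_bit (encode_nat n) i \<longleftrightarrow> ebit n i"
  unfolding encode_nat_def has_bit_append
  by (auto simp: has_bit_def ebit_def length_pairs nth_pairs length_binary[symmetric] binary_nth)

lemma length_adjacency: "length (adjacency_matrix n E) = n * n"
  by (simp add: adjacency_matrix_def length_concat comp_def sum_list_triv)

lemma nth_concat_rows:
  "i < m * n \<Longrightarrow> concat (map (\<lambda>u. map (f u) [0..<n]) [0..<m]) ! i = f (i div n) (i mod n)"
proof (induction m)
  case (Suc m)
  have len: "length (concat (map (\<lambda>u. map (f u) [0..<n]) [0..<m])) = m * n"
    by (simp add: length_concat comp_def sum_list_triv)
  show ?case
  proof (cases "i < m * n")
    case True
    then show ?thesis using Suc.IH len by (simp add: nth_append)
  next
    case False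
    then have d: "i div n = m"
      using Suc.prems by (intro div_nat_eqI) (auto simp: mult.commute)
    have m: "i mod n = i - m * n"
      unfolding modulo_nat_def d by simp
    have "i - m * n < n" using False Suc.prems by simp
    then show ?thesis using False len by (simp add: nth_append d m)
  qed
qed simp

lemma has_bit_adjacency:
  "has_bit (adjacency_matrix n E) i \<longleftrightarrow> i < n * n \<and> {i div n, i mod n} \<in> E"
proof (cases "i < n * n")
  case True
  with nth_concat_rows[OF True, of "\<lambda>u v. {u, v} \<in> E"] show ?thesis
    unfolding has_bit_def length_adjacency by (simp add: adjacency_matrix_def)
qed (simp add: has_bit_def length_adjacency)

lemma list_eq_has_bit: "u = v \<longleftrightarrow> length u = length v \<and> (\<forall>i<length u. has_bit u i \<longleftrightarrow> has_bit v i)"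
  by (auto simp: list_eq_iff_nth_eq has_bit_def)

definition inst_len :: "nat \<Rightarrow> nat \<Rightarrow> nat \<Rightarrow> nat \<Rightarrow> nat \<Rightarrow> nat" where
  "inst_len n a b c d = elen n + (n * n + (elen a + (elen b + (elen c + elen d))))"

definition app_bit :: "bool \<Rightarrow> nat \<Rightarrow> (nat \<Rightarrow> bool) \<Rightarrow> nat \<Rightarrow> bool" where
  "app_bit u l v i \<longleftrightarrow> u \<or> l \<le> i \<and> v (i - l)"

text \<open>The relation \<open>A\<close> is a parameter because the formula serves twice: to check
  an input, with \<open>A\<close> read off the input itself, and to write the output of the
  reduction.\<close>

definition inst_bit :: "(nat \<Rightarrow> nat \<Rightarrow> bool) \<Rightarrow> nat \<Rightarrow> nat \<Rightarrow> nat \<Rightarrow> nat \<Rightarrow> nat \<Rightarrow> nat \<Rightarrow> bool" where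
  "inst_bit A n a b c d i \<longleftrightarrow> app_bit (ebit n i) (elen n) (\<lambda>i. app_bit (i < n * n \<and> A (i div n) (i mod n)) (n * n)
     (\<lambda>i. app_bit (ebit a i) (elen a) (\<lambda>i. app_bit (ebit b i) (elen b) (\<lambda>i. app_bit (ebit c i) (elen c) (ebit d) i) i) i) i) i"

lemma length_instance: "length (encode_instance n E [a, b] [c, d]) = inst_len n a b c d"
  by (simp add: encode_instance_def inst_len_def length_encode_nat length_adjacency)

lemma has_bit_instance:
  "has_bit (encode_instance n E [a, b] [c, d]) i \<longleftrightarrow> inst_bit (\<lambda>u v. {u, v} \<in> E) n a b c d i"
  by (simp only: encode_instance_def list.map concat.simps append_Nil2 append.assoc has_bit_append
      inst_bit_def app_bit_def has_bit_encode_nat has_bit_adjacency length_encode_nat length_adjacency)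

lemma inst_bit_cong:
  assumes "\<And>u v. u < n \<Longrightarrow> v < n \<Longrightarrow> A u v = B u v"
  shows "inst_bit A n a b c d i = inst_bit B n a b c d i"
proof -
  have "(j < n * n \<and> A (j div n) (j mod n)) \<longleftrightarrow> (j < n * n \<and> B (j div n) (j mod n))" for j
  proof (cases "j < n * n")
    case True
    then have "n > 0" by (cases n) auto
    then show ?thesis using True assms[of "j div n" "j mod n"] by (simp add: less_mult_imp_div_less)
  qed simp
  then show ?thesis by (simp add: inst_bit_def)
qed

section \<open>Counting edges by sums over an adjacency relation\<close>

definition adj_graph :: "nat \<Rightarrow> (nat \<Rightarrow> nat \<Rightarrow> bool) \<Rightarrow> nat set set" where
  "adj_graph n A = {{u, v} | u v. u < n \<and> v < n \<and> A u v}"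

definition loopless_sym :: "nat \<Rightarrow> (nat \<Rightarrow> nat \<Rightarrow> bool) \<Rightarrow> bool" where
  "loopless_sym n A \<longleftrightarrow> (\<forall>u<n. \<not> A u u) \<and> (\<forall>u<n. \<forall>v<n. A u v = A v u)"

lemma finite_graph_adj: "loopless_sym n A \<Longrightarrow> finite_graph {..<n} (adj_graph n A)"
  by (auto simp: finite_graph_def adj_graph_def loopless_sym_def card_insert_if)

lemma adj_graph_iff: "loopless_sym n A \<Longrightarrow> {u, v} \<in> adj_graph n A \<longleftrightarrow> u < n \<and> v < n \<and> A u v"
  by (auto simp: adj_graph_def loopless_sym_def doubleton_eq_iff)

lemma finite_graph_loopless_sym:
  assumes "finite_graph {..<n} E"
  shows "loopless_sym n (\<lambda>u v. {u, v} \<in> E)" "adj_graph n (\<lambda>u v. {u, v} \<in> E) = E"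
proof -
  show "loopless_sym n (\<lambda>u v. {u, v} \<in> E)"
    using assms by (auto simp: loopless_sym_def finite_graph_def insert_commute)
  have "\<exists>u v. e = {u, v} \<and> u < n \<and> v < n" if "e \<in> E" for e
    using assms that unfolding finite_graph_def card_2_iff by (metis insert_subset lessThan_iff)
  then show "adj_graph n (\<lambda>u v. {u, v} \<in> E) = E"
    by (auto simp: adj_graph_def) blast
qed

lemma card_incident:
  assumes "loopless_sym n A" "v < n"
  shows "card {e \<in> adj_graph n A. v \<in> e \<and> P e} = (\<Sum>u<n. of_bool (A v u \<and> P {v, u}))"
proof -
  have "{e \<in> adj_graph n A. v \<in> e \<and> P e} = (\<lambda>u. {v, u}) ` {u. u < n \<and> A v u \<and> P {v, u}}"
  proof (intro set_eqI iffI)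
    fix e assume "e \<in> {e \<in> adj_graph n A. v \<in> e \<and> P e}"
    then obtain u w where "e = {u, w}" "u < n" "w < n" "A u w" "v \<in> e" "P e"
      by (auto simp: adj_graph_def)
    then show "e \<in> (\<lambda>u. {v, u}) ` {u. u < n \<and> A v u \<and> P {v, u}}"
      using assms by (auto simp: loopless_sym_def insert_commute)
  qed (use assms in \<open>auto simp: adj_graph_def\<close>)
  moreover have "inj_on (\<lambda>u. {v, u}) {u. u < n \<and> A v u \<and> P {v, u}}"
    by (auto simp: inj_on_def doubleton_eq_iff)
  ultimately show ?thesis by (simp add: sum_of_bool_card card_image)
qed

lemma neighborhood_adj:
  "loopless_sym n A \<Longrightarrow> v < n \<Longrightarrow> neighborhood (adj_graph n A) v = {u. u < n \<and> A v u}"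
  by (auto simp: neighborhood_def adj_graph_iff loopless_sym_def)

lemma card_induced:
  assumes "loopless_sym n A" "v < n"
  shows "card {e \<in> adj_graph n A. e \<subseteq> neighborhood (adj_graph n A) v \<and> P e} =
    (\<Sum>u<n. \<Sum>w<u. of_bool (A v u \<and> A v w \<and> A u w \<and> P {u, w}))"
proof -
  let ?Q = "\<lambda>u w. A v u \<and> A v w \<and> A u w \<and> P {u, w}"
  \<comment> \<open>Each edge is counted once, by the pair with its larger vertex first.\<close>
  let ?S = "SIGMA u:{..<n}. {w. w < u \<and> ?Q u w}"
  have N: "neighborhood (adj_graph n A) v = {u. u < n \<and> A v u}"
    using assms by (rule neighborhood_adj)
  have "{e \<in> adj_graph n A. e \<subseteq> neighborhood (adj_graph n A) v \<and> P e} = (\<lambda>(u, w). {u, w}) ` ?S"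
    unfolding N
  proof (intro set_eqI iffI)
    fix e assume "e \<in> {e \<in> adj_graph n A. e \<subseteq> {u. u < n \<and> A v u} \<and> P e}"
    then obtain u w where e: "e = {u, w}" "u < n" "w < n" "A u w" "A v u" "A v w" "P {u, w}"
      unfolding adj_graph_def by blast
    then have "u \<noteq> w" "A w u" using assms(1) unfolding loopless_sym_def by blast+
    then consider "w < u" | "u < w" by linarith
    then show "e \<in> (\<lambda>(u, w). {u, w}) ` ?S"
    proof cases
      case 1
      then have "(u, w) \<in> ?S" using e by simp
      then show ?thesis unfolding e(1) by (rule rev_image_eqI) simp
    next
      case 2
      then have "(w, u) \<in> ?S" using e \<open>A w u\<close> by (simp add: insert_commute)
      then show ?thesis unfolding e(1) by (rule rev_image_eqI) (simp add: insert_commute)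
    qed
  next
    fix e assume "e \<in> (\<lambda>(u, w). {u, w}) ` ?S"
    then obtain u w where "e = {u, w}" "u < n" "w < u" "?Q u w" by auto
    then show "e \<in> {e \<in> adj_graph n A. e \<subseteq> {u. u < n \<and> A v u} \<and> P e}"
      using adj_graph_iff[OF assms(1)] by auto
  qed
  moreover have "inj_on (\<lambda>(u, w). {u, w}) ?S"
    by (auto simp: inj_on_def doubleton_eq_iff)
  moreover have "card ?S = (\<Sum>u<n. \<Sum>w<u. of_bool (?Q u w))"
    unfolding sum_of_bool_card by (subst card_SigmaI) auto
  ultimately show ?thesis by (simp add: card_image)
qed

definition counts_ok :: "(nat \<Rightarrow> nat \<Rightarrow> bool) \<Rightarrow> (nat \<Rightarrow> nat \<Rightarrow> bool) \<Rightarrow> nat \<Rightarrow> nat \<Rightarrow> nat \<Rightarrow> nat \<Rightarrow> nat \<Rightarrow> bool" where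
  "counts_ok A Y n a b c d \<longleftrightarrow> (\<forall>v<n.
     (\<Sum>u<n. of_bool (A v u \<and> Y v u)) = a \<and>
     (\<Sum>u<n. of_bool (A v u \<and> \<not> Y v u)) = b \<and>
     (\<Sum>u<n. \<Sum>w<u. of_bool (A v u \<and> A v w \<and> A u w \<and> Y u w)) = c \<and>
     (\<Sum>u<n. \<Sum>w<u. of_bool (A v u \<and> A v w \<and> A u w \<and> \<not> Y u w)) = d)"

lemma triangle_regular_counts:
  assumes "loopless_sym n A" "\<And>u v. u < n \<Longrightarrow> v < n \<Longrightarrow> A u v \<Longrightarrow> col {u, v} = (if Y u v then 1 else 2)"
  shows "triangle_regular 2 [a, b] [c, d] {..<n} (adj_graph n A) col \<longleftrightarrow> counts_ok A Y n a b c d"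
proof -
  have 2: "{1..2::nat} = {1, 2}" by auto
  have I1: "card {e \<in> adj_graph n A. v \<in> e \<and> col e = 1} = (\<Sum>u<n. of_bool (A v u \<and> Y v u))"
    if "v < n" for v
    unfolding card_incident[OF assms(1) that] using assms that
    by (intro sum.cong refl arg_cong[of _ _ of_bool]) (auto split: if_splits)
  have I2: "card {e \<in> adj_graph n A. v \<in> e \<and> col e = 2} = (\<Sum>u<n. of_bool (A v u \<and> \<not> Y v u))"
    if "v < n" for v
    unfolding card_incident[OF assms(1) that] using assms that
    by (intro sum.cong refl arg_cong[of _ _ of_bool]) (auto split: if_splits)
  have J1: "card {e \<in> adj_graph n A. e \<subseteq> neighborhood (adj_graph n A) v \<and> col e = 1} =
      (\<Sum>u<n. \<Sum>w<u. of_bool (A v u \<and> A v w \<and> A u w \<and> Y u w))"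
    if "v < n" for v
    unfolding card_induced[OF assms(1) that] using assms that
    by (intro sum.cong refl arg_cong[of _ _ of_bool]) (auto split: if_splits)
  have J2: "card {e \<in> adj_graph n A. e \<subseteq> neighborhood (adj_graph n A) v \<and> col e = 2} =
      (\<Sum>u<n. \<Sum>w<u. of_bool (A v u \<and> A v w \<and> A u w \<and> \<not> Y u w))"
    if "v < n" for v
    unfolding card_induced[OF assms(1) that] using assms that
    by (intro sum.cong refl arg_cong[of _ _ of_bool]) (auto split: if_splits)
  have "triangle_regular 2 [a, b] [c, d] {..<n} (adj_graph n A) col \<longleftrightarrow> (\<forall>v<n.
      card {e \<in> adj_graph n A. v \<in> e \<and> col e = 1} = a \<and>
      card {e \<in> adj_graph n A. v \<in> e \<and> col e = 2} = b \<and>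
      card {e \<in> adj_graph n A. e \<subseteq> neighborhood (adj_graph n A) v \<and> col e = 1} = c \<and>
      card {e \<in> adj_graph n A. e \<subseteq> neighborhood (adj_graph n A) v \<and> col e = 2} = d)"
    unfolding triangle_regular_def 2 by auto
  also have "\<dots> \<longleftrightarrow> counts_ok A Y n a b c d"
    unfolding counts_ok_def by (simp only: I1 I2 J1 J2 cong: imp_cong)
  finally show ?thesis .
qed

definition xadj :: "bool list \<Rightarrow> nat \<Rightarrow> nat \<Rightarrow> nat \<Rightarrow> bool" where
  "xadj x n u v \<longleftrightarrow> has_bit x (elen n + (u * n + v))"

text \<open>Only the entry with the larger vertex first is consulted, so that every certificate,
  symmetric or not, assigns one color to each edge.\<close>

definition ycol :: "bool list \<Rightarrow> nat \<Rightarrow> nat \<Rightarrow> nat \<Rightarrow> bool" where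
  "ycol y n u v \<longleftrightarrow> (if v < u then has_bit y (u * n + v) else has_bit y (v * n + u))"

lemma pcp_xadj: "pc n \<Longrightarrow> pc u \<Longrightarrow> pc v \<Longrightarrow> pcp (\<lambda>x y s. xadj x (n x y s) (u x y s) (v x y s))"
  unfolding xadj_def by (intro pc_elen pc_intros)

lemma pcp_ycol: "pc n \<Longrightarrow> pc u \<Longrightarrow> pc v \<Longrightarrow> pcp (\<lambda>x y s. ycol y (n x y s) (u x y s) (v x y s))"
  unfolding ycol_def by (intro pc_intros)

text \<open>This replaces parsing: the verifier runs through all candidate parameters and compares
  \<open>x\<close> bit by bit with the encoding of these and of the adjacency read off
  \<open>x\<close> itself.\<close>

definition inst_ok :: "bool list \<Rightarrow> nat \<Rightarrow> nat \<Rightarrow> nat \<Rightarrow> nat \<Rightarrow> nat \<Rightarrow> bool" where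
  "inst_ok x n a b c d \<longleftrightarrow> length x = inst_len n a b c d \<and>
     (\<forall>i<length x. has_bit x i \<longleftrightarrow> inst_bit (xadj x n) n a b c d i) \<and> loopless_sym n (xadj x n)"

lemma inst_okD:
  assumes "inst_ok x n a b c d"
  shows "x = encode_instance n (adj_graph n (xadj x n)) [a, b] [c, d]"
proof -
  let ?E = "adj_graph n (xadj x n)"
  from assms have ls: "loopless_sym n (xadj x n)" by (simp add: inst_ok_def)
  have "inst_bit (xadj x n) n a b c d i = inst_bit (\<lambda>u v. {u, v} \<in> ?E) n a b c d i" for i
    by (rule inst_bit_cong) (simp add: adj_graph_iff[OF ls])
  with assms show ?thesis
    unfolding list_eq_has_bit[of x] by (simp add: inst_ok_def length_instance has_bit_instance)
qed

lemma pair_less: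
  fixes u v n :: nat
  assumes "u < m" "v < n"
  shows "u * n + v < m * n"
proof -
  have "u * n + v < Suc u * n" using assms by simp
  also have "\<dots> \<le> m * n" using assms by (intro mult_right_mono) auto
  finally show ?thesis .
qed

lemma xadj_instance:
  assumes "u < n" "v < n"
  shows "xadj (encode_instance n E r c) n u v \<longleftrightarrow> {u, v} \<in> E"
  using pair_less[OF assms] assms
  by (simp add: xadj_def encode_instance_def has_bit_append has_bit_encode_nat length_encode_nat
      has_bit_adjacency length_adjacency) (simp add: ebit_def elen_def)

lemma inst_ok_instance:
  assumes "finite_graph {..<n} E" "x = encode_instance n E [a, b] [c, d]"
  shows "inst_ok x n a b c d" "E = adj_graph n (xadj x n)"
proof -
  have x: "xadj x n u v \<longleftrightarrow> {u, v} \<in> E" if "u < n" "v < n" for u v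
    using xadj_instance[OF that] by (simp add: assms(2))
  have "loopless_sym n (xadj x n)"
    using finite_graph_loopless_sym(1)[OF assms(1)] by (simp add: loopless_sym_def x)
  moreover have "inst_bit (xadj x n) n a b c d i = inst_bit (\<lambda>u v. {u, v} \<in> E) n a b c d i" for i
    by (rule inst_bit_cong) (rule x)
  ultimately show "inst_ok x n a b c d"
    unfolding inst_ok_def by (simp add: length_instance has_bit_instance assms(2))
  have "adj_graph n (xadj x n) = adj_graph n (\<lambda>u v. {u, v} \<in> E)"
    unfolding adj_graph_def using x by blast
  then show "E = adj_graph n (xadj x n)"
    using finite_graph_loopless_sym(2)[OF assms(1)] by simp
qed

section \<open>Instances without vertices\<close>

text \<open>Recognizes the encoding of a number that may be too large for a unary register. Digits
  are stored with the lowest first, so the bit before the terminator is the leading digit, and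
  requiring it to be 1 excludes leading zeros.\<close>

definition is_nat :: "bool list \<Rightarrow> nat \<Rightarrow> nat \<Rightarrow> bool" where
  "is_nat x p q \<longleftrightarrow> p < q \<and> q \<le> length x \<and> odd (q - p) \<and> \<not> has_bit x (q - 1) \<and>
     (\<forall>j<(q - p) div 2. has_bit x (p + 2 * j)) \<and> (1 < q - p \<longrightarrow> has_bit x (q - 2))"

lemma binary_surj: "bs = [] \<or> last bs \<Longrightarrow> \<exists>n. binary n = bs"
proof (induction bs)
  case Nil
  show ?case by (rule exI[of _ 0]) (simp add: binary.simps)
next
  case (Cons b bs)
  have "bs = [] \<or> last bs" using Cons.prems by (auto split: if_splits)
  with Cons.IH obtain n where n: "binary n = bs" by blast
  have "b \<or> n > 0"
    using Cons.prems n by (cases "n = 0") (auto simp: binary.simps)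
  then have "binary (2 * n + of_bool b) = b # bs"
    using n by (subst binary.simps) auto
  then show ?case by blast
qed

lemma is_nat_iff: "is_nat x p q \<longleftrightarrow> p \<le> q \<and> q \<le> length x \<and> (\<exists>m. take (q - p) (drop p x) = encode_nat m)"
proof
  assume *: "p \<le> q \<and> q \<le> length x \<and> (\<exists>m. take (q - p) (drop p x) = encode_nat m)"
  then obtain m where m: "take (q - p) (drop p x) = encode_nat m" by blast
  have len: "q - p = 2 * blen m + 1"
  proof -
    have "length (take (q - p) (drop p x)) = q - p" using * by (auto simp: min_def)
    then show ?thesis unfolding m by (simp add: length_encode_nat elen_def)
  qed
  have bit: "has_bit x (p + i) \<longleftrightarrow> ebit m i" if "i < q - p" for i
  proof -
    have len: "p + i < length x" "i < length (take (q - p) (drop p x))" using * that by auto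
    have "take (q - p) (drop p x) ! i = x ! (p + i)" using that * by simp
    then have "has_bit (take (q - p) (drop p x)) i \<longleftrightarrow> has_bit x (p + i)"
      unfolding has_bit_def using len by blast
    then show ?thesis unfolding m has_bit_encode_nat by blast
  qed
  \<comment> \<open>The leading digit is 1: dividing by 2 ^ k leaves a positive number, dividing
    once more by 2 leaves 0, so the former is odd.\<close>
  have top: "has_bit x (p + (2 * blen m - 1))" if "0 < blen m"
  proof -
    define k where "k = blen m - 1"
    have k: "blen m = Suc k" using that by (simp add: k_def)
    have "0 < m div 2 ^ k" "\<not> 0 < m div 2 ^ Suc k"
      using binary_less[of k m] binary_less[of "Suc k" m] by (simp_all add: length_binary k)
    moreover have "odd v" if "0 < v" "\<not> 0 < v div 2" for v :: nat using that by presburger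
    ultimately have "odd (m div 2 ^ k)"
      unfolding power_Suc2 div_mult2_eq by blast
    moreover have "(2 * blen m - 1) div 2 = k" by (simp add: k)
    ultimately show ?thesis using bit[of "2 * blen m - 1"] len k by (simp add: ebit_def)
  qed
  show "is_nat x p q"
    unfolding is_nat_def
  proof (intro conjI allI impI)
    show "p < q" "odd (q - p)" using len by (auto intro: ccontr)
    show "q \<le> length x" using * by blast
    have "q - 1 = p + 2 * blen m" using len by linarith
    then show "\<not> has_bit x (q - 1)"
      using bit[of "2 * blen m"] len by (simp add: ebit_def)
    fix j assume "j < (q - p) div 2"
    then have "j < blen m" by (simp add: len)
    then show "has_bit x (p + 2 * j)"
      using bit[of "2 * j"] len by (simp add: ebit_def)
  next
    assume "1 < q - p"
    then have "0 < blen m" "q - 2 = p + (2 * blen m - 1)" using len by linarith+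
    then show "has_bit x (q - 2)" using top by simp
  qed
next
  assume *: "is_nat x p q"
  define w where "w = take (q - p) (drop p x)"
  define h where "h = (q - p) div 2"
  have "odd (q - p)" using * unfolding is_nat_def by blast
  then have h: "q - p = 2 * h + 1"
    unfolding h_def by (rule odd_two_times_div_two_succ[symmetric])
  define bs where "bs = map (\<lambda>j. w ! (2 * j + 1)) [0..<h]"
  have "p < q" "q \<le> length x" using * unfolding is_nat_def by blast+
  then have len: "length w = 2 * h + 1" unfolding w_def h[symmetric] by simp
  have w: "w ! i = has_bit x (p + i)" if "i < 2 * h + 1" for i
    using that * h by (auto simp: w_def is_nat_def has_bit_def)
  have "bs = [] \<or> last bs"
  proof (cases "h = 0")
    case False
    then have "last bs = has_bit x (p + (2 * (h - 1) + 1))"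
      by (simp add: bs_def last_map w)
    also have "p + (2 * (h - 1) + 1) = q - 2" using h False * by (auto simp: is_nat_def)
    finally show ?thesis using * h False by (simp add: is_nat_def)
  qed (simp add: bs_def)
  then obtain m where m: "binary m = bs" using binary_surj by blast
  have lbs: "length bs = h" and nbs: "\<And>j. j < h \<Longrightarrow> bs ! j = w ! (2 * j + 1)"
    by (simp_all add: bs_def)
  have "w = encode_nat m"
  proof (rule nth_equalityI)
    show "length w = length (encode_nat m)" by (simp add: len encode_nat_def m length_pairs lbs)
    fix i assume i: "i < length w"
    have "i = 2 * (i div 2) \<or> i = 2 * (i div 2) + 1" by presburger
    moreover have "i = 2 * h \<or> i div 2 < h" using i len by linarith
    ultimately consider "i = 2 * h" | j where "i = 2 * j" "j < h" | j where "i = 2 * j + 1" "j < h"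
      by blast
    then show "w ! i = encode_nat m ! i"
    proof cases
      case 1
      have "p + 2 * h = q - 1" using h * by (auto simp: is_nat_def)
      then show ?thesis
        using 1 * by (simp add: w encode_nat_def m nth_append length_pairs lbs is_nat_def)
    next
      case 2
      have "has_bit x (p + 2 * j)" using * 2(2) unfolding is_nat_def h_def by blast
      with 2 show ?thesis by (simp add: w encode_nat_def m nth_append length_pairs lbs nth_pairs)
    next
      case 3
      then show ?thesis
        using * by (simp add: encode_nat_def m nth_append length_pairs lbs nth_pairs nbs)
    qed
  qed
  then show "p \<le> q \<and> q \<le> length x \<and> (\<exists>m. take (q - p) (drop p x) = encode_nat m)"
    using * unfolding w_def is_nat_def by auto
qed

text \<open>Without vertices all vectors are admissible, and their entries can be exponential in the
  length of \<open>x\<close>. They cannot be run through by unary counters, so only the form of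
  their encodings is checked. The number of vertices takes the single bit 0, hence the first entry
  starts at position 1.\<close>

definition empty_ok :: "bool list \<Rightarrow> bool" where
  "empty_ok x \<longleftrightarrow> 0 < length x \<and> \<not> has_bit x 0 \<and> (\<exists>i<length x. \<exists>j<length x. \<exists>k<length x.
     is_nat x 1 i \<and> is_nat x i j \<and> is_nat x j k \<and> is_nat x k (length x))"

lemma encode_nat_0: "encode_nat 0 = [False]"
  by (simp add: encode_nat_def binary.simps)

lemma is_nat_middle: "is_nat (u @ encode_nat m @ v) (length u) (length u + length (encode_nat m))"
  by (auto simp: is_nat_iff)

lemma empty_ok_iff: "empty_ok x \<longleftrightarrow> (\<exists>a b c d. x = encode_instance 0 {} [a, b] [c, d])"
proof
  assume "empty_ok x"
  then obtain i j k where *: "0 < length x" "\<not> has_bit x 0"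
    "is_nat x 1 i" "is_nat x i j" "is_nat x j k" "is_nat x k (length x)"
    by (auto simp: empty_ok_def)
  then obtain t where t: "x = False # t"
    by (cases x) (auto simp: has_bit_def)
  have split: "\<exists>m. drop p x = encode_nat m @ drop q x" if "is_nat x p q" for p q
    using that unfolding is_nat_iff
    by (metis append_take_drop_id drop_drop le_add_diff_inverse2)
  obtain a b c d where "drop 1 x = encode_nat a @ drop i x" "drop i x = encode_nat b @ drop j x"
    "drop j x = encode_nat c @ drop k x" "drop k x = encode_nat d @ drop (length x) x"
    using split[OF *(3)] split[OF *(4)] split[OF *(5)] split[OF *(6)] by blast
  then have "t = encode_nat a @ encode_nat b @ encode_nat c @ encode_nat d"
    by (simp add: t)
  then show "\<exists>a b c d. x = encode_instance 0 {} [a, b] [c, d]"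
    by (auto simp: encode_instance_def adjacency_matrix_def encode_nat_0 t)
next
  assume "\<exists>a b c d. x = encode_instance 0 {} [a, b] [c, d]"
  then obtain a b c d where x: "x = [False] @ encode_nat a @ encode_nat b @ encode_nat c @ encode_nat d"
    by (auto simp: encode_instance_def adjacency_matrix_def encode_nat_0)
  define i where "i = 1 + length (encode_nat a)"
  define j where "j = i + length (encode_nat b)"
  define k where "k = j + length (encode_nat c)"
  have "is_nat x 1 i"
    using is_nat_middle[of "[False]" a] by (simp add: x i_def)
  moreover have "is_nat x i j"
    using is_nat_middle[of "[False] @ encode_nat a" b] by (simp add: x i_def j_def)
  moreover have "is_nat x j k"
    using is_nat_middle[of "[False] @ encode_nat a @ encode_nat b" c] by (simp add: x i_def j_def k_def add.assoc)
  moreover have "is_nat x k (length x)"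
    using is_nat_middle[of "[False] @ encode_nat a @ encode_nat b @ encode_nat c" d "[]"]
    by (simp add: x i_def j_def k_def add.assoc)
  moreover have "0 < length x" "\<not> has_bit x 0" by (simp_all add: x has_bit_def)
  moreover have "p < q" if "is_nat x p q" for p q using that by (simp add: is_nat_def)
  ultimately show "empty_ok x"
    unfolding empty_ok_def by (meson less_trans)
qed

section \<open>The verifier\<close>

definition verify :: "bool list \<Rightarrow> bool list \<Rightarrow> bool" where
  "verify x y \<longleftrightarrow> empty_ok x \<or> (\<exists>n<Suc (length x). 0 < n \<and>
     (\<exists>a<Suc (length x). \<exists>b<Suc (length x). \<exists>c<Suc (length x). \<exists>d<Suc (length x).
        inst_ok x n a b c d \<and> counts_ok (xadj x n) (ycol y n) n a b c d))"

lemmas pc_deep = pc_vars pc_tl[OF pc_tl[OF pc_tl[OF pc_tl[OF pc_tl[OF pc_tl[OF pc_tl[OF pc_arg]]]]]]]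
  pc_tl[OF pc_tl[OF pc_tl[OF pc_tl[OF pc_tl[OF pc_tl[OF pc_tl[OF pc_tl[OF pc_arg]]]]]]]]
  pc_tl[OF pc_tl[OF pc_tl[OF pc_tl[OF pc_tl[OF pc_tl[OF pc_tl[OF pc_tl[OF pc_tl[OF pc_arg]]]]]]]]]

lemma pcp_verify: "pcp (\<lambda>x y s. verify x y)"
  unfolding verify_def empty_ok_def is_nat_def inst_ok_def counts_ok_def loopless_sym_def inst_bit_def
    app_bit_def inst_len_def
  by (intro pc_deep pcp_xadj pcp_ycol pc_elen pcp_ebit pc_intros)

lemma polytime_decidable_verify: "polytime_decidable verify"
proof -
  have "polytime_decidable (\<lambda>x y. of_bool (verify x y) \<noteq> (0::nat))"
    by (rule polytime_decidable_pc[OF pcp_verify[unfolded pcp_def]])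
  then show ?thesis by simp
qed

text \<open>Some vertex realizes the counts, so the entries of the vectors are at most n * n, the
  length of the adjacency matrix within the input. This justifies that \<open>verify\<close>
  searches for them only up to the length of \<open>x\<close>.\<close>

lemma counts_ok_le:
  assumes "counts_ok A Y n a b c d" "0 < n"
  shows "a \<le> n" "b \<le> n" "c \<le> n * n" "d \<le> n * n"
proof -
  have 1: "(\<Sum>u<n. of_bool (P u) :: nat) \<le> n" for P
    using sum_bounded_above[of "{..<n}" "\<lambda>u. of_bool (P u) :: nat" 1] by simp
  have 2: "(\<Sum>u<n. \<Sum>w<u. of_bool (P u w) :: nat) \<le> n * n" for P
  proof -
    have "(\<Sum>w<u. of_bool (P u w) :: nat) \<le> n" if "u < n" for u
    proof -
      have "(\<Sum>w<u. of_bool (P u w) :: nat) \<le> u"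
        using sum_bounded_above[of "{..<u}" "\<lambda>w. of_bool (P u w) :: nat" 1] by simp
      with that show ?thesis by simp
    qed
    then show ?thesis
      using sum_bounded_above[of "{..<n}" "\<lambda>u. \<Sum>w<u. of_bool (P u w) :: nat" n] by simp
  qed
  note e = assms(1)[unfolded counts_ok_def, rule_format, OF assms(2)]
  show "a \<le> n" unfolding e[THEN conjunct1, symmetric] by (rule 1)
  show "b \<le> n" unfolding e[THEN conjunct2, THEN conjunct1, symmetric] by (rule 1)
  show "c \<le> n * n" unfolding e[THEN conjunct2, THEN conjunct2, THEN conjunct1, symmetric] by (rule 2)
  show "d \<le> n * n" unfolding e[THEN conjunct2, THEN conjunct2, THEN conjunct2, symmetric] by (rule 2)
qed

theorem coloring_problem_in_NP: "triangle_regular_coloring_problem 2 \<in> NP"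
proof -
  \<comment> \<open>The certificate is a matrix of colors, no longer than the adjacency matrix in
    \<open>x\<close>; hence the identity polynomial.\<close>
  have "x \<in> triangle_regular_coloring_problem 2 \<longleftrightarrow> (\<exists>y. length y \<le> poly [:0, 1:] (length x) \<and> verify x y)" for x
  proof
    assume "x \<in> triangle_regular_coloring_problem 2"
    then obtain n E r c col where x: "x = encode_instance n E r c"
      and E: "finite_graph {..<n} E" and rc: "length r = 2" "length c = 2"
      and col: "edge_coloring 2 E col" "triangle_regular 2 r c {..<n} E col"
      unfolding triangle_regular_coloring_problem_def by blast
    from rc obtain a b c1 d where r: "r = [a, b]" and c: "c = [c1, d]"
      by (auto simp: numeral_2_eq_2 length_Suc_conv)
    show "\<exists>y. length y \<le> poly [:0, 1:] (length x) \<and> verify x y"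
    proof (cases "n = 0")
      case True
      then have "E = {}" using E by (auto simp: finite_graph_def card_2_iff)
      with True have "empty_ok x" unfolding empty_ok_iff x r c by blast
      then show ?thesis by (intro exI[of _ "[]"]) (simp add: verify_def)
    next
      case False
      define y where "y = map (\<lambda>i. col {i div n, i mod n} = 1) [0..<n * n]"
      note x' = x[unfolded r c]
      note ok = inst_ok_instance[OF E x']
      from ok(1) have ls: "loopless_sym n (xadj x n)" by (simp add: inst_ok_def)
      have Y: "col {u, v} = (if ycol y n u v then 1 else 2)" if "u < n" "v < n" "xadj x n u v" for u v
      proof -
        have "{u, v} \<in> E" using that adj_graph_iff[OF ls] ok(2) by blast
        then have "col {u, v} \<in> {1, 2}" using col(1) by (auto simp: edge_coloring_def numeral_2_eq_2)
        moreover have "ycol y n u v \<longleftrightarrow> col {u, v} = 1"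
          using pair_less[OF that(1,2)] pair_less[OF that(2,1)] that
          by (auto simp: ycol_def y_def has_bit_def insert_commute)
        ultimately show ?thesis by auto
      qed
      have "triangle_regular 2 [a, b] [c1, d] {..<n} (adj_graph n (xadj x n)) col \<longleftrightarrow>
          counts_ok (xadj x n) (ycol y n) n a b c1 d"
        by (rule triangle_regular_counts[OF ls]) (rule Y)
      then have cnt: "counts_ok (xadj x n) (ycol y n) n a b c1 d"
        using col(2) by (simp only: r c ok(2)[symmetric])
      have nn: "n * n \<le> length x" using ok(1) by (simp add: inst_ok_def inst_len_def)
      moreover have "n \<le> n * n" using False by simp
      ultimately have "n \<le> length x" "a \<le> length x" "b \<le> length x" "c1 \<le> length x" "d \<le> length x"
        using counts_ok_le[OF cnt] False by linarith+
      then have "verify x y"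
        unfolding verify_def using ok(1) cnt False
        by (intro disjI2 exI[of _ n] exI[of _ a] exI[of _ b] exI[of _ c1] exI[of _ d] conjI) simp_all
      moreover have "length y \<le> poly [:0, 1:] (length x)" using nn by (simp add: y_def)
      ultimately show ?thesis by blast
    qed
  next
    assume "\<exists>y. length y \<le> poly [:0, 1:] (length x) \<and> verify x y"
    then obtain y where "verify x y" by blast
    then consider "empty_ok x" | n a b c d where "inst_ok x n a b c d" "counts_ok (xadj x n) (ycol y n) n a b c d"
      unfolding verify_def by blast
    then show "x \<in> triangle_regular_coloring_problem 2"
    proof cases
      case 1
      then obtain a b c d where x: "x = encode_instance 0 {} [a, b] [c, d]" unfolding empty_ok_iff by blast
      have "finite_graph {..<0::nat} {}" "edge_coloring 2 {} (\<lambda>_. 1)"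
        "triangle_regular 2 [a, b] [c, d] {..<0::nat} {} (\<lambda>_. 1)"
        by (auto simp: finite_graph_def edge_coloring_def triangle_regular_def)
      then show ?thesis unfolding triangle_regular_coloring_problem_def x
        by (intro CollectI exI[of _ 0] exI[of _ "{}"] exI[of _ "[a, b]"] exI[of _ "[c, d]"] conjI exI[of _ "\<lambda>_. 1"]) auto
    next
      case 2
      define E where "E = adj_graph n (xadj x n)"
      from 2(1) have ls: "loopless_sym n (xadj x n)" by (simp add: inst_ok_def)
      have E: "finite_graph {..<n} E" "x = encode_instance n E [a, b] [c, d]"
        using finite_graph_adj[OF ls] inst_okD[OF 2(1)] by (simp_all add: E_def)
      define col where "col e = (if ycol y n (Max e) (Min e) then 1 else 2::nat)" for e
      have "col {u, v} = (if ycol y n u v then 1 else 2)" for u v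
        by (auto simp: col_def ycol_def max_def min_def)
      with 2(2) have "triangle_regular 2 [a, b] [c, d] {..<n} E col"
        unfolding E_def by (subst triangle_regular_counts[OF ls, where Y = "ycol y n"]) auto
      moreover have "edge_coloring 2 E col" by (auto simp: edge_coloring_def col_def)
      ultimately show ?thesis unfolding triangle_regular_coloring_problem_def
        using E by (intro CollectI exI[of _ n] exI[of _ E] exI[of _ "[a, b]"] exI[of _ "[c, d]"] conjI exI[of _ col]) auto
    qed
  qed
  then show ?thesis unfolding NP_def using polytime_decidable_verify by blast
qed

section \<open>Exact-one systems as colouring instances\<close>

definition rel_graph :: "'a set \<Rightarrow> ('a \<Rightarrow> 'a \<Rightarrow> bool) \<Rightarrow> 'a set set" where
  "rel_graph V A = {{u, v} | u v. u \<in> V \<and> v \<in> V \<and> A u v}"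

lemma card_rel_incident:
  assumes "\<And>u w. A u w \<Longrightarrow> A w u" "v \<in> V"
  shows "card {e \<in> rel_graph V A. v \<in> e \<and> P e} = card {u \<in> V. A v u \<and> P {v, u}}"
proof -
  have "{e \<in> rel_graph V A. v \<in> e \<and> P e} = (\<lambda>u. {v, u}) ` {u \<in> V. A v u \<and> P {v, u}}"
  proof (intro set_eqI iffI)
    fix e assume "e \<in> {e \<in> rel_graph V A. v \<in> e \<and> P e}"
    then obtain u w where e: "e = {u, w}" "u \<in> V" "w \<in> V" "A u w" "v \<in> e" "P {u, w}"
      unfolding rel_graph_def by blast
    then consider "v = u" | "v = w" by blast
    then show "e \<in> (\<lambda>u. {v, u}) ` {u \<in> V. A v u \<and> P {v, u}}"
    proof cases
      case 1
      with e show ?thesis by blast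
    next
      case 2
      with e assms(1) have "A v u" "P {v, u}" "e = {v, u}" by (auto simp: insert_commute)
      with e show ?thesis by blast
    qed
  next
    fix e assume "e \<in> (\<lambda>u. {v, u}) ` {u \<in> V. A v u \<and> P {v, u}}"
    then show "e \<in> {e \<in> rel_graph V A. v \<in> e \<and> P e}"
      using assms(2) unfolding rel_graph_def by blast
  qed
  moreover have "inj_on (\<lambda>u. {v, u}) {u \<in> V. A v u \<and> P {v, u}}"
    by (auto simp: inj_on_def doubleton_eq_iff)
  ultimately show ?thesis by (simp add: card_image)
qed

lemma rel_graph_iff: "(\<And>u w. A u w \<Longrightarrow> A w u) \<Longrightarrow> {u, v} \<in> rel_graph V A \<longleftrightarrow> u \<in> V \<and> v \<in> V \<and> A u v"
  unfolding rel_graph_def by (auto simp: doubleton_eq_iff)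

definition colorable :: "nat \<Rightarrow> nat list \<Rightarrow> nat list \<Rightarrow> 'a set \<Rightarrow> 'a set set \<Rightarrow> bool" where
  "colorable t r c V E \<longleftrightarrow> (\<exists>col. edge_coloring t E col \<and> triangle_regular t r c V E col)"

lemma triangle_regular_image:
  assumes inj: "inj_on h V" and E: "\<And>e. e \<in> E \<Longrightarrow> e \<subseteq> V"
  shows "triangle_regular t r c (h ` V) ((`) h ` E) col \<longleftrightarrow> triangle_regular t r c V E (\<lambda>e. col (h ` e))"
proof -
  have inj': "inj_on ((`) h) E"
    using E by (intro inj_onI) (meson inj inj_on_image_eq_iff)
  have 1: "card {e \<in> (`) h ` E. h v \<in> e \<and> col e = i} = card {e \<in> E. v \<in> e \<and> col (h ` e) = i}" if "v \<in> V" for v i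
  proof -
    have "h v \<in> h ` e \<longleftrightarrow> v \<in> e" if "e \<in> E" for e
      using E[OF that] \<open>v \<in> V\<close> by (rule inj_on_image_mem_iff[OF inj, rotated])
    then have "{e \<in> (`) h ` E. h v \<in> e \<and> col e = i} = (`) h ` {e \<in> E. v \<in> e \<and> col (h ` e) = i}"
      by blast
    moreover have "inj_on ((`) h) {e \<in> E. v \<in> e \<and> col (h ` e) = i}"
      by (rule inj_on_subset[OF inj']) blast
    ultimately show ?thesis by (simp add: card_image)
  qed
  have N: "neighborhood ((`) h ` E) (h v) = h ` neighborhood E v" if "v \<in> V" for v
  proof (intro set_eqI iffI)
    fix w assume "w \<in> neighborhood ((`) h ` E) (h v)"
    then obtain e where e: "e \<in> E" "{w, h v} = h ` e" "w \<noteq> h v" by (auto simp: neighborhood_def)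
    then obtain u where u: "u \<in> e" "w = h u" by (metis imageE insertI1)
    have "h ` e = h ` {u, v}" using e(2) u(2) by simp
    then have "e = {u, v}"
      using inj_on_image_eq_iff[OF inj] E[OF e(1)] that u by (metis empty_subsetI insert_subset subsetD)
    with e u show "w \<in> h ` neighborhood E v" by (auto simp: neighborhood_def)
  next
    fix w assume "w \<in> h ` neighborhood E v"
    then obtain u where u: "w = h u" "{u, v} \<in> E" "u \<noteq> v" by (auto simp: neighborhood_def)
    moreover have "u \<in> V" using E[OF u(2)] by blast
    ultimately show "w \<in> neighborhood ((`) h ` E) (h v)"
      using inj \<open>v \<in> V\<close> by (auto simp: neighborhood_def inj_on_eq_iff intro!: image_eqI[of _ _ "{u, v}"])
  qed
  have 2: "card {e \<in> (`) h ` E. e \<subseteq> neighborhood ((`) h ` E) (h v) \<and> col e = i} =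
      card {e \<in> E. e \<subseteq> neighborhood E v \<and> col (h ` e) = i}" if "v \<in> V" for v i
  proof -
    have NV: "neighborhood E v \<subseteq> V" using E by (fastforce simp: neighborhood_def)
    have "h ` e \<subseteq> h ` neighborhood E v \<longleftrightarrow> e \<subseteq> neighborhood E v" if "e \<in> E" for e
    proof
      assume *: "h ` e \<subseteq> h ` neighborhood E v"
      show "e \<subseteq> neighborhood E v"
      proof
        fix x assume x: "x \<in> e"
        with * obtain y where "y \<in> neighborhood E v" "h x = h y" by blast
        moreover have "x = y"
          using inj \<open>h x = h y\<close> by (rule inj_onD) (use E[OF that] x NV \<open>y \<in> _\<close> in blast)+
        ultimately show "x \<in> neighborhood E v" by simp
      qed
    qed blast
    then have "{e \<in> (`) h ` E. e \<subseteq> neighborhood ((`) h ` E) (h v) \<and> col e = i} =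
        (`) h ` {e \<in> E. e \<subseteq> neighborhood E v \<and> col (h ` e) = i}"
      unfolding N[OF that] by blast
    moreover have "inj_on ((`) h) {e \<in> E. e \<subseteq> neighborhood E v \<and> col (h ` e) = i}"
      by (rule inj_on_subset[OF inj']) blast
    ultimately show ?thesis by (simp add: card_image)
  qed
  show ?thesis
    unfolding triangle_regular_def by (simp add: 1 2)
qed

lemma triangle_regular_cong:
  assumes "\<And>e. e \<in> E \<Longrightarrow> f e = g e"
  shows "triangle_regular t r c V E f \<longleftrightarrow> triangle_regular t r c V E g"
proof -
  have "{e \<in> E. Q e \<and> f e = i} = {e \<in> E. Q e \<and> g e = i}" for Q i
    using assms by (intro Collect_cong) auto
  from this[of "\<lambda>e. v \<in> e" for v] this[of "\<lambda>e. e \<subseteq> neighborhood E v" for v]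
  show ?thesis unfolding triangle_regular_def by simp
qed

text \<open>The gadget is built on structured vertices and an instance lives on an initial segment
  of the naturals; this lemma is the passage between them.\<close>

lemma colorable_image:
  assumes inj: "inj_on h V" and E: "\<And>e. e \<in> E \<Longrightarrow> e \<subseteq> V"
  shows "colorable t r c (h ` V) ((`) h ` E) \<longleftrightarrow> colorable t r c V E"
proof
  assume "colorable t r c (h ` V) ((`) h ` E)"
  then obtain col where "edge_coloring t ((`) h ` E) col" "triangle_regular t r c (h ` V) ((`) h ` E) col"
    by (auto simp: colorable_def)
  then have "edge_coloring t E (\<lambda>e. col (h ` e))" "triangle_regular t r c V E (\<lambda>e. col (h ` e))"
    using triangle_regular_image[OF assms] by (auto simp: edge_coloring_def)
  then show "colorable t r c V E" unfolding colorable_def by blast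
next
  assume "colorable t r c V E"
  then obtain col where col: "edge_coloring t E col" "triangle_regular t r c V E col"
    by (auto simp: colorable_def)
  define col' where "col' e = col (the_inv_into V h ` e)" for e
  have *: "col' (h ` e) = col e" if "e \<in> E" for e
  proof -
    have "\<forall>x\<in>e. the_inv_into V h (h x) = x"
      using E[OF that] the_inv_into_f_f[OF inj] by blast
    then have "the_inv_into V h ` h ` e = e"
      by (simp add: image_image)
    then show ?thesis by (simp add: col'_def)
  qed
  have "edge_coloring t ((`) h ` E) col'"
    unfolding edge_coloring_def
  proof
    fix f assume "f \<in> (`) h ` E"
    then obtain e where "e \<in> E" "f = h ` e" by blast
    then show "col' f \<in> {1..t}" using col(1) *[of e] by (simp add: edge_coloring_def)
  qed
  moreover have "triangle_regular t r c V E (\<lambda>e. col' (h ` e))"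
    using col(2) triangle_regular_cong[where f = "\<lambda>e. col' (h ` e)" and g = col and E = E, OF *] by metis
  then have "triangle_regular t r c (h ` V) ((`) h ` E) col'"
    using triangle_regular_image[OF assms, where col = col' and t = t and r = r and c = c] by simp
  ultimately show "colorable t r c (h ` V) ((`) h ` E)"
    unfolding colorable_def by blast
qed

section \<open>The gadget graph of an exact-one system\<close>

text \<open>
  A row of the system demands that exactly one of its variables is selected.  The vertices
  \<open>Some e\<close> for the two ends \<open>e\<close> belong to a variable, which is selected iff the edge between
  them has color 1; the vertices \<open>None\<close> belong to a row and see this edge for each of its
  variables.  The copies \<open>(b, \<kappa>)\<close> form a complete bipartite graph, whose edges compensate for
  the degrees.
\<close>

type_synonym 'i vertex = "bool option \<times> bool \<times> nat \<times> 'i"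

definition gadget_vertices :: "'i set \<Rightarrow> nat \<Rightarrow> 'i vertex set" where
  "gadget_vertices I m = UNIV \<times> UNIV \<times> {..<m} \<times> I"

fun gadget_adj :: "('i \<Rightarrow> 'i set) \<Rightarrow> 'i vertex \<Rightarrow> 'i vertex \<Rightarrow> bool" where
  "gadget_adj row (Some e, b, \<kappa>, i) (Some e', b', \<kappa>', j) \<longleftrightarrow>
     i = j \<and> (if b = b' then \<kappa> = \<kappa>' \<and> e \<noteq> e' else e = e')"
| "gadget_adj row (Some e, b, \<kappa>, i) (None, b', \<kappa>', j) \<longleftrightarrow> b = b' \<and> \<kappa> = \<kappa>' \<and> i \<in> row j"
| "gadget_adj row (None, b, \<kappa>, i) (Some e, b', \<kappa>', j) \<longleftrightarrow> b = b' \<and> \<kappa> = \<kappa>' \<and> j \<in> row i"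
| "gadget_adj row (None, b, \<kappa>, i) (None, b', \<kappa>', j) \<longleftrightarrow> False"

text \<open>The intended color 1 for a selection \<open>X\<close>. An unselected variable takes the
  edge of color 1 that it lacks from the matching of copy \<open>(b, \<kappa>)\<close> with
  \<open>(\<not> b, \<kappa>)\<close>. On edges between ends and rows, color 1 follows the matching
  of each variable with the row of the same index.\<close>

fun gadget_red :: "'i set \<Rightarrow> 'i vertex \<Rightarrow> 'i vertex \<Rightarrow> bool" where
  "gadget_red X (Some e, b, \<kappa>, i) (Some e', b', \<kappa>', j) \<longleftrightarrow>
     i = j \<and> \<kappa> = \<kappa>' \<and> (if b = b' then i \<in> X else i \<notin> X)"
| "gadget_red X (r, b, \<kappa>, i) (r', b', \<kappa>', j) \<longleftrightarrow> i = j"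

lemma gadget_adj_sym: "gadget_adj row u v \<Longrightarrow> gadget_adj row v u"
  by (cases "(row, u, v)" rule: gadget_adj.cases) (auto split: if_splits)

lemma gadget_red_sym: "gadget_red X u v \<Longrightarrow> gadget_red X v u"
  by (cases "(X, u, v)" rule: gadget_red.cases) (auto split: if_splits elim: option.exhaust)

lemma gadget_adj_irrefl: "\<not> gadget_adj row u u"
  by (cases "(row, u, u)" rule: gadget_adj.cases) auto

lemma card_split_colors:
  assumes "finite S" "\<And>x. x \<in> S \<Longrightarrow> f x = 1 \<or> f x = (2::nat)" "card S = n" "card {x \<in> S. f x = 1} = l"
  shows "card {x \<in> S. f x = 2} = n - l"
proof -
  have "card S = card ({x \<in> S. f x = 1} \<union> {x \<in> S. f x = 2})"
    using assms(2) by (intro arg_cong[of _ _ card]) blast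
  also have "\<dots> = card {x \<in> S. f x = 1} + card {x \<in> S. f x = 2}"
    using assms(1) by (intro card_Un_disjoint) auto
  finally show ?thesis using assms(3,4) by simp
qed

text \<open>Rows have \<open>Suc m\<close> variables, so \<open>m\<close> is the k - 1 of the
  overview. Constant row and column sizes make the degrees constant; \<open>diag\<close> supplies
  the perfect matching of variables with rows that color 1 follows.\<close>

locale exact_one =
  fixes I :: "'i set" and row :: "'i \<Rightarrow> 'i set" and m :: nat
  assumes fin: "finite I" and diag: "i \<in> I \<Longrightarrow> i \<in> row i" and row_sub: "i \<in> I \<Longrightarrow> row i \<subseteq> I"
    and card_row: "i \<in> I \<Longrightarrow> card (row i) = Suc m"
    and card_col: "i \<in> I \<Longrightarrow> card {j \<in> I. i \<in> row j} = Suc m" and m: "m > 0"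
begin

abbreviation "VG \<equiv> gadget_vertices I m"
abbreviation "EG \<equiv> rel_graph VG (gadget_adj row)"

lemma EG_iff: "{u, v} \<in> EG \<longleftrightarrow> u \<in> VG \<and> v \<in> VG \<and> gadget_adj row u v"
  using gadget_adj_sym by (rule rel_graph_iff)

lemma nbh: "v \<in> VG \<Longrightarrow> neighborhood EG v = {u \<in> VG. gadget_adj row v u}"
  unfolding neighborhood_def EG_iff using gadget_adj_sym gadget_adj_irrefl by blast

lemma nbh_variable:
  assumes "\<kappa> < m" "i \<in> I"
  shows "{u \<in> VG. gadget_adj row (Some e, b, \<kappa>, i) u} =
    insert (Some (\<not> e), b, \<kappa>, i) ((\<lambda>j. (None, b, \<kappa>, j)) ` {j \<in> I. i \<in> row j} \<union> (\<lambda>\<kappa>'. (Some e, \<not> b, \<kappa>', i)) ` {..<m})"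
    (is "?L = ?R")
proof (rule set_eqI)
  fix u :: "'i vertex"
  obtain r' b' \<kappa>' j where u: "u = (r', b', \<kappa>', j)" by (cases u)
  show "u \<in> ?L \<longleftrightarrow> u \<in> ?R"
  proof (cases r')
    case None
    then show ?thesis using assms by (auto simp: u gadget_vertices_def)
  next
    case (Some e')
    then show ?thesis using assms by (cases "b' = b") (auto simp: u gadget_vertices_def)
  qed
qed

lemma nbh_row:
  assumes "\<kappa> < m" "j \<in> I"
  shows "{u \<in> VG. gadget_adj row (None, b, \<kappa>, j) u} = {Some False, Some True} \<times> {b} \<times> {\<kappa>} \<times> row j"
    (is "?L = ?R")
proof (rule set_eqI)
  fix u :: "'i vertex"
  obtain r' b' \<kappa>' i where u: "u = (r', b', \<kappa>', i)" by (cases u)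
  show "u \<in> ?L \<longleftrightarrow> u \<in> ?R"
    using assms row_sub[of j] by (cases r') (auto simp: u gadget_vertices_def)
qed

text \<open>The other end is adjacent to the same rows, and rows are pairwise nonadjacent. The
  neighbors on the opposite side are equal ends of copies on one side, hence nonadjacent to each
  other and to the remaining neighbors: edges between copies lie in no triangle.\<close>

lemma induced_variable:
  assumes "\<kappa> < m" "i \<in> I"
  shows "{f \<in> EG. f \<subseteq> {u \<in> VG. gadget_adj row (Some e, b, \<kappa>, i) u}} =
    (\<lambda>j. {(Some (\<not> e), b, \<kappa>, i), (None, b, \<kappa>, j)}) ` {j \<in> I. i \<in> row j}" (is "?L = ?R")
proof (intro set_eqI iffI)
  fix f assume "f \<in> ?L"
  then obtain u v where f: "f = {u, v}" "gadget_adj row u v"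
    "u \<in> {u \<in> VG. gadget_adj row (Some e, b, \<kappa>, i) u}" "v \<in> {u \<in> VG. gadget_adj row (Some e, b, \<kappa>, i) u}"
    unfolding rel_graph_def by blast
  have "(\<exists>j\<in>I. i \<in> row j \<and> u = (Some (\<not> e), b, \<kappa>, i) \<and> v = (None, b, \<kappa>, j)) \<or>
      (\<exists>j\<in>I. i \<in> row j \<and> v = (Some (\<not> e), b, \<kappa>, i) \<and> u = (None, b, \<kappa>, j))"
    using f(2,3,4) unfolding nbh_variable[OF assms] by auto
  then show "f \<in> ?R"
    unfolding f(1) by (auto simp: insert_commute)
next
  fix f assume "f \<in> ?R"
  then obtain j where j: "j \<in> I" "i \<in> row j" "f = {(Some (\<not> e), b, \<kappa>, i), (None, b, \<kappa>, j)}" by blast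
  have "f \<in> EG" unfolding j(3) EG_iff using j assms by (simp add: gadget_vertices_def)
  moreover have "f \<subseteq> {u \<in> VG. gadget_adj row (Some e, b, \<kappa>, i) u}"
    unfolding nbh_variable[OF assms] using j by blast
  ultimately show "f \<in> ?L" by blast
qed

text \<open>All neighbors of a row lie in a single copy, where two ends are adjacent only if they
  are the two ends of one variable.\<close>

lemma induced_row:
  assumes "\<kappa> < m" "j \<in> I"
  shows "{f \<in> EG. f \<subseteq> {u \<in> VG. gadget_adj row (None, b, \<kappa>, j) u}} =
    (\<lambda>i. {(Some False, b, \<kappa>, i), (Some True, b, \<kappa>, i)}) ` row j" (is "?L = ?R")
proof (intro set_eqI iffI)
  fix f assume "f \<in> ?L"
  then obtain u v where f: "f = {u, v}" "gadget_adj row u v"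
    "u \<in> {u \<in> VG. gadget_adj row (None, b, \<kappa>, j) u}" "v \<in> {u \<in> VG. gadget_adj row (None, b, \<kappa>, j) u}"
    unfolding rel_graph_def by blast
  have "\<exists>i\<in>row j. u = (Some False, b, \<kappa>, i) \<and> v = (Some True, b, \<kappa>, i) \<or> v = (Some False, b, \<kappa>, i) \<and> u = (Some True, b, \<kappa>, i)"
    using f(2,3,4) unfolding nbh_row[OF assms] by auto
  then show "f \<in> ?R"
    unfolding f(1) by (auto simp: insert_commute)
next
  fix f assume "f \<in> ?R"
  then obtain i where i: "i \<in> row j" "f = {(Some False, b, \<kappa>, i), (Some True, b, \<kappa>, i)}" by blast
  have "i \<in> I" using i(1) row_sub[OF assms(2)] by blast
  then have "f \<in> EG" unfolding i(2) EG_iff using assms by (simp add: gadget_vertices_def)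
  moreover have "f \<subseteq> {u \<in> VG. gadget_adj row (None, b, \<kappa>, j) u}"
    unfolding nbh_row[OF assms] i(2) using i(1) by blast
  ultimately show "f \<in> ?L" by blast
qed

lemma card_induced_variable:
  assumes "\<kappa> < m" "i \<in> I"
  shows "card {f \<in> EG. f \<subseteq> neighborhood EG (Some e, b, \<kappa>, i) \<and> P f} =
    card {j \<in> I. i \<in> row j \<and> P {(Some (\<not> e), b, \<kappa>, i), (None, b, \<kappa>, j)}}"
proof -
  have "(Some e, b, \<kappa>, i) \<in> VG" using assms by (simp add: gadget_vertices_def)
  then have "{f \<in> EG. f \<subseteq> neighborhood EG (Some e, b, \<kappa>, i) \<and> P f} =
      {f \<in> {f \<in> EG. f \<subseteq> {u \<in> VG. gadget_adj row (Some e, b, \<kappa>, i) u}}. P f}"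
    by (auto simp: nbh)
  also have "\<dots> = (\<lambda>j. {(Some (\<not> e), b, \<kappa>, i), (None, b, \<kappa>, j)}) ` {j \<in> I. i \<in> row j \<and> P {(Some (\<not> e), b, \<kappa>, i), (None, b, \<kappa>, j)}}"
    unfolding induced_variable[OF assms] by auto
  finally show ?thesis
    by (simp add: card_image inj_on_def doubleton_eq_iff)
qed

lemma card_induced_row:
  assumes "\<kappa> < m" "j \<in> I"
  shows "card {f \<in> EG. f \<subseteq> neighborhood EG (None, b, \<kappa>, j) \<and> P f} =
    card {i \<in> row j. P {(Some False, b, \<kappa>, i), (Some True, b, \<kappa>, i)}}"
proof -
  have "(None, b, \<kappa>, j) \<in> VG" using assms by (simp add: gadget_vertices_def)
  then have "{f \<in> EG. f \<subseteq> neighborhood EG (None, b, \<kappa>, j) \<and> P f} =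
      {f \<in> {f \<in> EG. f \<subseteq> {u \<in> VG. gadget_adj row (None, b, \<kappa>, j) u}}. P f}"
    by (auto simp: nbh)
  also have "\<dots> = (\<lambda>i. {(Some False, b, \<kappa>, i), (Some True, b, \<kappa>, i)}) ` {i \<in> row j. P {(Some False, b, \<kappa>, i), (Some True, b, \<kappa>, i)}}"
    unfolding induced_row[OF assms] by auto
  finally show ?thesis
    by (simp add: card_image inj_on_def doubleton_eq_iff)
qed

theorem colorable_iff:
  "colorable 2 [2, 2 * m] [1, m] VG EG \<longleftrightarrow> (\<exists>X. \<forall>j\<in>I. card (row j \<inter> X) = 1)"
proof
  assume "colorable 2 [2, 2 * m] [1, m] VG EG"
  then obtain col where "triangle_regular 2 [2, 2 * m] [1, m] VG EG col" by (auto simp: colorable_def)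
  then have "card {f \<in> EG. f \<subseteq> neighborhood EG v \<and> col f = 1} = 1" if "v \<in> VG" for v
    using that by (force simp: triangle_regular_def)
  \<comment> \<open>The selection is read off in the copy \<open>(False, 0)\<close>, which exists
    since \<open>m\<close> is positive.\<close>
  then have "card {i \<in> row j. col {(Some False, False, 0, i), (Some True, False, 0, i)} = 1} = 1" if "j \<in> I" for j
    using card_induced_row[of 0 j False "\<lambda>e. col e = 1"] that m by (simp add: gadget_vertices_def)
  then show "\<exists>X. \<forall>j\<in>I. card (row j \<inter> X) = 1"
    by (intro exI[of _ "{i. col {(Some False, False, 0, i), (Some True, False, 0, i)} = 1}"]) (simp add: Int_def)
next
  assume "\<exists>X. \<forall>j\<in>I. card (row j \<inter> X) = 1"
  then obtain X where X: "\<And>j. j \<in> I \<Longrightarrow> card (row j \<inter> X) = 1" by blast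
  define col where "col e = (if \<exists>u v. e = {u, v} \<and> gadget_red X u v then 1 else 2::nat)" for e :: "'i vertex set"
  have col: "col {u, v} = (if gadget_red X u v then 1 else 2)" for u v
  proof -
    have "(\<exists>u' v'. {u, v} = {u', v'} \<and> gadget_red X u' v') \<longleftrightarrow> gadget_red X u v"
      using gadget_red_sym by (metis doubleton_eq_iff)
    then show ?thesis by (simp add: col_def)
  qed
  have col12: "col e = 1 \<or> col e = 2" for e by (simp add: col_def)
  have finV: "finite VG" using fin by (simp add: gadget_vertices_def)
  have finR: "finite (row j)" if "j \<in> I" for j using row_sub[OF that] fin by (rule finite_subset)
  have counts: "card {f \<in> EG. v \<in> f \<and> col f = 1} = 2 \<and> card {f \<in> EG. v \<in> f \<and> col f = 2} = 2 * m \<and>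
      card {f \<in> EG. f \<subseteq> neighborhood EG v \<and> col f = 1} = 1 \<and>
      card {f \<in> EG. f \<subseteq> neighborhood EG v \<and> col f = 2} = m" if v: "v \<in> VG" for v
  proof -
    obtain r b \<kappa> i where veq: "v = (r, b, \<kappa>, i)" by (cases v)
    with v have *: "\<kappa> < m" "i \<in> I" by (auto simp: gadget_vertices_def)
    let ?N = "{u \<in> VG. gadget_adj row v u}"
    have inc: "card {f \<in> EG. v \<in> f \<and> col f = l} = card {u \<in> ?N. col {v, u} = l}" for l
      using card_rel_incident[of "gadget_adj row" v VG "\<lambda>e. col e = l", OF gadget_adj_sym v] by simp
    have finN: "finite ?N" using finV by simp
    show ?thesis
    proof (cases r)
      case r: (Some e)
      note N = nbh_variable[OF *, of e b, folded r, folded veq]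
      \<comment> \<open>The other end, \<open>Suc m\<close> rows and \<open>m\<close> copies on the
        opposite side: exactly the degree 2 + 2 m of a row vertex.\<close>
      have "card ?N = Suc (Suc m + m)"
      proof -
        have "card ((\<lambda>j. (None, b, \<kappa>, j)) ` {j \<in> I. i \<in> row j} \<union> (\<lambda>\<kappa>'. (Some e, \<not> b, \<kappa>', i)) ` {..<m}) = Suc m + m"
          using r fin card_col[OF *(2)] by (subst card_Un_disjoint) (auto simp: card_image inj_on_def)
        then show ?thesis unfolding N using r * fin by (subst card_insert_disjoint) auto
      qed
      \<comment> \<open>One edge of color 1 goes to the row of index \<open>i\<close>, the second to
        the other end or to the matched copy, depending on \<open>X\<close>.\<close>
      moreover have "{u \<in> ?N. col {v, u} = 1} =
          {(None, b, \<kappa>, i), if i \<in> X then (Some (\<not> e), b, \<kappa>, i) else (Some e, \<not> b, \<kappa>, i)}"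
        unfolding N using r * diag[OF *(2)] by (auto simp: col veq split: if_splits)
      then have red: "card {u \<in> ?N. col {v, u} = 1} = 2" using r by auto
      ultimately have blue: "card {u \<in> ?N. col {v, u} = 2} = 2 * m"
        using card_split_colors[OF finN, of "\<lambda>u. col {v, u}", OF col12 _ red] by simp
      have "{j \<in> {j \<in> I. i \<in> row j}. col {(Some (\<not> e), b, \<kappa>, i), (None, b, \<kappa>, j)} = 1} = {i}"
        using r * diag[OF *(2)] by (auto simp: col split: if_splits)
      then have red': "card {j \<in> {j \<in> I. i \<in> row j}. col {(Some (\<not> e), b, \<kappa>, i), (None, b, \<kappa>, j)} = 1} = 1" by simp
      have blue': "card {j \<in> {j \<in> I. i \<in> row j}. col {(Some (\<not> e), b, \<kappa>, i), (None, b, \<kappa>, j)} = 2} = Suc m - 1"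
        by (rule card_split_colors[OF _ col12 card_col[OF *(2)] red']) (simp add: fin)
      show ?thesis
        using red blue red' blue' unfolding inc unfolding veq r card_induced_variable[OF *] by simp
    next
      case r: None
      note N = nbh_row[OF *, of b, folded r, folded veq]
      have "card ?N = 2 * Suc m" unfolding N using card_row[OF *(2)] by (simp add: card_cartesian_product)
      moreover have "{u \<in> ?N. col {v, u} = 1} = {(Some False, b, \<kappa>, i), (Some True, b, \<kappa>, i)}"
        unfolding N using r * diag[OF *(2)] by (auto simp: col veq split: if_splits)
      then have red: "card {u \<in> ?N. col {v, u} = 1} = 2" by simp
      ultimately have blue: "card {u \<in> ?N. col {v, u} = 2} = 2 * m"
        using card_split_colors[OF finN, of "\<lambda>u. col {v, u}", OF col12 _ red] by simp
      have "{j \<in> row i. col {(Some False, b, \<kappa>, j), (Some True, b, \<kappa>, j)} = 1} = row i \<inter> X"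
        by (auto simp: col)
      then have red': "card {j \<in> row i. col {(Some False, b, \<kappa>, j), (Some True, b, \<kappa>, j)} = 1} = 1" using X[OF *(2)] by simp
      have blue': "card {j \<in> row i. col {(Some False, b, \<kappa>, j), (Some True, b, \<kappa>, j)} = 2} = Suc m - 1"
        by (rule card_split_colors[OF finR[OF *(2)] col12 card_row[OF *(2)] red'])
      show ?thesis
        using red blue red' blue' unfolding inc unfolding veq r card_induced_row[OF *] by simp
    qed
  qed
  have "{1..2::nat} = {1, 2}" by auto
  then have "triangle_regular 2 [2, 2 * m] [1, m] VG EG col"
    using counts unfolding triangle_regular_def by simp
  moreover have "edge_coloring 2 EG col" using col12 by (auto simp: edge_coloring_def col_def)
  ultimately show "colorable 2 [2, 2 * m] [1, m] VG EG" unfolding colorable_def by blast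
qed

end

section \<open>Binary constraint systems as exact-one systems\<close>

text \<open>Values range below \<open>P * C\<close> because an element must also be able to name a
  partner cell together with a constraint number; the number \<open>C - 1\<close> is kept free for
  an auxiliary constraint.\<close>

definition csp_solvable :: "nat \<Rightarrow> nat \<Rightarrow> (nat \<Rightarrow> nat \<Rightarrow> nat \<Rightarrow> nat \<Rightarrow> bool) \<Rightarrow>
    (nat \<Rightarrow> nat \<Rightarrow> nat \<Rightarrow> nat \<Rightarrow> bool) \<Rightarrow> bool" where
  "csp_solvable P C F G \<longleftrightarrow> (\<exists>val. (\<forall>p<P. val p < P * C) \<and>
     (\<forall>p<P. \<forall>q<P. p \<noteq> q \<longrightarrow> (\<forall>c<C - 1. F p q c (val p) = G p q c (val q))))"

text \<open>
  Each cell has five blocks of elements, of which it selects one.  Block 2 holds the values.  The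
  elements of blocks 0 and 1 are also the names of the constraints in which the cell comes first or
  second, and the rows of such a constraint \<open>(p, q, c)\<close> say that the element selected at \<open>p\<close> lies in
  a certain set iff the one selected at \<open>q\<close> does.  As all rows must have the same size, all these sets
  have the same size: a set contains block 0 or 1, and exactly one of \<open>(2, a)\<close> and \<open>(3, a)\<close> for each
  value \<open>a\<close>.  The constraints with \<open>c = C - 1\<close> force all cells to select elements of block 2: their sets
  are the blocks 0 and 4 for \<open>p\<close>, and the blocks 1 and 3 for \<open>q\<close>.
\<close>

definition kind :: "nat \<Rightarrow> (nat \<Rightarrow> nat \<Rightarrow> nat \<Rightarrow> nat \<Rightarrow> bool) \<Rightarrow> (nat \<Rightarrow> nat \<Rightarrow> nat \<Rightarrow> nat \<Rightarrow> bool) \<Rightarrow>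
    nat \<Rightarrow> nat \<Rightarrow> nat \<Rightarrow> nat \<Rightarrow> nat \<Rightarrow> nat" where
  "kind C F G s p q c a = (if c = C - 1 then (if s = 0 then 4 else 3)
     else if (if s = 0 then F p q c a else G q p c a) then 2 else 3)"

definition in_slot :: "nat \<Rightarrow> (nat \<Rightarrow> nat \<Rightarrow> nat \<Rightarrow> nat \<Rightarrow> bool) \<Rightarrow> (nat \<Rightarrow> nat \<Rightarrow> nat \<Rightarrow> nat \<Rightarrow> bool) \<Rightarrow>
    nat \<Rightarrow> nat \<Rightarrow> nat \<Rightarrow> nat \<Rightarrow> nat \<Rightarrow> nat \<Rightarrow> bool" where
  "in_slot C F G s p q c t a \<longleftrightarrow> t = s \<or> t = kind C F G s p q c a"

text \<open>For \<open>t < 2\<close>, \<open>a\<close> names the partner cell \<open>a div C\<close>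
  and the constraint number \<open>a mod C\<close>, and \<open>t\<close> says whether
  \<open>p\<close> comes first or second. The row is the slot set at \<open>p\<close> and the
  complement of the slot set at the partner; it contains its own index because a slot set contains
  block \<open>t\<close>. Elements that name no constraint index the row of the whole cell, which
  demands that the cell selects one element.\<close>

definition in_row :: "nat \<Rightarrow> (nat \<Rightarrow> nat \<Rightarrow> nat \<Rightarrow> nat \<Rightarrow> bool) \<Rightarrow> (nat \<Rightarrow> nat \<Rightarrow> nat \<Rightarrow> nat \<Rightarrow> bool) \<Rightarrow>
    nat \<Rightarrow> nat \<Rightarrow> nat \<Rightarrow> nat \<Rightarrow> nat \<Rightarrow> nat \<Rightarrow> bool" where
  "in_row C F G p t a p' t' a' \<longleftrightarrow>
    (if t < 2 \<and> a div C \<noteq> p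
     then p' = p \<and> in_slot C F G t p (a div C) (a mod C) t' a' \<or>
          p' = a div C \<and> \<not> in_slot C F G (1 - t) (a div C) p (a mod C) t' a'
     else p' = p)"

locale csp =
  fixes P C :: nat and F G :: "nat \<Rightarrow> nat \<Rightarrow> nat \<Rightarrow> nat \<Rightarrow> bool"
  assumes P: "P \<ge> 3" and C: "C > 0"
begin

abbreviation "w \<equiv> P * C"
abbreviation "slot \<equiv> in_slot C F G"

definition elems :: "(nat \<times> nat) set" where "elems = {..<5} \<times> {..<w}"

definition I :: "(nat \<times> nat \<times> nat) set" where "I = {..<P} \<times> elems"

definition row :: "nat \<times> nat \<times> nat \<Rightarrow> (nat \<times> nat \<times> nat) set" where
  "row = (\<lambda>(p, t, a). {(p', t', a'). (p', t', a') \<in> I \<and> in_row C F G p t a p' t' a'})"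

definition slots :: "nat \<Rightarrow> nat \<Rightarrow> nat \<Rightarrow> nat \<Rightarrow> (nat \<times> nat) set" where
  "slots s p q c = {(t, a). (t, a) \<in> elems \<and> slot s p q c t a}"

lemma kind_bounds: "2 \<le> kind C F G s p q c a" "kind C F G s p q c a < 5"
  by (auto simp: kind_def)

lemma fin_elems: "finite elems" and card_elems: "card elems = 5 * w"
  by (simp_all add: elems_def)

lemma slots_sub: "slots s p q c \<subseteq> elems"
  by (auto simp: slots_def)

lemma card_slots: "s < 2 \<Longrightarrow> card (slots s p q c) = 2 * w"
proof -
  assume s: "s < 2"
  let ?k = "kind C F G s p q c"
  have "slots s p q c = (\<lambda>a. (s, a)) ` {..<w} \<union> (\<lambda>a. (?k a, a)) ` {..<w}"
    using s kind_bounds(2)[of s p q c] by (auto simp: slots_def elems_def in_slot_def)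
  moreover have "(\<lambda>a. (s, a)) ` {..<w} \<inter> (\<lambda>a. (?k a, a)) ` {..<w} = {}"
  proof -
    have "?k a \<noteq> s" for a using s kind_bounds(1)[of s p q c a] by linarith
    then have "(s, b) \<noteq> (?k a, a)" for a b by (metis prod.inject)
    then show ?thesis by blast
  qed
  ultimately show ?thesis by (simp add: card_Un_disjoint card_image inj_on_def)
qed

lemma div_mod_slot: "q < P \<Longrightarrow> c < C \<Longrightarrow> q * C + c < w \<and> (q * C + c) div C = q \<and> (q * C + c) mod C = c"
  using pair_less[of q P c C] by simp

lemma slot_div: "a < w \<Longrightarrow> a div C < P \<and> a mod C < C"
  using C by (simp add: less_mult_imp_div_less)

lemma row_cell:
  assumes "p < P" "\<not> (t < 2 \<and> a div C \<noteq> p)"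
  shows "row (p, t, a) = {p} \<times> elems"
  using assms by (auto simp: row_def I_def in_row_def)

lemma row_slot:
  assumes "p < P" "a < w" "t < 2" "a div C \<noteq> p"
  shows "row (p, t, a) = {p} \<times> slots t p (a div C) (a mod C) \<union> {a div C} \<times> (elems - slots (1 - t) (a div C) p (a mod C))"
  using assms slot_div[OF assms(2)] by (auto simp: row_def I_def in_row_def slots_def)

text \<open>\<open>2 * w\<close> elements at one cell and all but \<open>2 * w\<close> at the other
  add up to \<open>5 * w\<close>, the size of a whole cell.\<close>

lemma card_row: "i \<in> I \<Longrightarrow> card (row i) = 5 * w"
proof -
  assume i: "i \<in> I"
  obtain p t a where i': "i = (p, t, a)" by (cases i)
  with i have *: "p < P" "t < 5" "a < w" by (auto simp: I_def elems_def)
  show ?thesis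
  proof (cases "t < 2 \<and> a div C \<noteq> p")
    case True
    let ?q = "a div C" and ?c = "a mod C"
    have fin: "finite (slots s p' q c)" for s p' q c using slots_sub fin_elems by (rule finite_subset)
    have "card (row i) = card ({p} \<times> slots t p ?q ?c) + card ({?q} \<times> (elems - slots (1 - t) ?q p ?c))"
    proof -
      have "row i = {p} \<times> slots t p ?q ?c \<union> {?q} \<times> (elems - slots (1 - t) ?q p ?c)"
        unfolding i' using True * by (intro row_slot) auto
      moreover have "({p} \<times> slots t p ?q ?c) \<inter> ({?q} \<times> (elems - slots (1 - t) ?q p ?c)) = {}"
        using True by auto
      ultimately show ?thesis using fin fin_elems by (simp only: card_Un_disjoint finite_cartesian_product
          finite.intros finite_Diff)
    qed
    also have "\<dots> = 2 * w + (5 * w - 2 * w)"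
      using True card_slots[of t] card_slots[of "1 - t"] card_elems
      by (simp add: card_cartesian_product card_Diff_subset[OF fin slots_sub])
    finally show ?thesis by simp
  next
    case False
    then show ?thesis using * by (simp add: i' row_cell card_elems card_cartesian_product)
  qed
qed

text \<open>Every constraint has two rows, one named from each side, and they are complementary
  within the two cells. The set \<open>out\<close> consists of the indices at cell \<open>p\<close>
  whose row misses \<open>i\<close>, and \<open>g\<close> sends each of them to the other row of its
  constraint, which then contains \<open>i\<close>. So the count equals the number of elements of
  cell \<open>p\<close>.\<close>

lemma card_col: "i \<in> I \<Longrightarrow> card {j \<in> I. i \<in> row j} = 5 * w"
proof -
  assume i: "i \<in> I"
  obtain p t a where i': "i = (p, t, a)" by (cases i)
  with i have p: "p < P" and ta: "(t, a) \<in> elems" by (auto simp: I_def)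
  define out where "out = {(s, b). (s, b) \<in> elems \<and> s < 2 \<and> b div C \<noteq> p \<and> \<not> slot s p (b div C) (b mod C) t a}"
  define g where "g = (\<lambda>(s, b). (b div C, 1 - s :: nat, p * C + b mod C))"
  have out_sub: "out \<subseteq> elems" by (auto simp: out_def)
  have fin_out: "finite out" using out_sub fin_elems by (rule finite_subset)
  have inj: "inj_on g out"
  proof (rule inj_onI)
    fix x y assume "x \<in> out" "y \<in> out" "g x = g y"
    then obtain s b s' b' where xy: "x = (s, b)" "y = (s', b')" "s < 2" "s' < 2"
      "b div C = b' div C" "1 - s = 1 - s'" "p * C + b mod C = p * C + b' mod C"
      by (auto simp: out_def g_def)
    then have "b = b'" by (metis add_left_imp_eq div_mult_mod_eq)
    moreover have "s = s'" using xy by linarith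
    ultimately show "x = y" using xy by simp
  qed
  have eq: "{j \<in> I. i \<in> row j} = {p} \<times> (elems - out) \<union> g ` out"
  proof (rule set_eqI)
    fix j :: "nat \<times> nat \<times> nat"
    obtain p' s b where j: "j = (p', s, b)" by (cases j)
    show "j \<in> {j \<in> I. i \<in> row j} \<longleftrightarrow> j \<in> {p} \<times> (elems - out) \<union> g ` out"
    proof (cases "p' = p")
      case True
      have "j \<notin> g ` out"
        by (auto simp: g_def out_def j True)
      then show ?thesis
        using p ta by (auto simp: j True I_def row_def in_row_def out_def i')
    next
      case False
      have "j \<in> {j \<in> I. i \<in> row j} \<longleftrightarrow> p' < P \<and> b < w \<and> s < 2 \<and> b div C = p \<and> \<not> slot (1 - s) p p' (b mod C) t a"
        using False p ta by (auto simp: j I_def row_def in_row_def i' elems_def)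
      also have "\<dots> \<longleftrightarrow> j \<in> g ` out"
      proof
        assume *: "p' < P \<and> b < w \<and> s < 2 \<and> b div C = p \<and> \<not> slot (1 - s) p p' (b mod C) t a"
        then have "b mod C < C" using C by simp
        note d = div_mod_slot[OF conjunct1[OF *] this]
        have "(1 - s, p' * C + b mod C) \<in> out"
          using * d False by (auto simp: out_def elems_def)
        moreover have "g (1 - s, p' * C + b mod C) = j"
          using * d by (auto simp: g_def j)
        ultimately show "j \<in> g ` out" by (metis imageI)
      next
        assume "j \<in> g ` out"
        then obtain s' b' where *: "(s', b') \<in> out" "j = (b' div C, 1 - s', p * C + b' mod C)"
          by (auto simp: g_def)
        then have "b' < w" "s' < 2" by (auto simp: out_def elems_def)
        then have "b' div C < P" "b' mod C < C" using slot_div by auto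
        then show "p' < P \<and> b < w \<and> s < 2 \<and> b div C = p \<and> \<not> slot (1 - s) p p' (b mod C) t a"
          using * div_mod_slot[OF p \<open>b' mod C < C\<close>] \<open>s' < 2\<close> by (auto simp: j out_def)
      qed
      finally show ?thesis using False by (auto simp: j)
    qed
  qed
  have "{p} \<times> (elems - out) \<inter> g ` out = {}" by (auto simp: g_def out_def)
  then have "card {j \<in> I. i \<in> row j} = card (elems - out) + card out"
    unfolding eq using fin_elems fin_out inj by (subst card_Un_disjoint) (auto simp: card_image card_cartesian_product)
  then show ?thesis
    using card_Diff_subset[OF fin_out out_sub] card_mono[OF fin_elems out_sub] card_elems by simp
qed

lemma w_pos: "w > 0"
  using P C by simp

sublocale exact_one I row "5 * w - 1"
proof
  show "finite I" by (simp add: I_def fin_elems)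
  show "i \<in> row i" if "i \<in> I" for i
    using that by (auto simp: row_def in_row_def in_slot_def split: prod.splits)
  show "row i \<subseteq> I" if "i \<in> I" for i by (auto simp: row_def)
  show "card (row i) = Suc (5 * w - 1)" if "i \<in> I" for i
    using card_row[OF that] w_pos by simp
  show "card {j \<in> I. i \<in> row j} = Suc (5 * w - 1)" if "i \<in> I" for i
    using card_col[OF that] w_pos by simp
  show "5 * w - 1 > 0" using w_pos by linarith
qed

text \<open>The selected elements in the row are one for membership at \<open>p\<close> and one for
  non-membership at the partner; their number is 1 iff the two memberships agree.\<close>

lemma slot_row_iff:
  assumes sel: "\<And>p. p < P \<Longrightarrow> ({p} \<times> elems) \<inter> X = {(p, t p, a p)}"
    and "p < P" "b < w" "s < 2" "b div C \<noteq> p"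
  shows "card (row (p, s, b) \<inter> X) = 1 \<longleftrightarrow>
    slot s p (b div C) (b mod C) (t p) (a p) = slot (1 - s) (b div C) p (b mod C) (t (b div C)) (a (b div C))"
proof -
  let ?q = "b div C" and ?c = "b mod C"
  have q: "?q < P" using slot_div[OF assms(3)] by blast
  have ta: "(t p', a p') \<in> elems" if "p' < P" for p' using sel[OF that] by auto
  have 1: "({p} \<times> slots s p ?q ?c) \<inter> X = (if slot s p ?q ?c (t p) (a p) then {(p, t p, a p)} else {})"
  proof -
    have "({p} \<times> slots s p ?q ?c) \<inter> X = ({p} \<times> slots s p ?q ?c) \<inter> {(p, t p, a p)}"
      using sel[OF assms(2)] slots_sub[of s p ?q ?c] by blast
    then show ?thesis using ta[OF assms(2)] by (auto simp: slots_def)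
  qed
  have 2: "({?q} \<times> (elems - slots (1 - s) ?q p ?c)) \<inter> X =
      (if slot (1 - s) ?q p ?c (t ?q) (a ?q) then {} else {(?q, t ?q, a ?q)})"
  proof -
    have "({?q} \<times> (elems - slots (1 - s) ?q p ?c)) \<inter> X = ({?q} \<times> (elems - slots (1 - s) ?q p ?c)) \<inter> {(?q, t ?q, a ?q)}"
      using sel[OF q] by blast
    then show ?thesis using ta[OF q] by (auto simp: slots_def)
  qed
  have "row (p, s, b) \<inter> X = (if slot s p ?q ?c (t p) (a p) then {(p, t p, a p)} else {}) \<union>
      (if slot (1 - s) ?q p ?c (t ?q) (a ?q) then {} else {(?q, t ?q, a ?q)})"
    unfolding row_slot[OF assms(2-5)] Int_Un_distrib2 1 2 ..
  then show ?thesis using assms(5) by auto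
qed

theorem exact_one_iff: "(\<exists>X. \<forall>j\<in>I. card (row j \<inter> X) = 1) \<longleftrightarrow> csp_solvable P C F G"
proof
  assume "csp_solvable P C F G"
  then obtain val where val: "\<And>p. p < P \<Longrightarrow> val p < w"
    and con: "\<And>p q c. p < P \<Longrightarrow> q < P \<Longrightarrow> p \<noteq> q \<Longrightarrow> c < C - 1 \<Longrightarrow> F p q c (val p) = G p q c (val q)"
    unfolding csp_solvable_def by blast
  define X where "X = (\<lambda>p. (p, 2::nat, val p)) ` {..<P}"
  have sel: "({p} \<times> elems) \<inter> X = {(p, 2, val p)}" if "p < P" for p
    using that val[OF that] by (auto simp: X_def elems_def)
  have "card (row j \<inter> X) = 1" if j: "j \<in> I" for j
  proof -
    obtain p s b where j': "j = (p, s, b)" by (cases j)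
    with j have *: "p < P" "b < w" by (auto simp: I_def elems_def)
    show ?thesis
    proof (cases "s < 2 \<and> b div C \<noteq> p")
      case True
      have "b mod C < C" "b div C < P" using slot_div[OF *(2)] by auto
      then have "b mod C = C - 1 \<or> b mod C < C - 1" by linarith
      moreover have "s = 0 \<or> s = 1" using True by linarith
      ultimately show ?thesis
        unfolding j' using True con[of p "b div C" "b mod C"] con[of "b div C" p "b mod C"] * \<open>b div C < P\<close>
        by (subst slot_row_iff[OF sel]) (auto simp: in_slot_def kind_def)
    next
      case False
      then show ?thesis using * sel by (simp add: j' row_cell)
    qed
  qed
  then show "\<exists>X. \<forall>j\<in>I. card (row j \<inter> X) = 1" by blast
next
  assume "\<exists>X. \<forall>j\<in>I. card (row j \<inter> X) = 1"
  then obtain X where X: "\<And>j. j \<in> I \<Longrightarrow> card (row j \<inter> X) = 1" by blast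
  have "\<exists>t a. ({p} \<times> elems) \<inter> X = {(p, t, a)}" if "p < P" for p
  proof -
    \<comment> \<open>Block 2 names no constraint, so this row is the whole cell
      \<open>p\<close>.\<close>
    have "(p, 2, 0) \<in> I" using that w_pos by (simp add: I_def elems_def)
    from X[OF this] have "card (({p} \<times> elems) \<inter> X) = 1" using that by (simp add: row_cell)
    then obtain x where x: "({p} \<times> elems) \<inter> X = {x}" by (auto simp: card_1_singleton_iff)
    then have "x \<in> {p} \<times> elems" by blast
    then have "x = (p, fst (snd x), snd (snd x))" by auto
    with x show ?thesis by metis
  qed
  then obtain t a where sel: "\<And>p. p < P \<Longrightarrow> ({p} \<times> elems) \<inter> X = {(p, t p, a p)}" by metis
  have ta: "t p < 5" "a p < w" if "p < P" for p
  proof -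
    have "(p, t p, a p) \<in> {p} \<times> elems" using sel[OF that] by blast
    then show "t p < 5" "a p < w" by (auto simp: elems_def)
  qed
  have con: "slot 0 p q c (t p) (a p) = slot 1 q p c (t q) (a q)" if "p < P" "q < P" "p \<noteq> q" "c < C" for p q c
  proof -
    note d = div_mod_slot[OF that(2,4)]
    have "(p, 0, q * C + c) \<in> I" using that d by (simp add: I_def elems_def)
    from X[OF this] slot_row_iff[of X t a p "q * C + c" 0, OF sel] show ?thesis
      using that d by simp
  qed
  have two: "t p = 2" if p: "p < P" for p
  proof -
    have ends: "(t p \<in> {0, 4}) = (t q \<in> {1, 3})" if "p < P" "q < P" "p \<noteq> q" for p q
      using con[OF that, of "C - 1"] C by (simp add: in_slot_def kind_def)
    obtain q r where "q < P" "r < P" "p \<noteq> q" "p \<noteq> r" "q \<noteq> r"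
    proof -
      show ?thesis
        using P p that[of 1 2] that[of 0 2] that[of 0 1] by (cases "p = 0"; cases "p = 1") auto
    qed
    note qr = this
    \<comment> \<open>A third cell closes the chain: \<open>t p\<close> lies in both of the sets {0,
      4} and {1, 3} or in neither. They are disjoint, so only block 2 remains. This is where
      \<open>P \<ge> 3\<close> enters.\<close>
    have "(t p \<in> {0, 4}) = (t q \<in> {1, 3})" "(t r \<in> {0, 4}) = (t q \<in> {1, 3})" "(t r \<in> {0, 4}) = (t p \<in> {1, 3})"
      using ends[OF p qr(1,3)] ends[OF qr(2,1) qr(5)[symmetric]] ends[OF qr(2) p qr(4)[symmetric]] by blast+
    then have "t p \<notin> {0, 4}" "t p \<notin> {1, 3}" by auto
    with ta(1)[OF p] show ?thesis by auto
  qed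
  have "F p q c (a p) = G p q c (a q)" if "p < P" "q < P" "p \<noteq> q" "c < C - 1" for p q c
  proof -
    have "c < C" "c \<noteq> C - 1" using that(4) by linarith+
    with con[OF that(1-3) \<open>c < C\<close>] show ?thesis
      using two[OF that(1)] two[OF that(2)] by (simp add: in_slot_def kind_def split: if_splits)
  qed
  with ta(2) show "csp_solvable P C F G" unfolding csp_solvable_def by blast
qed

end

section \<open>Computations as binary constraint systems\<close>

text \<open>In a halting state the scanned symbols are rewritten and the heads stay, so that one
  local rule covers all steps up to a fixed time.\<close>

definition tm_act :: "tm \<Rightarrow> nat \<times> nat list \<Rightarrow> nat \<times> (nat \<times> int) list" where
  "tm_act M qa = (if fst qa \<in> {1, 2} then (fst qa, map (\<lambda>a. (a, 0)) (snd qa)) else tm_trans M (fst qa) (snd qa))"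

definition scanned :: "config \<Rightarrow> nat \<times> nat list" where
  "scanned D = (fst D, map (\<lambda>(f, h). f h) (snd D))"

definition local_views :: "tm \<Rightarrow> (nat \<times> nat list) set" where
  "local_views M = {..<tm_states M} \<times> {as. set as \<subseteq> {..<tm_symbols M} \<and> length as = tm_tapes M}"

definition good_config :: "tm \<Rightarrow> config \<Rightarrow> bool" where
  "good_config M D \<longleftrightarrow> fst D < tm_states M \<and> length (snd D) = tm_tapes M \<and>
     (\<forall>i<tm_tapes M. \<forall>z. fst (snd D ! i) z < tm_symbols M)"

lemma tm_act_wf:
  assumes "wf_tm M" "qa \<in> local_views M"
  shows "fst (tm_act M qa) < tm_states M" "length (snd (tm_act M qa)) = tm_tapes M"
    "i < tm_tapes M \<Longrightarrow> fst (snd (tm_act M qa) ! i) < tm_symbols M"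
    "i < tm_tapes M \<Longrightarrow> snd (snd (tm_act M qa) ! i) \<in> {-1, 0, 1}"
proof -
  obtain q as where qa: "qa = (q, as)" by (cases qa)
  have as: "q < tm_states M" "set as \<subseteq> {..<tm_symbols M}" "length as = tm_tapes M"
    using assms(2) by (auto simp: local_views_def qa)
  have "fst (tm_act M qa) < tm_states M \<and> length (snd (tm_act M qa)) = tm_tapes M \<and>
      set (snd (tm_act M qa)) \<subseteq> {..<tm_symbols M} \<times> {-1, 0, 1}"
  proof (cases "q \<in> {1, 2}")
    case True
    then show ?thesis using as by (auto simp: tm_act_def qa)
  next
    case False
    obtain q' acts where t: "tm_trans M q as = (q', acts)" by (cases "tm_trans M q as")
    with assms(1) as have "q' < tm_states M \<and> length acts = tm_tapes M \<and> set acts \<subseteq> {..<tm_symbols M} \<times> {-1, 0, 1}"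
      unfolding wf_tm_def by blast
    with False t show ?thesis by (simp add: tm_act_def qa)
  qed
  note * = this
  show "fst (tm_act M qa) < tm_states M" "length (snd (tm_act M qa)) = tm_tapes M"
    using * by blast+
  assume "i < tm_tapes M"
  with * have "snd (tm_act M qa) ! i \<in> {..<tm_symbols M} \<times> {-1, 0, 1}" by (metis nth_mem subsetD)
  then show "fst (snd (tm_act M qa) ! i) < tm_symbols M" "snd (snd (tm_act M qa) ! i) \<in> {-1, 0, 1}"
    by (auto simp: mem_Times_iff)
qed

lemma scanned_view: "good_config M D \<Longrightarrow> scanned D \<in> local_views M"
  by (fastforce simp: good_config_def scanned_def local_views_def in_set_conv_nth split: prod.splits)

lemma tm_step_act:
  assumes "wf_tm M" "good_config M D"
  shows "fst (tm_step M D) = fst (tm_act M (scanned D))" "length (snd (tm_step M D)) = tm_tapes M"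
    "i < tm_tapes M \<Longrightarrow> snd (tm_step M D) ! i =
      ((fst (snd D ! i))(snd (snd D ! i) := fst (snd (tm_act M (scanned D)) ! i)),
       snd (snd D ! i) + snd (snd (tm_act M (scanned D)) ! i))"
proof -
  have len: "length (snd D) = tm_tapes M" using assms(2) by (simp add: good_config_def)
  note wf = tm_act_wf(2)[OF assms(1) scanned_view[OF assms(2)]]
  have "tm_step M D = (fst (tm_act M (scanned D)), map2 (\<lambda>(f, h) (a, d). (f(h := a), h + d)) (snd D) (snd (tm_act M (scanned D))))"
  proof (cases "halted D")
    case True
    then have "map2 (\<lambda>(f, h) (a, d). (f(h := a), h + d)) (snd D) (map (\<lambda>a. (a, 0)) (map (\<lambda>(f, h). f h) (snd D))) = snd D"
      by (intro nth_equalityI) (auto split: prod.splits)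
    with True show ?thesis by (auto simp: tm_step_def halted_def tm_act_def scanned_def)
  next
    case False
    then show ?thesis by (auto simp: tm_step_def halted_def tm_act_def scanned_def Let_def split: prod.splits)
  qed
  then show "fst (tm_step M D) = fst (tm_act M (scanned D))" "length (snd (tm_step M D)) = tm_tapes M"
    "i < tm_tapes M \<Longrightarrow> snd (tm_step M D) ! i =
      ((fst (snd D ! i))(snd (snd D ! i) := fst (snd (tm_act M (scanned D)) ! i)),
       snd (snd D ! i) + snd (snd (tm_act M (scanned D)) ! i))"
    using len wf by (simp_all add: split_beta)
qed

lemma good_config_step:
  assumes "wf_tm M" "good_config M D"
  shows "good_config M (tm_step M D)"
proof -
  note wf = tm_act_wf[OF assms(1) scanned_view[OF assms(2)]]
  show ?thesis
    using assms(2) wf(1,3) by (auto simp: good_config_def tm_step_act[OF assms])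
qed

lemma good_config_run: "wf_tm M \<Longrightarrow> good_config M (tm_run M ws t)"
proof (induction t)
  case 0
  then show ?case by (auto simp: good_config_def tm_run_def tm_init_def wf_tm_def tape_content_def)
next
  case (Suc t)
  then show ?case using good_config_step[of M "tm_run M ws t"] by (simp add: tm_run_def)
qed

lemma tm_run_Suc: "tm_run M ws (Suc t) = tm_step M (tm_run M ws t)"
  by (simp add: tm_run_def)

text \<open>This bounds the part of the tapes that the tableau has to represent.\<close>

lemma head_bound:
  assumes "wf_tm M" "i < tm_tapes M"
  shows "\<bar>snd (snd (tm_run M ws t) ! i)\<bar> \<le> int t"
proof (induction t)
  case 0
  show ?case using assms(2) by (simp add: tm_run_def tm_init_def)
next
  case (Suc t)
  note g = good_config_run[OF assms(1), of ws t]
  show ?case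
    using Suc.IH tm_act_wf(4)[OF assms(1) scanned_view[OF g] assms(2)]
    unfolding tm_run_Suc tm_step_act(3)[OF assms(1) g assms(2)] by auto
qed

lemma tm_run_halted_mono:
  assumes "fst (tm_run M ws t) \<in> {1, 2}" "t \<le> t'"
  shows "tm_run M ws t' = tm_run M ws t"
  using assms(2)
proof (induction t' rule: dec_induct)
  case (step n)
  then show ?case using assms(1) by (simp add: tm_run_Suc tm_step_def halted_def)
qed simp

lemma finite_local_views: "finite (local_views M)"
  unfolding local_views_def by (intro finite_cartesian_product finite_lists_length_eq) auto

section \<open>The tableau of a verifier run\<close>

text \<open>
  The cells are numbered by a time \<open>t \<le> T\<close>, a tape \<open>i \<le> K\<close> and \<open>z < W\<close>.  The value of a cell consists of
  the local view (the state and the scanned symbols) at time \<open>t\<close> and a number \<open>m\<close>: for \<open>z = 0\<close>, \<open>m\<close> is the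
  head position on tape \<open>i\<close>, and for \<open>z > 0\<close>, \<open>m\<close> is \<open>2 * a + b\<close> where \<open>a\<close> is the symbol at position \<open>z\<close> and
  \<open>b\<close> tells whether the head is there.  All positions are shifted by \<open>T + 1\<close>.  There is no tape \<open>K\<close>; the
  cell with \<open>t = 0\<close>, \<open>i = K\<close> and \<open>z = 0\<close> contains the length of the certificate.
\<close>

locale tableau =
  fixes M :: tm and \<Gamma> :: nat and en :: "nat \<Rightarrow> nat \<times> nat list" and pl qt :: "nat poly"
  assumes wf: "wf_tm M" and en: "bij_betw en {..<\<Gamma>} (local_views M)"
begin

abbreviation "K \<equiv> tm_tapes M"

text \<open>State and successor state of the view numbered \<open>g\<close>, and below, for each
  tape, the read symbol, the written symbol and the move, shifted by 1 to be a natural number. The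
  default 0 gives these tables the shape that \<open>pc_table\<close> and \<open>pc_table2\<close>
  expect.\<close>

definition tst :: "nat \<Rightarrow> nat" where "tst g = (if g < \<Gamma> then fst (en g) else 0)"
definition tnx :: "nat \<Rightarrow> nat" where "tnx g = (if g < \<Gamma> then fst (tm_act M (en g)) else 0)"
definition trd :: "nat \<Rightarrow> nat \<Rightarrow> nat" where "trd g i = (if g < \<Gamma> \<and> i < K then snd (en g) ! i else 0)"
definition twr :: "nat \<Rightarrow> nat \<Rightarrow> nat" where
  "twr g i = (if g < \<Gamma> \<and> i < K then fst (snd (tm_act M (en g)) ! i) else 0)"
definition tmv :: "nat \<Rightarrow> nat \<Rightarrow> nat" where
  "tmv g i = (if g < \<Gamma> \<and> i < K then nat (1 + snd (snd (tm_act M (en g)) ! i)) else 0)"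

definition pn :: "bool list \<Rightarrow> nat" where "pn x = poly pl (length x)"
definition TT :: "bool list \<Rightarrow> nat" where "TT x = poly qt (length x + pn x)"
text \<open>After the shift by T + 1 the heads stay in 1, ..., 2 T + 1 and a certificate occupies at
  most T + 1, ..., T + \<open>pn x\<close>; number 0 is free for the cell with the head
  position.\<close>

definition WW :: "bool list \<Rightarrow> nat" where "WW x = 2 * TT x + pn x + 3"
definition mu :: "bool list \<Rightarrow> nat" where "mu x = WW x + 2 * tm_symbols M"
definition PP :: "bool list \<Rightarrow> nat" where "PP x = (TT x + 1) * (K + 1) * WW x"
text \<open>Five families of constraints, told apart by \<open>c mod 5\<close>, whose parameter
  \<open>c div 5\<close> has to reach all views, numbers and states; the final 1 is the constraint
  number reserved by the exact-one system.\<close>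

definition CC :: "bool list \<Rightarrow> nat" where "CC x = 5 * (\<Gamma> * mu x + tm_states M + 2) + 1"

definition ct :: "bool list \<Rightarrow> nat \<Rightarrow> nat" where "ct x p = p div WW x div (K + 1)"
definition ci :: "bool list \<Rightarrow> nat \<Rightarrow> nat" where "ci x p = p div WW x mod (K + 1)"
definition cz :: "bool list \<Rightarrow> nat \<Rightarrow> nat" where "cz x p = p mod WW x"

definition vg :: "bool list \<Rightarrow> nat \<Rightarrow> nat" where "vg x v = v div mu x"
definition vm :: "bool list \<Rightarrow> nat \<Rightarrow> nat" where "vm x v = v mod mu x"
definition va :: "bool list \<Rightarrow> nat \<Rightarrow> nat" where "va x v = vm x v div 2"

definition symbol :: "bool list \<Rightarrow> nat \<Rightarrow> nat" where
  "symbol x z = (if z < TT x + 1 then 0 else if has_bit x (z - (TT x + 1)) then 2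
     else if z - (TT x + 1) < length x then 1 else 0)"

text \<open>The conditions on a single cell: agreement of the symbol under the head with the view,
  acceptance at time \<open>TT x\<close>, and the initial configuration. On tape 1 the symbols from
  position \<open>TT x + 1\<close> on are left open up to 2; this is where the certificate is
  guessed.\<close>

definition ok :: "bool list \<Rightarrow> nat \<Rightarrow> nat \<Rightarrow> bool" where
  "ok x p v \<longleftrightarrow> vg x v < \<Gamma> \<and>
     (ci x p < K \<and> 0 < cz x p \<and> odd (vm x v) \<longrightarrow> va x v = trd (vg x v) (ci x p)) \<and>
     (ct x p = TT x \<longrightarrow> tst (vg x v) = 1) \<and>
     (ct x p = 0 \<longrightarrow> tst (vg x v) = 0 \<and>
        (ci x p < K \<longrightarrow> (if cz x p = 0 then vm x v = TT x + 1 else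
            if ci x p = 0 then va x v = symbol x (cz x p)
            else if ci x p = 1 then va x v \<le> 2 \<and> (cz x p < TT x + 1 \<longrightarrow> va x v = 0)
            else va x v = 0)) \<and>
        (ci x p = K \<and> cz x p = 0 \<longrightarrow> vm x v \<le> pn x))"

text \<open>An equation between data of two cells is split into one equivalence for each possible
  value \<open>c div 5\<close>. Conditions on the positions occur in \<open>FF\<close> and
  \<open>GG\<close> alike, so that unrelated cells satisfy False = False. Families 0 to 3 are: a
  common view at each time, the successor state, the next head position or symbol, and the match of
  head position with head marks. In family 4, parameter 0 makes the certificate contiguous, and any
  other parameter states \<open>ok\<close>. The \<open>Suc\<close> offsets the shifted
  moves.\<close>

definition FF :: "bool list \<Rightarrow> nat \<Rightarrow> nat \<Rightarrow> nat \<Rightarrow> nat \<Rightarrow> bool" where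
  "FF x p q c v \<longleftrightarrow>
     (if c mod 5 = 0 then ct x p = ct x q \<and> vg x v = c div 5
      else if c mod 5 = 1 then ct x q = ct x p + 1 \<and> tnx (vg x v) = c div 5
      else if c mod 5 = 2 then ct x q = ct x p + 1 \<and> ci x p = ci x q \<and> ci x p < K \<and> cz x p = cz x q \<and>
        (if cz x p = 0 then vm x v + tmv (vg x v) (ci x p) = Suc (c div 5)
         else (if odd (vm x v) then twr (vg x v) (ci x p) else va x v) = c div 5)
      else if c mod 5 = 3 then ct x p = ct x q \<and> ci x p = ci x q \<and> ci x p < K \<and> cz x p = 0 \<and> 0 < cz x q \<and>
        vm x v = cz x q
      else if c div 5 = 0 then ct x p = 0 \<and> ct x q = 0 \<and> ci x p = K \<and> cz x p = 0 \<and> ci x q = 1 \<and> TT x + 1 \<le> cz x q \<and>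
        cz x q - (TT x + 1) < vm x v
      else ok x p v)"

definition GG :: "bool list \<Rightarrow> nat \<Rightarrow> nat \<Rightarrow> nat \<Rightarrow> nat \<Rightarrow> bool" where
  "GG x p q c v \<longleftrightarrow>
     (if c mod 5 = 0 then ct x p = ct x q \<and> vg x v = c div 5
      else if c mod 5 = 1 then ct x q = ct x p + 1 \<and> tst (vg x v) = c div 5
      else if c mod 5 = 2 then ct x q = ct x p + 1 \<and> ci x p = ci x q \<and> ci x p < K \<and> cz x p = cz x q \<and>
        (if cz x p = 0 then vm x v = c div 5 else va x v = c div 5)
      else if c mod 5 = 3 then ct x p = ct x q \<and> ci x p = ci x q \<and> ci x p < K \<and> cz x p = 0 \<and> 0 < cz x q \<and>
        odd (vm x v)
      else if c div 5 = 0 then ct x p = 0 \<and> ct x q = 0 \<and> ci x p = K \<and> cz x p = 0 \<and> ci x q = 1 \<and> TT x + 1 \<le> cz x q \<and>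
        va x v \<noteq> 0
      else True)"

definition cell :: "bool list \<Rightarrow> nat \<Rightarrow> nat \<Rightarrow> nat \<Rightarrow> nat" where
  "cell x t i z = (t * (K + 1) + i) * WW x + z"

lemma cell:
  assumes "t \<le> TT x" "i \<le> K" "z < WW x"
  shows "cell x t i z < PP x" "ct x (cell x t i z) = t" "ci x (cell x t i z) = i" "cz x (cell x t i z) = z"
proof -
  have 1: "t * (K + 1) + i < (TT x + 1) * (K + 1)" using assms by (intro pair_less) auto
  show "cell x t i z < PP x" unfolding cell_def PP_def by (rule pair_less[OF 1 assms(3)])
  have "cell x t i z div WW x = t * (K + 1) + i" using assms(3) by (simp add: cell_def)
  moreover have "(t * (K + 1) + i) div (K + 1) = t" "(t * (K + 1) + i) mod (K + 1) = i"
    using assms(2) div_mult_self3[of "K + 1" t i] mod_mult_self3[of t "K + 1" i] by (auto simp del: mult_Suc_right)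
  ultimately show "ct x (cell x t i z) = t" "ci x (cell x t i z) = i" unfolding ct_def ci_def by metis+
  show "cz x (cell x t i z) = z" using assms(3) by (simp add: cell_def cz_def)
qed

lemma cell_decode:
  assumes "p < PP x"
  shows "cell x (ct x p) (ci x p) (cz x p) = p" "ct x p \<le> TT x" "ci x p \<le> K" "cz x p < WW x"
proof -
  have W: "0 < WW x" by (simp add: WW_def)
  show "cell x (ct x p) (ci x p) (cz x p) = p"
    unfolding cell_def ct_def ci_def cz_def by (metis div_mult_mod_eq)
  have "p div WW x < (TT x + 1) * (K + 1)"
    using assms unfolding PP_def by (rule less_mult_imp_div_less)
  then have "ct x p < TT x + 1" unfolding ct_def by (rule less_mult_imp_div_less)
  then show "ct x p \<le> TT x" by simp
  show "ci x p \<le> K" unfolding ci_def using mod_less_divisor[of "K + 1" "p div WW x"] by linarith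
  show "cz x p < WW x" unfolding cz_def using W by simp
qed

lemma PP_ge_3: "PP x \<ge> 3"
proof -
  have "1 * 1 * 3 \<le> (TT x + 1) * (K + 1) * WW x"
    by (intro mult_mono) (auto simp: WW_def)
  then show ?thesis by (simp add: PP_def)
qed

lemma K_ge_2: "K \<ge> 2"
  using wf by (simp add: wf_tm_def)

lemma Gamma_pos: "\<Gamma> > 0"
proof -
  have "scanned (tm_run M [] 0) \<in> local_views M" by (rule scanned_view[OF good_config_run[OF wf]])
  then show ?thesis using en by (cases "\<Gamma> = 0") (auto simp: bij_betw_def)
qed

text \<open>The pairs of a view and a number have to fit into the value range prescribed by
  \<open>csp_solvable\<close>.\<close>

lemma values_fit: "\<Gamma> * mu x \<le> PP x * CC x"
proof -
  have "1 * (\<Gamma> * mu x) \<le> PP x * CC x"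
    using PP_ge_3[of x] by (intro mult_mono) (auto simp: CC_def)
  then show ?thesis by simp
qed

end

section \<open>Correctness of the tableau\<close>

context tableau
begin

lemma cell_inject:
  assumes "t \<le> TT x" "i \<le> K" "z < WW x" "t' \<le> TT x" "i' \<le> K" "z' < WW x"
  shows "cell x t i z = cell x t' i' z' \<longleftrightarrow> t = t' \<and> i = i' \<and> z = z'"
  using cell[OF assms(1-3)] cell[OF assms(4-6)] by metis

lemma en_view: "g < \<Gamma> \<Longrightarrow> en g \<in> local_views M"
  using en by (auto simp: bij_betw_def)

lemma tst_less: "g < \<Gamma> \<Longrightarrow> tst g < tm_states M"
  using en_view[of g] by (auto simp: tst_def local_views_def)

lemma mu_pos: "mu x > 0"
  by (simp add: mu_def WW_def)

lemma tape_content_symbol: "symbol x z = tape_content x (int z - (int (TT x) + 1))"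
  by (auto simp: symbol_def tape_content_def has_bit_def nat_diff_distrib' nat_add_distrib of_nat_diff nat_less_iff
      split: if_splits)

text \<open>The certificate is read off the cells at time 0, and induction on the time shows that
  the cells describe the run on it within the window of width \<open>WW x\<close>, which no head
  leaves.\<close>

lemma solvable_imp_accepts:
  assumes "csp_solvable (PP x) (CC x) (FF x) (GG x)"
  shows "\<exists>y. length y \<le> pn x \<and> fst (tm_run M [x, y] (TT x)) = 1"
proof -
  let ?T = "TT x" and ?W = "WW x"
  obtain val where val: "\<And>p q c. p < PP x \<Longrightarrow> q < PP x \<Longrightarrow> p \<noteq> q \<Longrightarrow> c < CC x - 1 \<Longrightarrow>
      FF x p q c (val p) = GG x p q c (val q)"
    using assms unfolding csp_solvable_def by blast
  define v where "v t i z = val (cell x t i z)" for t i z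
  have con: "FF x (cell x t i z) (cell x t' i' z') (f + 5 * c) (v t i z) =
      GG x (cell x t i z) (cell x t' i' z') (f + 5 * c) (v t' i' z')"
    if "t \<le> ?T" "i \<le> K" "z < ?W" "t' \<le> ?T" "i' \<le> K" "z' < ?W" "(t, i, z) \<noteq> (t', i', z')"
      "f < 5" "c < \<Gamma> * mu x + tm_states M + 2" for t i z t' i' z' f c
  proof -
    have "f + 5 * c < CC x - 1" using that by (simp add: CC_def)
    then show ?thesis
      unfolding v_def using that cell(1)[OF that(1-3)] cell(1)[OF that(4-6)] cell_inject[OF that(1-6)]
      by (intro val) auto
  qed
  have W: "2 * ?T + 1 < ?W" by (simp add: WW_def)
  have T0: "0 \<le> ?T" by simp
  have okc: "ok x (cell x t i z) (v t i z)" if "t \<le> ?T" "i \<le> K" "z < ?W" for t i z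
  proof -
    \<comment> \<open>The unary condition is stated as a constraint with a second cell, so some
      other cell has to be named.\<close>
    define z' where "z' = (if z = 0 then 1 else 0 :: nat)"
    have "z' < ?W" "z' \<noteq> z" using W by (auto simp: z'_def)
    then show ?thesis using con[OF that that(1,2), of z' 4 1] by (simp add: FF_def GG_def)
  qed
  define \<gamma> where "\<gamma> t = vg x (v t 0 0)" for t
  have W0: "0 < ?W" using W by linarith
  have g\<Gamma>: "vg x (v t i z) < \<Gamma>" if "t \<le> ?T" "i \<le> K" "z < ?W" for t i z
    using okc[OF that] by (simp add: ok_def)
  have small: "c < \<Gamma> * mu x + tm_states M + 2" if "c < \<Gamma> \<or> c < mu x \<or> c < tm_states M" for c
  proof -
    have "\<Gamma> \<le> \<Gamma> * mu x" "mu x \<le> \<Gamma> * mu x" using mu_pos[of x] Gamma_pos by simp_all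
    with that show ?thesis by linarith
  qed
  have same: "vg x (v t i z) = \<gamma> t" if "t \<le> ?T" "i \<le> K" "z < ?W" for t i z
  proof (cases "(t, i, z) = (t, 0, 0)")
    case False
    show ?thesis
      \<comment> \<open>The parameter is instantiated with the value that actually occurs on one
        side; the equivalence then becomes the desired equation. The next facts use the same
        device.\<close>
      using con[OF that that(1) le0 W0 False, of 0 "vg x (v t i z)"] small g\<Gamma>[OF that]
        cell[OF that] cell[OF that(1) le0 W0]
      by (simp add: FF_def GG_def \<gamma>_def)
  qed (simp add: \<gamma>_def)
  have vm_mu: "vm x u < mu x" for u using mu_pos[of x] by (simp add: vm_def)
  have va_mu: "va x u < mu x" for u using vm_mu[of u] by (simp add: va_def)
  have \<gamma>\<Gamma>: "\<gamma> t < \<Gamma>" if "t \<le> ?T" for t using g\<Gamma>[OF that le0 W0] by (simp add: \<gamma>_def)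
  have div5: "Suc (5 * c) div 5 = c" "Suc (Suc (5 * c)) div 5 = c" "Suc (Suc (5 * c)) mod 5 = 2" for c :: nat
    by presburger+
  have nxt: "tnx (\<gamma> t) = tst (\<gamma> (Suc t))" if "t < ?T" for t
  proof -
    have t: "t \<le> ?T" "Suc t \<le> ?T" using that by auto
    show ?thesis
      using con[OF t(1) le0 W0 t(2) le0 W0, of 1 "tst (\<gamma> (Suc t))"] small tst_less[OF \<gamma>\<Gamma>[OF t(2)]]
        cell[OF t(1) le0 W0] cell[OF t(2) le0 W0]
      by (simp add: FF_def GG_def \<gamma>_def div5)
  qed
  have move: "vm x (v t i 0) + tmv (\<gamma> t) i = Suc (vm x (v (Suc t) i 0))" if "t < ?T" "i < K" for t i
  proof -
    have t: "t \<le> ?T" "Suc t \<le> ?T" "i \<le> K" using that by auto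
    show ?thesis
      using con[OF t(1,3) W0 t(2,3) W0, of 2 "vm x (v (Suc t) i 0)"] small vm_mu[of "v (Suc t) i 0"]
        cell[OF t(1,3) W0] cell[OF t(2,3) W0] that(2) same[OF t(1,3) W0]
      by (simp add: FF_def GG_def div5)
  qed
  have writes: "va x (v (Suc t) i z) = (if odd (vm x (v t i z)) then twr (\<gamma> t) i else va x (v t i z))"
    if "t < ?T" "i < K" "0 < z" "z < ?W" for t i z
  proof -
    have t: "t \<le> ?T" "Suc t \<le> ?T" "i \<le> K" using that by auto
    show ?thesis
      using con[OF t(1,3) that(4) t(2,3) that(4), of 2 "va x (v (Suc t) i z)"] small va_mu[of "v (Suc t) i z"]
        cell[OF t(1,3) that(4)] cell[OF t(2,3) that(4)] that(2,3) same[OF t(1,3) that(4)]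
      by (auto simp: FF_def GG_def div5 split: if_splits)
  qed
  have head: "vm x (v t i 0) = z \<longleftrightarrow> odd (vm x (v t i z))" if "t \<le> ?T" "i < K" "0 < z" "z < ?W" for t i z
  proof -
    have t: "i \<le> K" using that by auto
    show ?thesis
      using con[OF that(1) t W0 that(1) t that(4), of 3 0] small[of 0] Gamma_pos
        cell[OF that(1) t W0] cell[OF that(1) t that(4)] that(2,3)
      by (simp add: FF_def GG_def)
  qed
  define l where "l = vm x (v 0 K 0)"
  have len: "z - (?T + 1) < l \<longleftrightarrow> va x (v 0 1 z) \<noteq> 0" if "?T + 1 \<le> z" "z < ?W" for z
  proof -
    have K1: "1 \<le> K" "1 \<noteq> K" using K_ge_2 by auto
    show ?thesis
      using con[OF T0 order.refl W0 T0 K1(1) that(2), of 4 0] small[of 0] Gamma_pos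
        cell[OF T0 order.refl W0] cell[OF T0 K1(1) that(2)] that(1) K1
      by (simp add: FF_def GG_def l_def)
  qed
  have l: "l \<le> pn x"
    using okc[OF T0 order.refl W0] cell[OF T0 order.refl W0] by (simp add: ok_def l_def)
  \<comment> \<open>By \<open>len\<close>, the nonblank symbols of tape 1 from the origin on are
    exactly the first \<open>l\<close> in the window, and \<open>ok\<close> limits them to 1 and
    2.\<close>
  define y where "y = map (\<lambda>j. va x (v 0 1 (?T + 1 + j)) = 2) [0..<l]"
  have inv: "t \<le> ?T \<longrightarrow> fst (tm_run M [x, y] t) = tst (\<gamma> t) \<and>
      (\<forall>i<K. int (vm x (v t i 0)) = snd (snd (tm_run M [x, y] t) ! i) + (int ?T + 1) \<and>
        (\<forall>z. 0 < z \<and> z < ?W \<longrightarrow> va x (v t i z) = fst (snd (tm_run M [x, y] t) ! i) (int z - (int ?T + 1))))" for t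
  proof (induction t)
    case 0
    have ini: "snd (tm_run M [x, y] 0) ! i = (tape_content (if i < 2 then [x, y] ! i else []), 0)" if "i < K" for i
      using that by (simp add: tm_run_def tm_init_def)
    have ok0: "ok x (cell x 0 i z) (v 0 i z)" "ct x (cell x 0 i z) = 0" "ci x (cell x 0 i z) = i" "cz x (cell x 0 i z) = z"
      if "i < K" "z < ?W" for i z
      using okc[OF T0 _ that(2), of i] cell[OF T0 _ that(2), of i] that(1) by auto
    have sym: "va x (v 0 i z) = tape_content (if i < 2 then [x, y] ! i else []) (int z - (int ?T + 1))"
      if "i < K" "0 < z" "z < ?W" for i z
    proof -
      consider "i = 0" | "i = 1" "z < ?T + 1" | "i = 1" "?T + 1 \<le> z" | "2 \<le> i" by linarith
      then show ?thesis
      proof cases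
        case 1
        then show ?thesis using ok0[OF that(1,3)] that by (simp add: ok_def tape_content_symbol)
      next
        case 2
        then show ?thesis using ok0[OF that(1,3)] that by (simp add: ok_def tape_content_def)
      next
        case 3
        define j where "j = z - (?T + 1)"
        have z: "z = ?T + 1 + j" using 3 by (simp add: j_def)
        have "va x (v 0 1 z) \<le> 2" using ok0[OF that(1,3)] that 3 by (simp add: ok_def)
        moreover have "j < l \<longleftrightarrow> va x (v 0 1 z) \<noteq> 0" using len[OF 3(2) that(3)] by (simp add: j_def)
        ultimately show ?thesis
          using 3 by (auto simp: z tape_content_def y_def)
      next
        case 4
        then show ?thesis using ok0[OF that(1,3)] that by (simp add: ok_def tape_content_def)
      qed
    qed
    have "0 < K" using K_ge_2 by linarith
    have "tst (\<gamma> 0) = 0"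
      using ok0[OF \<open>0 < K\<close> W0] by (simp add: ok_def \<gamma>_def)
    moreover have "vm x (v 0 i 0) = ?T + 1" if "i < K" for i
      using ok0[OF that W0] that by (simp add: ok_def)
    ultimately show ?case using ini sym by (simp add: tm_run_def tm_init_def)
  next
    case (Suc t)
    show ?case
    proof
      assume "Suc t \<le> ?T"
      then have t: "t < ?T" "t \<le> ?T" by auto
      define D where "D = tm_run M [x, y] t"
      have good: "good_config M D" unfolding D_def by (rule good_config_run[OF wf])
      have IH: "fst D = tst (\<gamma> t)" "\<And>i. i < K \<Longrightarrow> int (vm x (v t i 0)) = snd (snd D ! i) + (int ?T + 1)"
        "\<And>i z. i < K \<Longrightarrow> 0 < z \<Longrightarrow> z < ?W \<Longrightarrow> va x (v t i z) = fst (snd D ! i) (int z - (int ?T + 1))"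
        using Suc.IH t unfolding D_def by blast+
      have hd: "\<bar>snd (snd D ! i)\<bar> \<le> int t" if "i < K" for i unfolding D_def by (rule head_bound[OF wf that])
      \<comment> \<open>The head is inside the window and never at number 0, which is not a tape
        position, so the cell under the head exists.\<close>
      have pos: "0 < vm x (v t i 0)" "vm x (v t i 0) < ?W" if "i < K" for i
        using hd[OF that] IH(2)[OF that] W t by linarith+
      have "scanned D = en (\<gamma> t)"
      proof (rule prod_eqI)
        show "fst (scanned D) = fst (en (\<gamma> t))" using IH(1) \<gamma>\<Gamma>[OF t(2)] by (simp add: scanned_def tst_def)
        show "snd (scanned D) = snd (en (\<gamma> t))"
        proof (rule nth_equalityI)
          show "length (snd (scanned D)) = length (snd (en (\<gamma> t)))"
            using good en_view[OF \<gamma>\<Gamma>[OF t(2)]] by (auto simp: good_config_def scanned_def local_views_def)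
          fix i assume "i < length (snd (scanned D))"
          then have i: "i < K" using good by (simp add: good_config_def scanned_def)
          define z where "z = vm x (v t i 0)"
          have z: "0 < z" "z < ?W" using pos[OF i] by (simp_all add: z_def)
          have "odd (vm x (v t i z))" using head[OF t(2) i z] by (simp add: z_def)
          then have "va x (v t i z) = trd (\<gamma> t) i"
            using okc[OF t(2) less_imp_le[OF i] z(2)] cell[OF t(2) less_imp_le[OF i] z(2)] i z
              same[OF t(2) less_imp_le[OF i] z(2)] by (simp add: ok_def)
          moreover have "int z - (int ?T + 1) = snd (snd D ! i)" using IH(2)[OF i] by (simp add: z_def)
          ultimately show "snd (scanned D) ! i = snd (en (\<gamma> t)) ! i"
            using IH(3)[OF i z] i good \<gamma>\<Gamma>[OF t(2)]
            by (simp add: scanned_def trd_def good_config_def split_beta)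
        qed
      qed
      note act = tm_step_act[OF wf good, unfolded this]
      have run: "tm_run M [x, y] (Suc t) = tm_step M D" by (simp add: tm_run_Suc D_def)
      have "fst (tm_step M D) = tst (\<gamma> (Suc t))"
        using nxt[OF t(1)] \<gamma>\<Gamma>[OF t(2)] by (simp add: act(1) tnx_def)
      moreover have "int (vm x (v (Suc t) i 0)) = snd (snd (tm_step M D) ! i) + (int ?T + 1)" if "i < K" for i
      proof -
        have "snd (snd (tm_act M (en (\<gamma> t))) ! i) \<in> {-1, 0, 1}"
          by (rule tm_act_wf(4)[OF wf en_view[OF \<gamma>\<Gamma>[OF t(2)]] that])
        then have "int (tmv (\<gamma> t) i) = 1 + snd (snd (tm_act M (en (\<gamma> t))) ! i)"
          using \<gamma>\<Gamma>[OF t(2)] that by (auto simp: tmv_def)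
        then show ?thesis using move[OF t(1) that] IH(2)[OF that] unfolding act(3)[OF that] by simp
      qed
      moreover have "va x (v (Suc t) i z) = fst (snd (tm_step M D) ! i) (int z - (int ?T + 1))"
        if "i < K" "0 < z" "z < ?W" for i z
      proof -
        have "odd (vm x (v t i z)) \<longleftrightarrow> int z - (int ?T + 1) = snd (snd D ! i)"
          using head[OF t(2) that] IH(2)[OF that(1)] by auto
        then show ?thesis
          using writes[OF t(1) that] IH(3)[OF that] \<gamma>\<Gamma>[OF t(2)] that(1)
          unfolding act(3)[OF that(1)] by (simp add: twr_def)
      qed
      ultimately show "fst (tm_run M [x, y] (Suc t)) = tst (\<gamma> (Suc t)) \<and>
        (\<forall>i<K. int (vm x (v (Suc t) i 0)) = snd (snd (tm_run M [x, y] (Suc t)) ! i) + (int ?T + 1) \<and>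
          (\<forall>z. 0 < z \<and> z < ?W \<longrightarrow> va x (v (Suc t) i z) = fst (snd (tm_run M [x, y] (Suc t)) ! i) (int z - (int ?T + 1))))"
        unfolding run by blast
    qed
  qed
  have "tst (\<gamma> ?T) = 1"
    using okc[OF order.refl le0 W0] cell[OF order.refl le0 W0] by (simp add: ok_def \<gamma>_def)
  then have "fst (tm_run M [x, y] ?T) = 1" using inv[of ?T] by simp
  moreover have "length y \<le> pn x" using l by (simp add: y_def)
  ultimately show ?thesis by blast
qed

lemma accepts_imp_solvable:
  assumes "length y \<le> pn x" "fst (tm_run M [x, y] (TT x)) = 1"
  shows "csp_solvable (PP x) (CC x) (FF x) (GG x)"
proof -
  let ?T = "TT x" and ?W = "WW x"
  define D where "D = tm_run M [x, y]"
  have good: "good_config M (D t)" for t unfolding D_def by (rule good_config_run[OF wf])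
  have hd: "\<bar>snd (snd (D t) ! i)\<bar> \<le> int t" if "i < K" for i t unfolding D_def by (rule head_bound[OF wf that])
  have "\<exists>g<\<Gamma>. en g = scanned (D t)" for t
    using en scanned_view[OF good[of t]] unfolding bij_betw_def by (metis imageE lessThan_iff)
  then obtain \<gamma> where \<gamma>: "\<And>t. \<gamma> t < \<Gamma>" "\<And>t. en (\<gamma> t) = scanned (D t)" by metis
  define head where "head t i = nat (snd (snd (D t) ! i) + (int ?T + 1))" for t i
  define sy where "sy t i z = fst (snd (D t) ! i) (int z - (int ?T + 1))" for t i z
  define m where "m t i z = (if i < K then (if z = 0 then head t i else 2 * sy t i z + of_bool (head t i = z))
    else if t = 0 \<and> z = 0 then length y else 0)" for t i z
  define val where "val p = \<gamma> (ct x p) * mu x + m (ct x p) (ci x p) (cz x p)" for p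
  have headz: "int (head t i) = snd (snd (D t) ! i) + (int ?T + 1)" if "t \<le> ?T" "i < K" for t i
    using hd[OF that(2), of t] that(1) by (simp add: head_def)
  have sy_less: "sy t i z < tm_symbols M" if "i < K" for t i z
    using good[of t] that by (simp add: sy_def good_config_def)
  have m_mu: "m t i z < mu x" if "t \<le> ?T" for t i z
  proof (cases "i < K")
    case True
    have "head t i < ?W" using headz[OF that True] hd[OF True, of t] that by (simp add: WW_def)
    then show ?thesis using sy_less[OF True, of t z] True by (auto simp: m_def mu_def)
  next
    case False
    then show ?thesis using assms(1) by (auto simp: m_def mu_def WW_def)
  qed
  have vg: "vg x (val p) = \<gamma> (ct x p)" and vm: "vm x (val p) = m (ct x p) (ci x p) (cz x p)" if "p < PP x" for p
    using m_mu[OF cell_decode(2)[OF that], of "ci x p" "cz x p"] by (simp_all add: vg_def vm_def val_def)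
  have va: "va x (val p) = sy (ct x p) (ci x p) (cz x p)" and odd: "odd (vm x (val p)) \<longleftrightarrow> head (ct x p) (ci x p) = cz x p"
    if "p < PP x" "ci x p < K" "0 < cz x p" for p
    using that by (auto simp: va_def vm m_def)
  have vm0: "vm x (val p) = head (ct x p) (ci x p)" if "p < PP x" "ci x p < K" "cz x p = 0" for p
    using that by (simp add: vm m_def)
  have st: "tst (\<gamma> t) = fst (D t)" for t
    using \<gamma> by (simp add: tst_def scanned_def)
  have step: "D (Suc t) = tm_step M (D t)" for t by (simp add: D_def tm_run_Suc)
  note act = tm_step_act[OF wf good]
  have nxt: "tnx (\<gamma> t) = tst (\<gamma> (Suc t))" for t
    using \<gamma> by (simp add: tnx_def st step act(1))
  have move: "head t i + tmv (\<gamma> t) i = Suc (head (Suc t) i)" if "Suc t \<le> ?T" "i < K" for t i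
  proof -
    have "snd (snd (tm_act M (scanned (D t))) ! i) \<in> {-1, 0, 1}"
      by (rule tm_act_wf(4)[OF wf scanned_view[OF good] that(2)])
    then have "int (tmv (\<gamma> t) i) = 1 + snd (snd (tm_act M (scanned (D t))) ! i)"
      using \<gamma> that(2) by (auto simp: tmv_def)
    moreover have "snd (snd (D (Suc t)) ! i) = snd (snd (D t) ! i) + snd (snd (tm_act M (scanned (D t))) ! i)"
      using that(2) by (simp add: step act(3))
    ultimately have "int (head t i + tmv (\<gamma> t) i) = int (Suc (head (Suc t) i))"
      using headz[of t i] headz[of "Suc t" i] that by simp
    then show ?thesis by simp
  qed
  have writes: "sy (Suc t) i z = (if head t i = z then twr (\<gamma> t) i else sy t i z)" if "Suc t \<le> ?T" "i < K" for t i z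
  proof -
    have "head t i = z \<longleftrightarrow> int z - (int ?T + 1) = snd (snd (D t) ! i)"
      using headz[of t i] that by auto
    then show ?thesis using that(2) \<gamma> by (simp add: sy_def step act(3) twr_def)
  qed
  have read: "sy t i z = trd (\<gamma> t) i" if "t \<le> ?T" "i < K" "head t i = z" for t i z
  proof -
    have "int z - (int ?T + 1) = snd (snd (D t) ! i)" using headz[OF that(1,2)] that(3) by simp
    then show ?thesis using that(2) good[of t] \<gamma> by (simp add: sy_def trd_def scanned_def good_config_def split_beta)
  qed
  have ini: "snd (D 0) ! i = (tape_content (if i < 2 then [x, y] ! i else []), 0)" if "i < K" for i
    using that by (simp add: D_def tm_run_def tm_init_def)
  have okv: "ok x p (val p)" if p: "p < PP x" for p
    unfolding ok_def
  proof (intro conjI impI)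
    show "vg x (val p) < \<Gamma>" using \<gamma>(1) by (simp add: vg[OF p])
    note d = cell_decode[OF p]
    { assume *: "ci x p < K \<and> 0 < cz x p \<and> odd (vm x (val p))"
      then have "head (ct x p) (ci x p) = cz x p" using odd[OF p] by blast
      with * show "va x (val p) = trd (vg x (val p)) (ci x p)"
        using read[OF d(2)] by (simp add: va[OF p] vg[OF p]) }
    { assume "ct x p = ?T"
      then show "tst (vg x (val p)) = 1" using assms(2) by (simp add: vg[OF p] st D_def) }
    assume t0: "ct x p = 0"
    show "tst (vg x (val p)) = 0" using t0 by (simp add: vg[OF p] st D_def tm_run_def tm_init_def)
    { assume i: "ci x p < K"
      have h0: "head 0 (ci x p) = ?T + 1" using ini[OF i] by (simp add: head_def nat_add_distrib)
      have s0: "sy 0 (ci x p) z = tape_content (if ci x p < 2 then [x, y] ! ci x p else []) (int z - (int ?T + 1))" for z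
        using ini[OF i] by (simp add: sy_def)
      show "if cz x p = 0 then vm x (val p) = ?T + 1
          else if ci x p = 0 then va x (val p) = symbol x (cz x p)
          else if ci x p = 1 then va x (val p) \<le> 2 \<and> (cz x p < ?T + 1 \<longrightarrow> va x (val p) = 0)
          else va x (val p) = 0"
      proof (cases "cz x p = 0")
        case True
        then show ?thesis using vm0[OF p i] h0 t0 by simp
      next
        case False
        then have "va x (val p) = tape_content (if ci x p < 2 then [x, y] ! ci x p else []) (int (cz x p) - (int ?T + 1))"
          using va[OF p i] s0 t0 by simp
        then show ?thesis using False tape_content_symbol[of x "cz x p"]
          by (auto simp: tape_content_def)
      qed }
    assume "ci x p = K \<and> cz x p = 0"
    then show "vm x (val p) \<le> pn x" using assms(1) t0 by (simp add: vm[OF p] m_def)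
  qed
  have "FF x p q c (val p) = GG x p q c (val q)" if p: "p < PP x" and q: "q < PP x" for p q c
  proof -
    note dp = cell_decode[OF p] and dq = cell_decode[OF q]
    consider "c mod 5 = 0" | "c mod 5 = 1" | "c mod 5 = 2" | "c mod 5 = 3" | "c mod 5 = 4"
      using mod_less_divisor[of 5 c] by linarith
    then show ?thesis
    proof cases
      case 1
      then show ?thesis by (auto simp: FF_def GG_def vg p q)
    next
      case 2
      then show ?thesis using nxt by (auto simp: FF_def GG_def vg p q)
    next
      case 3
      show ?thesis
      proof (cases "ct x q = ct x p + 1 \<and> ci x p = ci x q \<and> ci x p < K \<and> cz x p = cz x q")
        case True
        then have le: "Suc (ct x p) \<le> ?T" using dq(2) by simp
        show ?thesis
        proof (cases "cz x p = 0")
          case z: True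
          have "vm x (val p) + tmv (vg x (val p)) (ci x p) = Suc (vm x (val q))"
            using move[OF le] True z by (simp add: vm0[OF p] vm0[OF q] vg[OF p])
          then show ?thesis using 3 True z by (simp add: FF_def GG_def)
        next
          case z: False
          have "va x (val q) = (if odd (vm x (val p)) then twr (vg x (val p)) (ci x p) else va x (val p))"
            using writes[OF le] True z by (simp add: va[OF p] va[OF q] odd[OF p] vg[OF p])
          then show ?thesis using 3 True z by (simp add: FF_def GG_def)
        qed
      next
        case False
        then show ?thesis using 3 by (auto simp: FF_def GG_def)
      qed
    next
      case 4
      show ?thesis
        using 4 odd[OF q] by (auto simp: FF_def GG_def vm0[OF p])
    next
      case 5
      show ?thesis
      proof (cases "c div 5 = 0")
        case True
        show ?thesis
        proof (cases "ct x p = 0 \<and> ct x q = 0 \<and> ci x p = K \<and> cz x p = 0 \<and> ci x q = 1 \<and> ?T + 1 \<le> cz x q")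
          case c: True
          have "1 < K" using K_ge_2 by linarith
          have "vm x (val p) = length y" using c by (simp add: vm[OF p] m_def)
          moreover have "va x (val q) = tape_content y (int (cz x q) - (int ?T + 1))"
            using va[OF q] c ini[OF \<open>1 < K\<close>] \<open>1 < K\<close> by (simp add: sy_def)
          moreover have "tape_content y (int (cz x q) - (int ?T + 1)) \<noteq> 0 \<longleftrightarrow> cz x q - (?T + 1) < length y"
            using c by (auto simp: tape_content_def)
          ultimately show ?thesis using 5 True c by (simp add: FF_def GG_def)
        next
          case False
          then show ?thesis using 5 True by (auto simp: FF_def GG_def)
        qed
      next
        case False
        then show ?thesis using 5 okv[OF p] by (simp add: FF_def GG_def)
      qed
    qed
  qed
  moreover have "val p < PP x * CC x" if p: "p < PP x" for p
  proof -
    have "val p < \<Gamma> * mu x"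
      unfolding val_def by (rule pair_less[OF \<gamma>(1) m_mu[OF cell_decode(2)[OF p]]])
    with values_fit[of x] show ?thesis by linarith
  qed
  ultimately show ?thesis unfolding csp_solvable_def by blast
qed

end

section \<open>Computing the reduction\<close>

lemma pc_table2:
  assumes "pc a" "pc b"
  shows "pc (\<lambda>x y s. if a x y s < m \<and> b x y s < n then f (a x y s) (b x y s) else 0)"
proof -
  have "pc (\<lambda>x y s. if a x y s < m \<and> b x y s < n then
      (if a x y s * n + b x y s < m * n then f ((a x y s * n + b x y s) div n) ((a x y s * n + b x y s) mod n) else 0) else 0)"
    by (intro pc_if pcp_conj pcp_less pc_const assms
        pc_table[where f = "\<lambda>i. f (i div n) (i mod n)"] pc_add pc_mult)
  moreover have "(if u < m \<and> v < n then (if u * n + v < m * n then f ((u * n + v) div n) ((u * n + v) mod n) else 0) else 0) =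
      (if u < m \<and> v < n then f u v else 0)" for u v
    using pair_less[of u m v n] by simp
  ultimately show ?thesis by simp
qed

lemma poly_nat_mono: "a \<le> b \<Longrightarrow> poly p a \<le> poly p b" for p :: "nat poly"
  by (induction p) (auto intro!: add_mono mult_mono)

context tableau
begin

lemma pc_tst: "pc g \<Longrightarrow> pc (\<lambda>x y s. tst (g x y s))"
  unfolding tst_def by (rule pc_table)

lemma pc_tnx: "pc g \<Longrightarrow> pc (\<lambda>x y s. tnx (g x y s))"
  unfolding tnx_def by (rule pc_table)

lemma pc_trd: "pc g \<Longrightarrow> pc i \<Longrightarrow> pc (\<lambda>x y s. trd (g x y s) (i x y s))"
  unfolding trd_def by (rule pc_table2)

lemma pc_twr: "pc g \<Longrightarrow> pc i \<Longrightarrow> pc (\<lambda>x y s. twr (g x y s) (i x y s))"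
  unfolding twr_def by (rule pc_table2)

lemma pc_tmv: "pc g \<Longrightarrow> pc i \<Longrightarrow> pc (\<lambda>x y s. tmv (g x y s) (i x y s))"
  unfolding tmv_def by (rule pc_table2)

lemma pc_params: "pc (\<lambda>x y s. pn x)" "pc (\<lambda>x y s. TT x)" "pc (\<lambda>x y s. WW x)" "pc (\<lambda>x y s. mu x)"
  "pc (\<lambda>x y s. PP x)" "pc (\<lambda>x y s. CC x)"
proof -
  show 1: "pc (\<lambda>x y s. pn x)" unfolding pn_def by (intro pc_poly pc_input_length)
  then show 2: "pc (\<lambda>x y s. TT x)" unfolding TT_def by (intro pc_poly pc_add pc_input_length)
  with 1 show 3: "pc (\<lambda>x y s. WW x)" unfolding WW_def by (intro pc_add pc_mult pc_const)
  then show 4: "pc (\<lambda>x y s. mu x)" unfolding mu_def by (intro pc_add pc_const)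
  show "pc (\<lambda>x y s. PP x)" unfolding PP_def by (intro 2 3 pc_add pc_mult pc_const)
  show "pc (\<lambda>x y s. CC x)" unfolding CC_def by (intro 4 pc_add pc_mult pc_const)
qed

lemma pc_cells:
  assumes "pc p"
  shows "pc (\<lambda>x y s. ct x (p x y s))" "pc (\<lambda>x y s. ci x (p x y s))" "pc (\<lambda>x y s. cz x (p x y s))"
    "pc (\<lambda>x y s. vg x (p x y s))" "pc (\<lambda>x y s. vm x (p x y s))" "pc (\<lambda>x y s. va x (p x y s))"
  unfolding ct_def ci_def cz_def vg_def vm_def va_def
  by (intro pc_div pc_mod pc_params pc_const assms)+

lemma pc_symbol_at: "pc z \<Longrightarrow> pc (\<lambda>x y s. symbol x (z x y s))"
  unfolding symbol_def
  by (intro pc_if pcp_less pcp_input pc_diff pc_add pc_params pc_const pc_input_length)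

lemma pcp_ok: "pc p \<Longrightarrow> pc v \<Longrightarrow> pcp (\<lambda>x y s. ok x (p x y s) (v x y s))"
  unfolding ok_def
  by (intro pcp_conj pcp_imp pcp_if pcp_less pcp_le pcp_eq pcp_odd pc_add pc_cells pc_trd pc_tst pc_symbol_at
      pc_params pc_const)

lemma pcp_FF: "pc p \<Longrightarrow> pc q \<Longrightarrow> pc c \<Longrightarrow> pc v \<Longrightarrow> pcp (\<lambda>x y s. FF x (p x y s) (q x y s) (c x y s) (v x y s))"
  unfolding FF_def
  by (intro pcp_if pcp_conj pcp_less pcp_le pcp_eq pcp_odd pc_if pc_Suc pc_cells pc_tnx pc_twr pc_tmv pcp_ok
      pc_params pc_const pc_div pc_mod pc_add pc_diff)

lemma pcp_GG: "pc p \<Longrightarrow> pc q \<Longrightarrow> pc c \<Longrightarrow> pc v \<Longrightarrow> pcp (\<lambda>x y s. GG x (p x y s) (q x y s) (c x y s) (v x y s))"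
  unfolding GG_def
  by (intro pcp_if pcp_conj pcp_less pcp_le pcp_eq pcp_odd pcp_not pcp_const pc_cells pc_tst
      pc_params pc_const pc_div pc_mod pc_add)

lemma pc_kind:
  assumes "pc r" "pc p" "pc q" "pc c" "pc a"
  shows "pc (\<lambda>x y s. kind (CC x) (FF x) (GG x) (r x y s) (p x y s) (q x y s) (c x y s) (a x y s))"
  unfolding kind_def by (intro pc_if pcp_if pcp_eq pc_diff pc_params pc_const pcp_FF pcp_GG assms)

lemma pcp_in_slot:
  assumes "pc r" "pc p" "pc q" "pc c" "pc t" "pc a"
  shows "pcp (\<lambda>x y s. in_slot (CC x) (FF x) (GG x) (r x y s) (p x y s) (q x y s) (c x y s) (t x y s) (a x y s))"
  unfolding in_slot_def by (intro pcp_disj pcp_eq pc_kind assms)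

lemma pcp_in_row:
  assumes "pc p" "pc t" "pc a" "pc p'" "pc t'" "pc a'"
  shows "pcp (\<lambda>x y s. in_row (CC x) (FF x) (GG x) (p x y s) (t x y s) (a x y s) (p' x y s) (t' x y s) (a' x y s))"
  unfolding in_row_def
  by (intro pcp_if pcp_conj pcp_disj pcp_not pcp_less pcp_eq pcp_in_slot pc_div pc_mod pc_diff pc_params pc_const assms)

section \<open>The output graph on natural numbers\<close>

definition wd :: "bool list \<Rightarrow> nat" where "wd x = PP x * CC x"
definition md :: "bool list \<Rightarrow> nat" where "md x = 5 * wd x - 1"
definition nv :: "bool list \<Rightarrow> nat" where "nv x = 3 * 2 * md x * PP x * 5 * wd x"

text \<open>A vertex number consists of the role, the copy \<open>(b, \<kappa>)\<close>, the cell, the block and the element.\<close>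

definition ur :: "bool list \<Rightarrow> nat \<Rightarrow> nat" where "ur x u = u div wd x div 5 div PP x div md x div 2"
definition ub :: "bool list \<Rightarrow> nat \<Rightarrow> nat" where "ub x u = u div wd x div 5 div PP x div md x mod 2"
definition uk :: "bool list \<Rightarrow> nat \<Rightarrow> nat" where "uk x u = u div wd x div 5 div PP x mod md x"
definition up :: "bool list \<Rightarrow> nat \<Rightarrow> nat" where "up x u = u div wd x div 5 mod PP x"
definition ut :: "bool list \<Rightarrow> nat \<Rightarrow> nat" where "ut x u = u div wd x mod 5"
definition ua :: "bool list \<Rightarrow> nat \<Rightarrow> nat" where "ua x u = u mod wd x"

text \<open>\<open>gadget_adj\<close> in arithmetic form: roles 0 and 1 are the ends
  \<open>Some False\<close> and \<open>Some True\<close>, role 2 is a row.\<close>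

definition nadj :: "bool list \<Rightarrow> nat \<Rightarrow> nat \<Rightarrow> bool" where
  "nadj x u v \<longleftrightarrow>
    (ur x u < 2 \<and> ur x v < 2 \<and> up x u = up x v \<and> ut x u = ut x v \<and> ua x u = ua x v \<and>
      (if ub x u = ub x v then uk x u = uk x v \<and> ur x u \<noteq> ur x v else ur x u = ur x v)) \<or>
    (ub x u = ub x v \<and> uk x u = uk x v \<and>
      (ur x u < 2 \<and> ur x v = 2 \<and> in_row (CC x) (FF x) (GG x) (up x v) (ut x v) (ua x v) (up x u) (ut x u) (ua x u) \<or>
       ur x v < 2 \<and> ur x u = 2 \<and> in_row (CC x) (FF x) (GG x) (up x u) (ut x u) (ua x u) (up x v) (ut x v) (ua x v)))"

lemma pc_sizes: "pc (\<lambda>x y s. wd x)" "pc (\<lambda>x y s. md x)" "pc (\<lambda>x y s. nv x)"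
proof -
  show 1: "pc (\<lambda>x y s. wd x)" unfolding wd_def by (intro pc_mult pc_params)
  then show 2: "pc (\<lambda>x y s. md x)" unfolding md_def by (intro pc_mult pc_diff pc_const)
  show "pc (\<lambda>x y s. nv x)" unfolding nv_def by (intro 1 2 pc_mult pc_params pc_const)
qed

lemma pc_parts:
  assumes "pc u"
  shows "pc (\<lambda>x y s. ur x (u x y s))" "pc (\<lambda>x y s. ub x (u x y s))" "pc (\<lambda>x y s. uk x (u x y s))"
    "pc (\<lambda>x y s. up x (u x y s))" "pc (\<lambda>x y s. ut x (u x y s))" "pc (\<lambda>x y s. ua x (u x y s))"
  unfolding ur_def ub_def uk_def up_def ut_def ua_def
  by (intro pc_div pc_mod pc_sizes pc_params pc_const assms)+

lemma pcp_nadj: "pc u \<Longrightarrow> pc v \<Longrightarrow> pcp (\<lambda>x y s. nadj x (u x y s) (v x y s))"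
  unfolding nadj_def
  by (intro pcp_conj pcp_disj pcp_not pcp_if pcp_less pcp_eq pcp_in_row pc_parts pc_const)

definition out_len :: "bool list \<Rightarrow> nat" where
  "out_len x = inst_len (nv x) 2 (2 * md x) 1 (md x)"

definition out_bit :: "bool list \<Rightarrow> nat \<Rightarrow> bool" where
  "out_bit x i \<longleftrightarrow> inst_bit (nadj x) (nv x) 2 (2 * md x) 1 (md x) i"

definition reduce :: "bool list \<Rightarrow> bool list" where
  "reduce x = map (out_bit x) [0..<out_len x]"

lemma polytime_reduce: "polytime_computable reduce"
  unfolding reduce_def
proof (rule polytime_computable_pc)
  show "pc (\<lambda>x y s. out_len x)"
    unfolding out_len_def inst_len_def by (intro pc_elen pc_sizes pc_add pc_mult pc_const)
  show "pc (\<lambda>x y s. of_bool (out_bit x (arg 0 s)))"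
    unfolding out_bit_def inst_bit_def app_bit_def
    by (intro pc_of_bool pcp_ebit pcp_nadj pc_elen pc_sizes pcp_disj pcp_conj pcp_le pcp_less pc_diff pc_div pc_mod
        pc_mult pc_const pc_vars)
qed auto

context
  fixes x :: "bool list"
begin

interpretation csp "PP x" "CC x" "FF x" "GG x"
  by unfold_locales (use PP_ge_3 in \<open>auto simp: CC_def\<close>)

definition vdec :: "nat \<Rightarrow> (nat \<times> nat \<times> nat) vertex" where
  "vdec u = (if ur x u = 2 then None else Some (ur x u = 1), ub x u = 1, uk x u, (up x u, ut x u, ua x u))"

definition venc :: "(nat \<times> nat \<times> nat) vertex \<Rightarrow> nat" where
  "venc = (\<lambda>(e, b, \<kappa>, (p, t, a)).
     (((((case e of None \<Rightarrow> 2 | Some e \<Rightarrow> of_bool e) * 2 + of_bool b) * md x + \<kappa>) * PP x + p) * 5 + t) * wd x + a)"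

lemma parts_bounds:
  assumes "u < nv x"
  shows "ur x u < 3" "ub x u < 2" "uk x u < md x" "up x u < PP x" "ut x u < 5" "ua x u < wd x"
proof -
  have pos: "0 < wd x" "0 < PP x" "0 < md x"
    using w_pos m P by (auto simp: wd_def md_def)
  have "u div wd x < 3 * 2 * md x * PP x * 5" using assms unfolding nv_def by (rule less_mult_imp_div_less)
  then have "u div wd x div 5 < 3 * 2 * md x * PP x" by (rule less_mult_imp_div_less)
  then have "u div wd x div 5 div PP x < 3 * 2 * md x" by (rule less_mult_imp_div_less)
  then have "u div wd x div 5 div PP x div md x < 3 * 2" by (rule less_mult_imp_div_less)
  then show "ur x u < 3" unfolding ur_def by (rule less_mult_imp_div_less)
  show "ub x u < 2" "uk x u < md x" "up x u < PP x" "ut x u < 5" "ua x u < wd x"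
    using pos by (simp_all add: ub_def uk_def up_def ut_def ua_def)
qed

lemma vdec_in:
  assumes "u < nv x"
  shows "vdec u \<in> gadget_vertices I (md x)"
  using parts_bounds[OF assms] by (simp add: vdec_def gadget_vertices_def I_def elems_def wd_def)

lemma venc_vdec: "u < nv x \<Longrightarrow> venc (vdec u) = u"
proof -
  assume u: "u < nv x"
  have r: "(case (if ur x u = 2 then None else Some (ur x u = 1)) of None \<Rightarrow> 2 | Some e \<Rightarrow> of_bool e) = ur x u"
    using parts_bounds(1)[OF u] by auto
  have b: "of_bool (ub x u = 1) = ub x u" using parts_bounds(2)[OF u] by auto
  have "venc (vdec u) = ((((ur x u * 2 + ub x u) * md x + uk x u) * PP x + up x u) * 5 + ut x u) * wd x + ua x u"
    unfolding venc_def vdec_def prod.case r b ..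
  also have "\<dots> = u"
    unfolding ur_def ub_def uk_def up_def ut_def ua_def by (simp only: div_mult_mod_eq)
  finally show ?thesis .
qed

lemma venc_parts:
  assumes "a < wd x" "t < 5" "p < PP x" "\<kappa> < md x" "b < 2" "r < 3"
    and u: "u = ((((r * 2 + b) * md x + \<kappa>) * PP x + p) * 5 + t) * wd x + a"
  shows "u < nv x" "ur x u = r" "ub x u = b" "uk x u = \<kappa>" "up x u = p" "ut x u = t" "ua x u = a"
proof -
  have dm: "(k * n + l) div n = k" "(k * n + l) mod n = l" if "l < n" for k l n :: nat
    using that by auto
  show "u < nv x" unfolding u nv_def by (intro pair_less assms)
  show "ur x u = r" "ub x u = b" "uk x u = \<kappa>" "up x u = p" "ut x u = t" "ua x u = a"
    unfolding u ur_def ub_def uk_def up_def ut_def ua_def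
    by (simp_all only: dm[OF assms(1)] dm[OF assms(2)] dm[OF assms(3)] dm[OF assms(4)] dm[OF assms(5)])
qed

lemma vdec_venc:
  assumes "v \<in> gadget_vertices I (md x)"
  shows "venc v < nv x" "vdec (venc v) = v"
proof -
  obtain e b \<kappa> p t a where v: "v = (e, b, \<kappa>, (p, t, a))" by (cases v) auto
  then have *: "\<kappa> < md x" "p < PP x" "t < 5" "a < wd x"
    using assms by (auto simp: gadget_vertices_def I_def elems_def wd_def)
  define r :: nat where "r = (case e of None \<Rightarrow> 2 | Some e \<Rightarrow> of_bool e)"
  have "r < 3" "of_bool b < (2::nat)" by (auto simp: r_def split: option.split)
  note parts = venc_parts[OF *(4,3,2,1) this(2,1) refl, folded]
  have eq: "venc v = ((((r * 2 + of_bool b) * md x + \<kappa>) * PP x + p) * 5 + t) * wd x + a"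
    by (simp add: venc_def v r_def)
  show "venc v < nv x" unfolding eq by (rule parts(1))
  show "vdec (venc v) = v"
    unfolding eq vdec_def parts unfolding v by (auto simp: r_def split: option.split)
qed

lemma nadj_vdec:
  assumes "u < nv x" "v < nv x"
  shows "nadj x u v \<longleftrightarrow> gadget_adj row (vdec u) (vdec v)"
proof -
  note bu = parts_bounds[OF assms(1)] and bv = parts_bounds[OF assms(2)]
  have I: "(up x u, ut x u, ua x u) \<in> I" "(up x v, ut x v, ua x v) \<in> I"
    using bu bv by (simp_all add: I_def elems_def wd_def)
  have b: "(ub x u = 1) = (ub x v = 1) \<longleftrightarrow> ub x u = ub x v" using bu(2) bv(2) by linarith
  have r3: "ur x u = 0 \<or> ur x u = 1 \<or> ur x u = 2" "ur x v = 0 \<or> ur x v = 1 \<or> ur x v = 2"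
    using bu(1) bv(1) by linarith+
  from r3 show ?thesis
    by (elim disjE) (simp_all add: nadj_def vdec_def b[unfolded One_nat_def] row_def I)
qed

lemma reduce_eq: "reduce x = encode_instance (nv x) (adj_graph (nv x) (nadj x)) [2, 2 * md x] [1, md x]"
  and nadj_loopless: "loopless_sym (nv x) (nadj x)"
proof -
  show ls: "loopless_sym (nv x) (nadj x)"
    unfolding loopless_sym_def using nadj_vdec gadget_adj_sym gadget_adj_irrefl by blast
  have "inst_bit (nadj x) (nv x) a b c d i = inst_bit (\<lambda>u v. {u, v} \<in> adj_graph (nv x) (nadj x)) (nv x) a b c d i" for a b c d i
    by (rule inst_bit_cong) (simp add: adj_graph_iff[OF ls])
  moreover have "has_bit (reduce x) i \<longleftrightarrow> i < out_len x \<and> out_bit x i" for i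
    by (auto simp: has_bit_def reduce_def)
  ultimately show "reduce x = encode_instance (nv x) (adj_graph (nv x) (nadj x)) [2, 2 * md x] [1, md x]"
    unfolding list_eq_has_bit[of "reduce x"] has_bit_instance length_instance
    by (simp add: reduce_def out_len_def out_bit_def)
qed

lemma colorable_reduce:
  "colorable 2 [2, 2 * md x] [1, md x] {..<nv x} (adj_graph (nv x) (nadj x)) \<longleftrightarrow>
    csp_solvable (PP x) (CC x) (FF x) (GG x)"
proof -
  have md: "md x = 5 * (PP x * CC x) - 1" by (simp add: md_def wd_def)
  have inj: "inj_on venc (gadget_vertices I (md x))"
    by (rule inj_on_inverseI[of _ vdec]) (rule vdec_venc(2))
  have V: "{..<nv x} = venc ` gadget_vertices I (md x)"
  proof (intro set_eqI iffI)
    fix u assume "u \<in> {..<nv x}"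
    then show "u \<in> venc ` gadget_vertices I (md x)"
      using venc_vdec[of u] vdec_in[of u] by (metis imageI lessThan_iff)
  next
    fix u assume "u \<in> venc ` gadget_vertices I (md x)"
    then show "u \<in> {..<nv x}" using vdec_venc(1) by blast
  qed
  have E: "adj_graph (nv x) (nadj x) = (`) venc ` rel_graph (gadget_vertices I (md x)) (gadget_adj row)"
  proof (intro set_eqI iffI)
    fix e assume "e \<in> adj_graph (nv x) (nadj x)"
    then obtain u v where e: "e = {u, v}" "u < nv x" "v < nv x" "nadj x u v" by (auto simp: adj_graph_def)
    then have "{vdec u, vdec v} \<in> rel_graph (gadget_vertices I (md x)) (gadget_adj row)"
      unfolding rel_graph_def using vdec_in nadj_vdec by blast
    moreover have "e = venc ` {vdec u, vdec v}" using e venc_vdec by simp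
    ultimately show "e \<in> (`) venc ` rel_graph (gadget_vertices I (md x)) (gadget_adj row)" by blast
  next
    fix e assume "e \<in> (`) venc ` rel_graph (gadget_vertices I (md x)) (gadget_adj row)"
    then obtain u v where e: "e = {venc u, venc v}" "u \<in> gadget_vertices I (md x)" "v \<in> gadget_vertices I (md x)"
      "gadget_adj row u v" by (auto simp: rel_graph_def)
    then show "e \<in> adj_graph (nv x) (nadj x)"
      unfolding adj_graph_def using vdec_venc nadj_vdec by (metis (mono_tags, lifting) mem_Collect_eq)
  qed
  have "e \<subseteq> gadget_vertices I (md x)" if "e \<in> rel_graph (gadget_vertices I (md x)) (gadget_adj row)" for e
    using that by (auto simp: rel_graph_def)
  from colorable_image[OF inj this]
  have "colorable 2 [2, 2 * md x] [1, md x] {..<nv x} (adj_graph (nv x) (nadj x)) \<longleftrightarrow>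
      colorable 2 [2, 2 * md x] [1, md x] (gadget_vertices I (md x)) (rel_graph (gadget_vertices I (md x)) (gadget_adj row))"
    unfolding V E .
  also have "\<dots> \<longleftrightarrow> csp_solvable (PP x) (CC x) (FF x) (GG x)"
    unfolding md colorable_iff exact_one_iff ..
  finally show ?thesis .
qed

lemma reduce_correct:
  "reduce x \<in> triangle_regular_coloring_problem 2 \<longleftrightarrow> (\<exists>y. length y \<le> pn x \<and> fst (tm_run M [x, y] (TT x)) = 1)"
proof -
  let ?E = "adj_graph (nv x) (nadj x)"
  have fg: "finite_graph {..<nv x} ?E" by (rule finite_graph_adj[OF nadj_loopless])
  have "reduce x \<in> triangle_regular_coloring_problem 2 \<longleftrightarrow> colorable 2 [2, 2 * md x] [1, md x] {..<nv x} ?E"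
  proof
    assume "reduce x \<in> triangle_regular_coloring_problem 2"
    then obtain n E r c where *: "reduce x = encode_instance n E r c" "finite_graph {..<n} E" "length r = 2" "length c = 2"
      "colorable 2 r c {..<n} E"
      unfolding triangle_regular_coloring_problem_def colorable_def by blast
    \<comment> \<open>Membership only provides some colorable instance with this encoding;
      injectivity identifies it with the constructed one.\<close>
    have "nv x = n \<and> ?E = E \<and> [2, 2 * md x] = r \<and> [1, md x] = c"
      by (rule encode_instance_inject[OF _ fg *(2), where t = 2]) (use * reduce_eq in simp_all)
    with *(5) show "colorable 2 [2, 2 * md x] [1, md x] {..<nv x} ?E" by metis
  next
    assume "colorable 2 [2, 2 * md x] [1, md x] {..<nv x} ?E"
    then obtain col where "edge_coloring 2 ?E col" "triangle_regular 2 [2, 2 * md x] [1, md x] {..<nv x} ?E col"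
      unfolding colorable_def by blast
    then show "reduce x \<in> triangle_regular_coloring_problem 2"
      unfolding triangle_regular_coloring_problem_def reduce_eq using fg
      by (intro CollectI exI[of _ "nv x"] exI[of _ ?E] exI[of _ "[2, 2 * md x]"] exI[of _ "[1, md x]"] conjI exI[of _ col]) auto
  qed
  also have "\<dots> \<longleftrightarrow> (\<exists>y. length y \<le> pn x \<and> fst (tm_run M [x, y] (TT x)) = 1)"
    unfolding colorable_reduce using solvable_imp_accepts accepts_imp_solvable by blast
  finally show ?thesis .
qed

end

end

theorem coloring_problem_NP_hard: "NP_hard (triangle_regular_coloring_problem 2)"
  unfolding NP_hard_def
proof
  fix L assume "L \<in> NP"
  then obtain R p where R: "polytime_decidable R" and L: "\<And>x. x \<in> L \<longleftrightarrow> (\<exists>y. length y \<le> poly p (length x) \<and> R x y)"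
    unfolding NP_def by blast
  from R obtain M q where wf: "wf_tm M"
    and run: "\<And>x y. \<exists>T\<le>poly q (length x + length y). fst (tm_run M [x, y] T) = (if R x y then 1 else 2)"
    unfolding polytime_decidable_def by blast
  obtain en where "bij_betw en {0..<card (local_views M)} (local_views M)"
    using ex_bij_betw_nat_finite[OF finite_local_views] by blast
  then interpret tableau M "card (local_views M)" en p q
    by unfold_locales (use wf in \<open>simp_all add: atLeast0LessThan\<close>)
  \<comment> \<open>All certificates are judged at the same time \<open>TT x\<close>: polynomials
    over the naturals are monotone, and a halted run does not change any more.\<close>
  have "fst (tm_run M [x, y] (TT x)) = 1 \<longleftrightarrow> R x y" if "length y \<le> pn x" for x y
  proof -
    obtain T where T: "T \<le> poly q (length x + length y)" "fst (tm_run M [x, y] T) = (if R x y then 1 else 2)"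
      using run by blast
    have "poly q (length x + length y) \<le> TT x"
      unfolding TT_def by (rule poly_nat_mono) (use that in simp)
    with T(1) have "T \<le> TT x" by simp
    then have "tm_run M [x, y] (TT x) = tm_run M [x, y] T"
      by (intro tm_run_halted_mono) (use T(2) in auto)
    then show ?thesis using T(2) by simp
  qed
  then have "x \<in> L \<longleftrightarrow> reduce x \<in> triangle_regular_coloring_problem 2" for x
    unfolding L reduce_correct using pn_def by auto
  then show "polytime_reducible L (triangle_regular_coloring_problem 2)"
    unfolding polytime_reducible_def using polytime_reduce by blast
qed

theorem theorem1p8: "NP_complete (triangle_regular_coloring_problem 2)"
  unfolding NP_complete_def using coloring_problem_in_NP coloring_problem_NP_hard by blast

end
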